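(* Let $W=\bigoplus_{k=1}^r V_{d_k}$ ($r\ge1$) be a finite-dimensional $\mathrm{SL}_2$-representation with $W^{\mathrm{SL}_2}=\{0\}$, let $L\ge0$ be an integer, and assume that $W$ is not isomorphic to $V_d$ for $d\le4$ nor to $2V_1$. If at least one $d_k$ is odd, then the degree $3-D$ coefficient $\gamma_{0,L}$ of the Laurent series of $\mathrm{Hilb}_{(\mathbb{C}[W]\otimes V_L)^{\mathrm{SL}_2}}(t)$ at $t=1$ is $$\gamma_{0,L}=(L+1)\gamma_0=\frac{(L+1)\,s_\rho(\boldsymbol a)}{s_\delta(\boldsymbol a)},$$ where $\rho=(C-3,C-3,C-3,C-4,\dots,1,0)$ and $\delta=(C-1,C-2,\dots,1,0)$. If all $d_k$ are even, then $$\gamma_{0,L}=\frac{\big(1+(-1)^L\big)(L+1)\gamma_0}{2}=\frac{\big(1+(-1)^L\big)(L+1)\,s_\rho(\boldsymbol a)}{s_\delta(\boldsymbol a)}.$$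
   Context: $V_d$ denotes the irreducible $\mathrm{SL}_2=\mathrm{SL}_2(\mathbb C)$-module of dimension $d+1$ (binary forms of degree $d$), with weights $2i-d$, $0\le i\le d$; $2V_1=V_1\oplus V_1$. $D=\dim_{\mathbb C}W$; $\boldsymbol a$ is the list of positive weights of $W$ with multiplicity, and $C$ is its length. $\mathrm{Hilb}_{(\mathbb{C}[W]\otimes V_L)^{\mathrm{SL}_2}}(t)=\sum_{n\ge0}\dim_{\mathbb C}\big((\mathbb{C}[W]_n\otimes V_L)^{\mathrm{SL}_2}\big)t^n$, a rational function. $\gamma_{m,L}$ denotes the coefficient of $(1-t)^{m+3-D}$ in its Laurent expansion at $t=1$ (even if this makes $\gamma_{0,L}=0$), and $\gamma_m=\gamma_{m,0}$ is the corresponding coefficient for the invariant ring $\mathbb{C}[W]^{\mathrm{SL}_2}$. For $\rho\in\mathbb Z^n$, $s_\rho(x_1,\dots,x_n)=\det(x_i^{\rho_j+n-j})/\det(x_i^{n-j})$, the Schur polynomial (a Laurent polynomial if $\rho$ has negative entries; it is evaluated as such, so repeated entries of $\boldsymbol a$ cause no problem). The sequences $\rho,\delta$ have length $C$; explicitly $\rho_j=C-3$ for $j=1,2$ and $\rho_j=C-j$ for $j\ge3$ (truncated to length $C$; for $C=2$, $\rho=(-1,-1)$). *)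

theory Defs
  imports
    "HOL-Analysis.Analysis"
    "HOL-Computational_Algebra.Computational_Algebra"
    "HOL-Library.Function_Algebras"
    "HOL-Library.Poly_Mapping"
    "Jordan_Normal_Form.Determinant"
begin

no_notation Matrix.vec_index (infixl \<open>$\<close> 100)
no_notation fps_nth (infixl \<open>$\<close> 75)
no_notation Matrix.scalar_prod (infix \<open>\<bullet>\<close> 70)

section \<open>Spaces of complex-valued functions\<close>

text \<open>Every module below is a space of complex-valued functions on a set \<open>X\<close> acted on by
  \<open>SL\<^sub>2\<close>, with action \<open>(g f)(x) = f(g\<inverse> x)\<close>.\<close>

definition fscale :: "complex \<Rightarrow> ('x \<Rightarrow> complex) \<Rightarrow> 'x \<Rightarrow> complex" where
  "fscale c f = (\<lambda>x. c * f x)"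

global_interpretation cfun: vector_space "fscale :: complex \<Rightarrow> ('x \<Rightarrow> complex) \<Rightarrow> 'x \<Rightarrow> complex"
  by unfold_locales (auto simp: fscale_def fun_eq_iff algebra_simps)

definition SL2 :: "(complex^2^2) set" where
  "SL2 = {g. Determinants.det g = 1}"

definition translate ::
  "(complex^2^2 \<Rightarrow> 'x \<Rightarrow> 'x) \<Rightarrow> complex^2^2 \<Rightarrow> ('x \<Rightarrow> complex) \<Rightarrow> 'x \<Rightarrow> complex" where
  "translate act g f = (\<lambda>x. f (act (matrix_inv g) x))"

definition invariants ::
  "(complex^2^2 \<Rightarrow> ('x \<Rightarrow> complex) \<Rightarrow> 'x \<Rightarrow> complex) \<Rightarrow> ('x \<Rightarrow> complex) set \<Rightarrow> ('x \<Rightarrow> complex) set" where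
  "invariants \<alpha> M = {f \<in> M. \<forall>g\<in>SL2. \<alpha> g f = f}"

definition linear_map_on ::
  "('x \<Rightarrow> complex) set \<Rightarrow> (complex \<Rightarrow> 'b \<Rightarrow> 'b) \<Rightarrow> (('x \<Rightarrow> complex) \<Rightarrow> 'b::ab_group_add) \<Rightarrow> bool" where
  "linear_map_on M sc \<phi> \<longleftrightarrow>
     (\<forall>u\<in>M. \<forall>w\<in>M. \<phi> (u + w) = \<phi> u + \<phi> w) \<and> (\<forall>c. \<forall>u\<in>M. \<phi> (fscale c u) = sc c (\<phi> u))"

definition module_iso ::
  "(complex^2^2 \<Rightarrow> ('x \<Rightarrow> complex) \<Rightarrow> 'x \<Rightarrow> complex) \<Rightarrow> ('x \<Rightarrow> complex) set \<Rightarrow>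
   (complex^2^2 \<Rightarrow> ('y \<Rightarrow> complex) \<Rightarrow> 'y \<Rightarrow> complex) \<Rightarrow> ('y \<Rightarrow> complex) set \<Rightarrow> bool" where
  "module_iso \<alpha> M \<beta> N \<longleftrightarrow>
     (\<exists>\<phi>. linear_map_on M fscale \<phi> \<and> bij_betw \<phi> M N \<and> (\<forall>g\<in>SL2. \<forall>u\<in>M. \<phi> (\<alpha> g u) = \<beta> g (\<phi> u)))"


section \<open>The modules \<open>V\<^sub>d\<close>, \<open>W\<close> and \<open>\<complex>[W]\<^sub>n \<otimes> V\<^sub>L\<close>\<close>

definition monomial_form :: "nat \<Rightarrow> nat \<Rightarrow> complex^2 \<Rightarrow> complex" where
  "monomial_form d i = (\<lambda>v. (v $ 1) ^ i * (v $ 2) ^ (d - i))"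

definition binary_forms :: "nat \<Rightarrow> (complex^2 \<Rightarrow> complex) set" where
  "binary_forms d = cfun.span (monomial_form d ` {..d})"

definition actV :: "complex^2^2 \<Rightarrow> (complex^2 \<Rightarrow> complex) \<Rightarrow> complex^2 \<Rightarrow> complex" where
  "actV = translate (\<lambda>g v. g *v v)"

text \<open>An element of \<open>V\<^bsub>d\<^sub>1\<^esub> \<oplus> \<dots> \<oplus> V\<^bsub>d\<^sub>r\<^esub>\<close> is a tuple of binary forms, encoded as the function
  \<open>(k, v) \<mapsto> w\<^sub>k(v)\<close> with \<open>w\<^sub>k = 0\<close> for \<open>k \<ge> r\<close>; indices \<open>k\<close> start at \<open>0\<close>.\<close>

definition form_sum :: "nat list \<Rightarrow> (nat \<times> (complex^2) \<Rightarrow> complex) set" where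
  "form_sum ds = {w. (\<forall>k<length ds. (\<lambda>v. w (k, v)) \<in> binary_forms (ds ! k)) \<and>
                     (\<forall>k\<ge>length ds. \<forall>v. w (k, v) = 0)}"

definition actW :: "complex^2^2 \<Rightarrow> (nat \<times> (complex^2) \<Rightarrow> complex) \<Rightarrow> nat \<times> (complex^2) \<Rightarrow> complex" where
  "actW = translate (\<lambda>g (k, v). (k, g *v v))"

text \<open>The degree \<open>n\<close> part of \<open>\<complex>[M]\<close> is spanned by the products of \<open>n\<close> linear functionals on \<open>M\<close>.
  Functions on \<open>M\<close> are extended by \<open>0\<close> outside \<open>M\<close>, so that equality is equality on \<open>M\<close>.\<close>

definition homog_polys :: "('x \<Rightarrow> complex) set \<Rightarrow> nat \<Rightarrow> (('x \<Rightarrow> complex) \<Rightarrow> complex) set" where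
  "homog_polys M n = cfun.span
     {(\<lambda>w. if w \<in> M then \<Prod>i<n. l i w else 0) | l. \<forall>i<n. linear_map_on M (*) (l i)}"

text \<open>For spaces \<open>A\<close>, \<open>B\<close> of functions on \<open>X\<close>, \<open>Y\<close>, the canonical map from \<open>A \<otimes> B\<close> to functions on
  \<open>X \<times> Y\<close>, sending \<open>f \<otimes> h\<close> to \<open>(x, y) \<mapsto> f(x) h(y)\<close>, is injective; this is its image.\<close>

definition tensor :: "('x \<Rightarrow> complex) set \<Rightarrow> ('y \<Rightarrow> complex) set \<Rightarrow> ('x \<times> 'y \<Rightarrow> complex) set" where
  "tensor A B = cfun.span {(\<lambda>(x, y). f x * h y) | f h. f \<in> A \<and> h \<in> B}"

definition covariants ::
  "nat list \<Rightarrow> nat \<Rightarrow> nat \<Rightarrow> ((nat \<times> (complex^2) \<Rightarrow> complex) \<times> (complex^2) \<Rightarrow> complex) set" where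
  "covariants ds L n =
     invariants (translate (\<lambda>g (w, v). (actW g w, g *v v)))
       (tensor (homog_polys (form_sum ds) n) (binary_forms L))"


section \<open>The Hilbert series and its Laurent expansion at \<open>t = 1\<close>\<close>

definition hilbert_series :: "nat list \<Rightarrow> nat \<Rightarrow> complex fps" where
  "hilbert_series ds L = Abs_fps (\<lambda>n. of_nat (cfun.dim (covariants ds L n)))"

definition poly_in_one_minus :: "complex poly \<Rightarrow> complex fls" where
  "poly_in_one_minus P = fps_to_fls (fps_of_poly (pcompose P [:1, -1:]))"

text \<open>If the power series \<open>F\<close> in \<open>t\<close> is the rational function \<open>P(t)/Q(t)\<close>, its Laurent expansion at
  \<open>t = 1\<close> is the formal Laurent series of \<open>P(1 - s)/Q(1 - s)\<close> in the variable \<open>s = 1 - t\<close>.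
  It is unspecified if \<open>F\<close> is not rational.\<close>

definition laurent_at_one :: "complex fps \<Rightarrow> complex fls" where
  "laurent_at_one F = (THE E. \<exists>P Q. Q \<noteq> 0 \<and> F * fps_of_poly Q = fps_of_poly P \<and>
      E = poly_in_one_minus P / poly_in_one_minus Q)"

lemma pcompose_one_minus_eq_0_iff: "pcompose Q [:1, -1:] = 0 \<longleftrightarrow> Q = (0::complex poly)"
  by (rule pcompose_eq_0_iff) simp

lemma laurent_at_one_eqI:
  assumes Q: "Q \<noteq> 0" and F: "F * fps_of_poly Q = fps_of_poly P"
  shows "laurent_at_one F = poly_in_one_minus P / poly_in_one_minus Q"
  unfolding laurent_at_one_def
proof (rule the_equality)
  show "\<exists>P' Q'. Q' \<noteq> 0 \<and> F * fps_of_poly Q' = fps_of_poly P' \<and>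
    poly_in_one_minus P / poly_in_one_minus Q = poly_in_one_minus P' / poly_in_one_minus Q'"
    using assms by blast
next
  fix E assume "\<exists>P' Q'. Q' \<noteq> 0 \<and> F * fps_of_poly Q' = fps_of_poly P' \<and>
    E = poly_in_one_minus P' / poly_in_one_minus Q'"
  then obtain P' Q' where 1: "Q' \<noteq> 0" "F * fps_of_poly Q' = fps_of_poly P'"
    "E = poly_in_one_minus P' / poly_in_one_minus Q'" by blast
  have "fps_of_poly (P * Q') = fps_of_poly (P' * Q)"
    by (simp add: fps_of_poly_mult F[symmetric] 1(2)[symmetric] mult_ac)
  then have "P * Q' = P' * Q" by (simp add: fps_of_poly_eq_iff)
  then have "poly_in_one_minus P * poly_in_one_minus Q' = poly_in_one_minus P' * poly_in_one_minus Q"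
    by (simp add: poly_in_one_minus_def fls_times_fps_to_fls[symmetric] fps_of_poly_mult[symmetric]
        pcompose_mult[symmetric])
  moreover have "poly_in_one_minus Q \<noteq> 0" "poly_in_one_minus Q' \<noteq> 0"
    using Q 1(1) by (simp_all add: poly_in_one_minus_def pcompose_one_minus_eq_0_iff)
  ultimately show "E = poly_in_one_minus P / poly_in_one_minus Q"
    using 1(3) by (simp add: frac_eq_eq)
qed

definition gamma_coeff :: "nat list \<Rightarrow> nat \<Rightarrow> nat \<Rightarrow> complex" where
  "gamma_coeff ds m L =
     fls_nth (laurent_at_one (hilbert_series ds L)) (int m + 3 - int (cfun.dim (form_sum ds)))"


section \<open>Weights\<close>

definition weights :: "nat \<Rightarrow> int list" where
  "weights d = map (\<lambda>i. 2 * int i - int d) [0..<d + 1]"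

definition positive_weights :: "nat list \<Rightarrow> int list" where
  "positive_weights ds = filter (\<lambda>m. m > 0) (concat (map weights ds))"

definition torus :: "complex \<Rightarrow> complex^2^2" where
  "torus z = (\<chi> i j. if i = j then (if i = 1 then z else inverse z) else 0)"

lemma torus_monomial_form:
  assumes z: "z \<noteq> 0" and i: "i \<le> d"
  shows "torus z \<in> SL2"
    and "actV (torus z) (monomial_form d (d - i)) =
         fscale (z powi (2 * int i - int d)) (monomial_form d (d - i))"
proof -
  show "torus z \<in> SL2"
    using z by (simp add: SL2_def torus_def det_2)
  have prod: "torus z ** torus (inverse z) = Finite_Cartesian_Product.mat 1" "torus (inverse z) ** torus z = Finite_Cartesian_Product.mat 1"
    using z by (auto simp: torus_def matrix_matrix_mult_def Finite_Cartesian_Product.mat_def Finite_Cartesian_Product.vec_eq_iff forall_2 sum_2)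
  have inv: "matrix_inv (torus z) = torus (inverse z)"
    unfolding matrix_inv_def
  proof (rule some_equality)
    show "torus z ** torus (inverse z) = Finite_Cartesian_Product.mat 1 \<and>
      torus (inverse z) ** torus z = Finite_Cartesian_Product.mat 1"
      using prod by blast
  next
    fix B assume "torus z ** B = Finite_Cartesian_Product.mat 1 \<and> B ** torus z = Finite_Cartesian_Product.mat 1"
    then show "B = torus (inverse z)"
      using prod by (metis matrix_mul_assoc matrix_mul_lid matrix_mul_rid)
  qed
  have pw: "inverse z ^ (d - i) * z ^ i = z powi (2 * int i - int d)"
  proof -
    have "z powi (2 * int i - int d) = z powi (int i - int (d - i))"
      using i by (simp add: of_nat_diff)
    also have "\<dots> = z ^ i / z ^ (d - i)"
      using z by (simp add: power_int_diff)
    finally show ?thesis by (simp add: field_simps)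
  qed
  show "actV (torus z) (monomial_form d (d - i)) =
         fscale (z powi (2 * int i - int d)) (monomial_form d (d - i))"
  proof
    fix v :: "complex^2"
    have "(torus (inverse z) *v v) $ 1 = inverse z * v $ 1" "(torus (inverse z) *v v) $ 2 = z * v $ 2"
      by (simp_all add: matrix_vector_mult_def torus_def sum_2)
    then have "actV (torus z) (monomial_form d (d - i)) v =
        (inverse z * v $ 1) ^ (d - i) * (z * v $ 2) ^ i"
      using i by (simp add: actV_def translate_def inv monomial_form_def)
    also have "\<dots> = (inverse z ^ (d - i) * z ^ i) * ((v $ 1) ^ (d - i) * (v $ 2) ^ i)"
      by (simp only: power_mult_distrib mult_ac)
    finally show "actV (torus z) (monomial_form d (d - i)) v =
        fscale (z powi (2 * int i - int d)) (monomial_form d (d - i)) v"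
      unfolding pw using i by (simp add: fscale_def monomial_form_def)
  qed
qed


section \<open>Schur polynomials\<close>

text \<open>Laurent polynomials in the variables \<open>x\<^sub>0, x\<^sub>1, \<dots>\<close>: finitely supported maps from exponent
  vectors to coefficients. They form an integral domain.\<close>

type_synonym laurent_poly = "(nat \<Rightarrow>\<^sub>0 int) \<Rightarrow>\<^sub>0 complex"

definition var_power :: "nat \<Rightarrow> int \<Rightarrow> laurent_poly" where
  "var_power i e = Poly_Mapping.single (Poly_Mapping.single i e) 1"

text \<open>With rows and columns numbered from \<open>0\<close>, the exponent \<open>\<rho>\<^sub>j + n - j\<close> becomes
  \<open>\<rho> ! j + n - (j + 1)\<close>.\<close>

definition alternant :: "int list \<Rightarrow> laurent_poly" where
  "alternant \<rho> = (let n = length \<rho> in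
     Determinant.det (Matrix.mat n n (\<lambda>(i, j). var_power i (\<rho> ! j + int n - int (j + 1)))))"

definition schur_poly :: "int list \<Rightarrow> laurent_poly" where
  "schur_poly \<rho> = (THE S. S * alternant (replicate (length \<rho>) 0) = alternant \<rho>)"

definition laurent_eval :: "laurent_poly \<Rightarrow> complex list \<Rightarrow> complex" where
  "laurent_eval S xs = (\<Sum>e\<in>Poly_Mapping.keys S.
     Poly_Mapping.lookup S e * (\<Prod>i<length xs. (xs ! i) powi (Poly_Mapping.lookup e i)))"

definition schur :: "int list \<Rightarrow> int list \<Rightarrow> complex" where
  "schur \<rho> xs = laurent_eval (schur_poly \<rho>) (map of_int xs)"

definition rho :: "nat \<Rightarrow> int list" where
  "rho C = map (\<lambda>j. if j \<le> 2 then int C - 3 else int C - int j) [1..<C + 1]"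

definition delta :: "nat \<Rightarrow> int list" where
  "delta C = map (\<lambda>j. int C - int j) [1..<C + 1]"

end

theory Submission
  imports Defs
begin

text \<open>In a space of polynomials on which \<open>SL\<^sub>2\<close> acts, the invariants have dimension \<open>dim M\<^sub>0 - dim M\<^sub>2\<close>, the
  difference for the weight spaces of weights 0 and 2. Hence the Hilbert series is a difference of two Fourier coefficients, and by symmetry of the weights it is
  the integral over the unit circle of \<open>2 sin ((L + 1) \<theta>) sin \<theta>\<close> divided by the product of all \<open>1 - t e\<^bsup>i m \<theta>\<^esup>\<close>,
  up to the factor \<open>1 / (2 \<pi>)\<close>. It is rational, so the coefficient of degree \<open>3 - D\<close> is the limit of
  \<open>(1 - t)\<^bsup>D-3\<^esup>\<close> times this integral as \<open>t\<close> tends to 1. After the substitution \<open>\<theta> = (1 - t) x\<close> the dominated convergence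
  theorem gives \<open>(L + 1)\<close> times the integral of \<open>x\<^sup>2 / \<Prod>\<^sub>j (1 + a\<^sub>j\<^sup>2 x\<^sup>2)\<close> over the real line, divided by \<open>\<pi>\<close>; the
  conditions on \<open>W\<close> are what makes domination possible. If all weights are even, \<open>\<theta> = \<pi>\<close> contributes as much as
  \<open>\<theta> = 0\<close>, up to the sign \<open>(-1)\<^sup>L\<close>. The integral equals \<open>s\<^sub>\<rho>(a) / s\<^sub>\<delta>(a)\<close> by a Cauchy-type determinant.\<close>

text \<open>The obstacle is the other roots of unity. Where several sines sin (m \<theta> / 2)
  vanish together, the integrand can grow as fast as at \<theta> = 0, and sin \<theta> need not
  vanish there: for V_3, with positive weights 1 and 3, the primitive cube roots of unity contribute
  to the same order. The domination therefore uses two separate resources. One weight p, equal to 1,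
  or to 2 when all weights are even, has a sine that vanishes only at \<theta> = 0 on the interval
  of integration; it gives integrable decay. Further weights absorb the square of sin \<theta>: a
  weight p or 2, or two weights q and q + 2, whose half-angles differ by \<theta>. Invariants are
  reached infinitesimally: two unipotent one-parameter subgroups generate \<open>SL2\<close>, and a
  polynomial is constant along their orbits iff two derivations kill it. Rationality has a proof of
  its own, because a limit along one sequence determines a Laurent coefficient only for a function
  known to be meromorphic. Repeated weights make both determinants of a Schur quotient vanish, so
  they are approached by distinct real numbers.\<close>

section \<open>Determinants of arrays given by functions of two indices\<close>

definition det_fun :: "nat \<Rightarrow> (nat \<Rightarrow> nat \<Rightarrow> 'a::comm_ring_1) \<Rightarrow> 'a" where
  "det_fun n f = Determinant.det (Matrix.mat n n (\<lambda>(i, j). f i j))"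

lemma det_fun_cong:
  assumes "\<And>i j. i < n \<Longrightarrow> j < n \<Longrightarrow> f i j = g i j"
  shows "det_fun n f = det_fun n g"
proof -
  have "Matrix.mat n n (\<lambda>(i, j). f i j) = Matrix.mat n n (\<lambda>(i, j). g i j)"
    using assms by (intro eq_matI) auto
  then show ?thesis by (simp add: det_fun_def)
qed

lemma det_fun_mult:
  "det_fun n (\<lambda>i j. \<Sum>k<n. f i k * g k j) = det_fun n f * det_fun n g"
proof -
  have "Matrix.mat n n (\<lambda>(i, j). \<Sum>k<n. f i k * g k j) =
      Matrix.mat n n (\<lambda>(i, j). f i j) * Matrix.mat n n (\<lambda>(i, j). g i j)"
    by (intro eq_matI) (auto simp: scalar_prod_def lessThan_atLeast0 intro!: sum.cong)
  then show ?thesis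
    by (simp add: det_fun_def Determinant.det_mult[where n = n])
qed

lemma det_fun_lower:
  assumes "\<And>i j. i < j \<Longrightarrow> j < n \<Longrightarrow> f i j = 0"
  shows "det_fun n f = (\<Prod>i<n. f i i)"
proof -
  have "det_fun n f = prod_list (diag_mat (Matrix.mat n n (\<lambda>(i, j). f i j)))"
    unfolding det_fun_def using assms by (intro det_lower_triangular[where n = n]) auto
  then show ?thesis
    by (simp add: prod_list_diag_prod lessThan_atLeast0)
qed

lemma det_fun_upper:
  assumes "\<And>i j. j < i \<Longrightarrow> i < n \<Longrightarrow> f i j = 0"
  shows "det_fun n f = (\<Prod>i<n. f i i)"
proof -
  have "det_fun n f = prod_list (diag_mat (Matrix.mat n n (\<lambda>(i, j). f i j)))"
    unfolding det_fun_def using assms by (intro det_upper_triangular[where n = n]) auto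
  then show ?thesis
    by (simp add: prod_list_diag_prod lessThan_atLeast0)
qed

lemma det_fun_scale_rows:
  "det_fun n (\<lambda>i j. r i * f i j) = (\<Prod>i<n. r i) * det_fun n f"
proof -
  have "det_fun n (\<lambda>i j. r i * f i j) =
      det_fun n (\<lambda>i j. \<Sum>k<n. (if i = k then r i else 0) * f k j)"
    by (rule det_fun_cong) (simp add: if_distrib[where f = "\<lambda>x. x * _"] cong: if_cong)
  also have "\<dots> = det_fun n (\<lambda>i k. if i = k then r i else 0) * det_fun n f"
    by (rule det_fun_mult)
  also have "det_fun n (\<lambda>i k. if i = k then r i else 0) = (\<Prod>i<n. r i)"
    by (subst det_fun_lower) auto
  finally show ?thesis .
qed

text \<open>Expansion along column 0, whose cofactors do not see that column: the determinant is a
  linear functional of it. This linearity is what lets an integral be pulled through a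
  determinant.\<close>

lemma det_fun_col0:
  assumes "0 < n"
  obtains c where "\<And>f. det_fun n (\<lambda>i j. if j = 0 then f i else g i j) = (\<Sum>i<n. f i * c i)"
proof
  fix f :: "nat \<Rightarrow> 'a"
  define M where "M f = Matrix.mat n n (\<lambda>(i, j). if j = 0 then f i else g i j)" for f
  have "det_fun n (\<lambda>i j. if j = 0 then f i else g i j) = (\<Sum>i<n. M f $$ (i, 0) * cofactor (M f) i 0)"
    unfolding det_fun_def M_def using assms by (intro laplace_expansion_column) auto
  also have "\<dots> = (\<Sum>i<n. f i * cofactor (M (\<lambda>_. 0)) i 0)"
  proof (rule sum.cong)
    fix i assume i: "i \<in> {..<n}"
    have "mat_delete (M f) i 0 = mat_delete (M (\<lambda>_. 0)) i 0"
      using i assms by (intro eq_matI) (auto simp: M_def mat_delete_def)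
    then show "M f $$ (i, 0) * cofactor (M f) i 0 = f i * cofactor (M (\<lambda>_. 0)) i 0"
      using i assms by (simp add: cofactor_def) (simp add: M_def)
  qed simp
  finally show "det_fun n (\<lambda>i j. if j = 0 then f i else g i j) =
    (\<Sum>i<n. f i * cofactor (M (\<lambda>_. 0)) i 0)" .
qed

lemma det_fun_swap01:
  assumes "2 \<le> n"
  shows "det_fun n (\<lambda>i j. f i (if j = 0 then 1 else if j = 1 then 0 else j)) = - det_fun n f"
proof -
  let ?A = "Matrix.mat n n (\<lambda>(i, j). f i j)"
  have "swapcols 0 1 ?A = Matrix.mat n n (\<lambda>(i, j). f i (if j = 0 then 1 else if j = 1 then 0 else j))"
    using assms by (intro eq_matI) (auto simp: mat_swapcols_def)
  moreover have "Determinant.det (swapcols 0 1 ?A) = - Determinant.det ?A"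
    using assms by (intro det_swapcols[where n = n]) auto
  ultimately show ?thesis by (simp add: det_fun_def)
qed

lemma det_fun_identical_cols:
  assumes "i < n" "j < n" "i \<noteq> j" "\<And>k. k < n \<Longrightarrow> f k i = f k j"
  shows "det_fun n f = 0"
  unfolding det_fun_def using assms
  by (intro Determinant.det_identical_columns[where n = n and i = i and j = j])
     (auto intro!: eq_vecI)

lemma det_fun_hom:
  assumes "comm_ring_hom h"
  shows "h (det_fun n f) = det_fun n (\<lambda>i j. h (f i j))"
proof -
  have "map_mat h (Matrix.mat n n (\<lambda>(i, j). f i j)) = Matrix.mat n n (\<lambda>(i, j). h (f i j))"
    by (intro eq_matI) auto
  then show ?thesis
    using comm_ring_hom.hom_det[OF assms, of "Matrix.mat n n (\<lambda>(i, j). f i j)"]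
    by (simp add: det_fun_def)
qed

section \<open>Newton interpolation and alternants\<close>

definition newton :: "(nat \<Rightarrow> 'a::comm_ring_1) \<Rightarrow> nat \<Rightarrow> 'a \<Rightarrow> 'a" where
  "newton x k z = (\<Prod>l<k. z - x l)"

text \<open>\<open>divdiff x e k\<close> is the divided difference of \<open>z \<mapsto> z\<^sup>e\<close> at \<open>x\<^sub>0, \<dots>, x\<^sub>k\<close>.\<close>

fun divdiff :: "(nat \<Rightarrow> 'a::comm_ring_1) \<Rightarrow> nat \<Rightarrow> nat \<Rightarrow> 'a" where
  "divdiff x 0 k = (if k = 0 then 1 else 0)"
| "divdiff x (Suc e) k = x k * divdiff x e k + (if k = 0 then 0 else divdiff x e (k - 1))"

lemma newton_eq_0: "i < k \<Longrightarrow> newton x k (x i) = 0"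
  unfolding newton_def by (rule prod_zero) auto

text \<open>Newton's formula without division, so it holds in every commutative ring, in particular
  for Laurent polynomials. Multiplication by z sends N_k to N_(k+1) + x_k N_k, which is the
  recursion of \<open>divdiff\<close>.\<close>

lemma newton_interpolation:
  assumes "i < n"
  shows "x i ^ e = (\<Sum>k<n. divdiff x e k * newton x k (x i))"
proof (induction e)
  case 0
  have "(\<Sum>k<n. divdiff x 0 k * newton x k (x i)) = (\<Sum>k<n. if k = 0 then 1 else 0)"
    by (intro sum.cong) (auto simp: newton_def)
  then show ?case using assms by simp
next
  case (Suc e)
  obtain m where n: "n = Suc m" using assms by (cases n) auto
  let ?N = "\<lambda>k. newton x k (x i)"
  have N: "x i * ?N k = ?N (Suc k) + x k * ?N k" for k
    by (simp add: newton_def algebra_simps)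
  have "x i ^ Suc e = (\<Sum>k<n. divdiff x e k * (x i * ?N k))"
    using Suc by (simp add: sum_distrib_left mult_ac)
  also have "\<dots> = (\<Sum>k<n. divdiff x e k * ?N (Suc k)) + (\<Sum>k<n. x k * divdiff x e k * ?N k)"
    by (simp add: N sum.distrib distrib_left mult_ac)
  \<comment> \<open>The top term contains the factor x_i - x_i because i < n.\<close>
  also have "(\<Sum>k<n. divdiff x e k * ?N (Suc k)) = (\<Sum>k<m. divdiff x e k * ?N (Suc k))"
    using assms by (simp add: n newton_eq_0)
  also have "\<dots> = (\<Sum>k<n. (if k = 0 then 0 else divdiff x e (k - 1)) * ?N k)"
    unfolding n by (subst sum.lessThan_Suc_shift) simp
  finally show ?case
    by (simp add: sum.distrib[symmetric] algebra_simps del: mult_eq_if)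
qed

lemma divdiff_eq_0: "e < k \<Longrightarrow> divdiff x e k = 0"
  by (induction e arbitrary: k) auto

lemma divdiff_eq_1: "divdiff x k k = 1"
  by (induction k) (auto simp: divdiff_eq_0)

definition vdm :: "nat \<Rightarrow> (nat \<Rightarrow> 'a::comm_ring_1) \<Rightarrow> 'a" where
  "vdm n x = det_fun n (\<lambda>i j. x i ^ (n - 1 - j))"

text \<open>Expansion in the Newton basis factors the matrix: an evaluation matrix that depends on x
  only, times a matrix of divided differences. Indexing by n - 1 - k makes the first factor the one
  that belongs to \<open>vdm\<close>.\<close>

lemma det_powers_newton:
  "det_fun n (\<lambda>i j. x i ^ e j) =
     det_fun n (\<lambda>i k. newton x (n - 1 - k) (x i)) * det_fun n (\<lambda>k j. divdiff x (e j) (n - 1 - k))"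
proof -
  have "x i ^ e j = (\<Sum>k<n. newton x (n - 1 - k) (x i) * divdiff x (e j) (n - 1 - k))" if "i < n" for i j
  proof -
    have "x i ^ e j = (\<Sum>k<n. divdiff x (e j) k * newton x k (x i))"
      by (rule newton_interpolation[OF that])
    also have "\<dots> = (\<Sum>k<n. divdiff x (e j) (n - Suc k) * newton x (n - Suc k) (x i))"
      by (subst sum.nat_diff_reindex) simp
    finally show ?thesis by (simp add: mult_ac)
  qed
  then show ?thesis
    by (subst det_fun_mult[symmetric]) (intro det_fun_cong)
qed

lemma vdm_newton: "vdm n x = det_fun n (\<lambda>i k. newton x (n - 1 - k) (x i))"
proof -
  have "det_fun n (\<lambda>k j. divdiff x (n - 1 - j) (n - 1 - k)) = (1 :: 'a)"
    by (subst det_fun_lower) (auto simp: divdiff_eq_0 divdiff_eq_1)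
  then show ?thesis unfolding vdm_def by (subst det_powers_newton) simp
qed

text \<open>This divisibility in an arbitrary commutative ring is the source of the existence of
  Schur polynomials.\<close>

lemma vdm_dvd_det_powers: "vdm n x dvd det_fun n (\<lambda>i j. x i ^ e j)"
  by (subst det_powers_newton) (simp add: vdm_newton)

text \<open>The constant c is the sign of the reversal of the columns. It is left implicit because
  it is the same for all x and cancels in quotients.\<close>

lemma vdm_prod:
  obtains c :: "'a::comm_ring_1" where "c * c = 1"
    "\<And>x. vdm n x = c * (\<Prod>i<n. \<Prod>l<i. x i - x l)"
proof
  define P where "P k j = (if k + j = n - 1 then 1 else 0 :: 'a)" for k j
  have P: "(\<Sum>k<n. f k * P k j) = f (n - 1 - j)" if "j < n" for f j
  proof -
    have "(\<Sum>k<n. f k * P k j) = (\<Sum>k<n. if k = n - 1 - j then f k else 0)"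
      using that by (intro sum.cong) (auto simp: P_def)
    then show ?thesis using that by simp
  qed
  show "det_fun n P * det_fun n P = 1"
  proof -
    have "det_fun n P * det_fun n P = det_fun n (\<lambda>i j. \<Sum>k<n. P i k * P k j)"
      by (rule det_fun_mult[symmetric])
    also have "\<dots> = det_fun n (\<lambda>i j. if i = j then 1 else 0)"
      by (rule det_fun_cong) (simp add: P, auto simp: P_def)
    also have "\<dots> = 1" by (subst det_fun_lower) auto
    finally show ?thesis .
  qed
  fix x :: "nat \<Rightarrow> 'a"
  have "vdm n x = det_fun n (\<lambda>i j. \<Sum>k<n. newton x k (x i) * P k j)"
    unfolding vdm_newton by (rule det_fun_cong) (simp add: P)
  also have "\<dots> = det_fun n (\<lambda>i k. newton x k (x i)) * det_fun n P"
    by (rule det_fun_mult)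
  also have "det_fun n (\<lambda>i k. newton x k (x i)) = (\<Prod>i<n. \<Prod>l<i. x i - x l)"
    by (subst det_fun_lower) (auto simp: newton_eq_0, simp add: newton_def)
  finally show "vdm n x = det_fun n P * (\<Prod>i<n. \<Prod>l<i. x i - x l)" by (simp add: mult.commute)
qed

lemma vdm_neq_0:
  fixes x :: "nat \<Rightarrow> 'a::idom"
  assumes "inj_on x {..<n}"
  shows "vdm n x \<noteq> 0"
proof -
  obtain c :: 'a where c: "c * c = 1" "\<And>x. vdm n x = c * (\<Prod>i<n. \<Prod>l<i. x i - x l)"
    using vdm_prod[where 'a = 'a and n = n] by blast
  have "x i \<noteq> x l" if "l < i" "i < n" for i l
    using assms that by (metis inj_onD lessThan_iff less_trans less_irrefl)
  then show ?thesis using c by auto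
qed

section \<open>Schur polynomials and their evaluation\<close>

lemma laurent_eval_superset:
  assumes "finite K" "Poly_Mapping.keys S \<subseteq> K"
  shows "laurent_eval S xs =
    (\<Sum>e\<in>K. Poly_Mapping.lookup S e * (\<Prod>i<length xs. (xs ! i) powi (Poly_Mapping.lookup e i)))"
  unfolding laurent_eval_def using assms
  by (intro sum.mono_neutral_left) (auto simp: in_keys_iff)

lemma laurent_eval_add: "laurent_eval (S + T) xs = laurent_eval S xs + laurent_eval T xs"
proof -
  let ?K = "Poly_Mapping.keys S \<union> Poly_Mapping.keys T"
  have "Poly_Mapping.keys (S + T) \<subseteq> ?K" by (rule Poly_Mapping.keys_add)
  then show ?thesis
    by (simp add: laurent_eval_superset[of ?K] lookup_add distrib_right sum.distrib)
qed

lemma laurent_eval_sum: "laurent_eval (\<Sum>i\<in>A. f i) xs = (\<Sum>i\<in>A. laurent_eval (f i) xs)"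
  by (induction A rule: infinite_finite_induct) (auto simp: laurent_eval_add, auto simp: laurent_eval_def)

lemma laurent_eval_single:
  "laurent_eval (Poly_Mapping.single e c) xs = c * (\<Prod>i<length xs. (xs ! i) powi (Poly_Mapping.lookup e i))"
  by (simp add: laurent_eval_superset[of "{e}"])

lemma poly_mapping_sum_single:
  "(\<Sum>e\<in>Poly_Mapping.keys S. Poly_Mapping.single e (Poly_Mapping.lookup S e)) = S"
proof (rule poly_mapping_eqI)
  fix k
  have "Poly_Mapping.lookup (\<Sum>e\<in>Poly_Mapping.keys S. Poly_Mapping.single e (Poly_Mapping.lookup S e)) k =
    (\<Sum>e\<in>Poly_Mapping.keys S. if e = k then Poly_Mapping.lookup S e else 0)"
    by (simp add: Poly_Mapping.lookup_sum lookup_single when_def)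
  also have "\<dots> = Poly_Mapping.lookup S k" by (simp add: in_keys_iff)
  finally show "Poly_Mapping.lookup (\<Sum>e\<in>Poly_Mapping.keys S. Poly_Mapping.single e (Poly_Mapping.lookup S e)) k
    = Poly_Mapping.lookup S k" .
qed

lemma laurent_eval_mult:
  assumes "0 \<notin> set xs"
  shows "laurent_eval (S * T) xs = laurent_eval S xs * laurent_eval T xs"
proof -
  define m where "m e = (\<Prod>i<length xs. (xs ! i) powi (Poly_Mapping.lookup e i))" for e :: "nat \<Rightarrow>\<^sub>0 int"
  have m: "m (e + e') = m e * m e'" for e e'
  proof -
    have "xs ! i \<noteq> 0" if "i < length xs" for i using assms that by (metis nth_mem)
    then show ?thesis
      by (simp add: m_def lookup_add power_int_add prod.distrib)
  qed
  let ?s = "\<lambda>S e. Poly_Mapping.single e (Poly_Mapping.lookup S e)"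
  have "S * T = (\<Sum>a\<in>Poly_Mapping.keys S. ?s S a) * (\<Sum>b\<in>Poly_Mapping.keys T. ?s T b)"
    by (simp only: poly_mapping_sum_single)
  also have "\<dots> = (\<Sum>a\<in>Poly_Mapping.keys S. \<Sum>b\<in>Poly_Mapping.keys T.
      Poly_Mapping.single (a + b) (Poly_Mapping.lookup S a * Poly_Mapping.lookup T b))"
    by (simp add: sum_product mult_single)
  also have "laurent_eval \<dots> xs =
      (\<Sum>a\<in>Poly_Mapping.keys S. \<Sum>b\<in>Poly_Mapping.keys T. Poly_Mapping.lookup S a * Poly_Mapping.lookup T b * m (a + b))"
    by (simp add: laurent_eval_sum laurent_eval_single m_def)
  also have "\<dots> = laurent_eval S xs * laurent_eval T xs"
    by (simp add: laurent_eval_def sum_product m m_def[symmetric] mult_ac)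
  finally show ?thesis .
qed

lemma laurent_eval_hom:
  assumes "0 \<notin> set xs"
  shows "comm_ring_hom (\<lambda>S. laurent_eval S xs)"
proof
  show "laurent_eval 1 xs = 1"
    by (simp add: laurent_eval_single flip: single_one)
qed (auto simp: laurent_eval_add laurent_eval_mult[OF assms], simp add: laurent_eval_def)

lemma laurent_eval_var_power:
  assumes "i < length xs"
  shows "laurent_eval (var_power i e) xs = (xs ! i) powi e"
proof -
  have "(\<Prod>k<length xs. (xs ! k) powi Poly_Mapping.lookup (Poly_Mapping.single i e) k) =
      (\<Prod>k<length xs. if k = i then (xs ! k) powi e else 1)"
    by (intro prod.cong) (auto simp: lookup_single when_def)
  then show ?thesis using assms by (simp add: var_power_def laurent_eval_single)
qed

lemma alternant_eq_det_fun:
  "alternant \<rho> = det_fun (length \<rho>) (\<lambda>i j. var_power i (\<rho> ! j + int (length \<rho>) - int (j + 1)))"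
  by (simp add: alternant_def det_fun_def Let_def)

lemma laurent_eval_alternant:
  assumes "0 \<notin> set xs" "length \<rho> = length xs"
  shows "laurent_eval (alternant \<rho>) xs =
    det_fun (length xs) (\<lambda>i j. (xs ! i) powi (\<rho> ! j + int (length xs) - int (j + 1)))"
  unfolding alternant_eq_det_fun assms(2) det_fun_hom[OF laurent_eval_hom[OF assms(1)]]
  by (rule det_fun_cong) (simp add: laurent_eval_var_power)

lemma laurent_eval_alternant_0:
  assumes "0 \<notin> set xs" "length xs = n"
  shows "laurent_eval (alternant (replicate n 0)) xs = vdm n (\<lambda>i. xs ! i)"
  using assms(2)[symmetric] by (subst laurent_eval_alternant[OF assms(1)]) 
     (auto simp: vdm_def nat_diff_split intro!: det_fun_cong simp flip: power_int_of_nat)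

text \<open>Evaluation at the distinct points 1, ..., n gives a Vandermonde determinant that is not
  0.\<close>

lemma alternant_0_neq_0: "alternant (replicate n 0) \<noteq> 0"
proof
  assume "alternant (replicate n 0) = 0"
  then have "laurent_eval (alternant (replicate n 0)) (map of_nat [1..<n+1]) = 0"
    by (simp add: laurent_eval_def)
  then have "vdm n (\<lambda>i. map (of_nat :: nat \<Rightarrow> complex) [1..<n+1] ! i) = 0"
    by (subst (asm) laurent_eval_alternant_0) auto
  moreover have "inj_on (\<lambda>i. map (of_nat :: nat \<Rightarrow> complex) [1..<n+1] ! i) {..<n}"
    by (auto simp: inj_on_def simp del: upt_Suc)
  ultimately show False using vdm_neq_0 by blast
qed

lemma var_power_add: "var_power i (a + b) = var_power i a * var_power i b"
  by (simp add: var_power_def mult_single single_add)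

lemma var_power_of_nat: "var_power i (int n) = var_power i 1 ^ n"
proof (induction n)
  case 0 then show ?case by (simp add: var_power_def)
next
  case (Suc n)
  have "var_power i (int (Suc n)) = var_power i (1 + int n)" by simp
  then show ?case by (simp only: var_power_add Suc power_Suc)
qed

text \<open>Negative exponents are removed by pulling the unit \<open>var_power i (- int c)\<close>
  out of row i; what remains is a determinant of ordinary powers.\<close>

lemma alternant_0_dvd: "alternant (replicate (length \<rho>) 0) dvd alternant \<rho>"
proof -
  let ?n = "length \<rho>"
  \<comment> \<open>This shift is large enough to make every exponent of the alternant a natural
    number \<open>e j\<close>.\<close>
  define c where "c = nat (\<Sum>j<?n. \<bar>\<rho> ! j\<bar>)"
  define e where "e j = nat (\<rho> ! j + int ?n - int (j + 1) + int c)" for j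
  have e: "\<rho> ! j + int ?n - int (j + 1) = - int c + int (e j)" if "j < ?n" for j
  proof -
    have "\<bar>\<rho> ! j\<bar> \<le> (\<Sum>j<?n. \<bar>\<rho> ! j\<bar>)" using that by (intro member_le_sum) auto
    then have "0 \<le> \<rho> ! j + int ?n - int (j + 1) + int c"
      using that unfolding c_def by linarith
    then show ?thesis by (simp add: e_def)
  qed
  have 1: "alternant \<rho> = det_fun ?n (\<lambda>i j. var_power i (- int c) * var_power i 1 ^ e j)"
    unfolding alternant_eq_det_fun
    by (rule det_fun_cong) (simp only: e var_power_add var_power_of_nat)
  have 2: "alternant (replicate ?n 0) = vdm ?n (\<lambda>i. var_power i 1)"
    unfolding alternant_eq_det_fun vdm_def
    by (auto simp: var_power_of_nat[symmetric] of_nat_diff algebra_simps intro!: det_fun_cong)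
  show ?thesis
    unfolding 1 2 det_fun_scale_rows by (intro dvd_mult vdm_dvd_det_powers)
qed

text \<open>The definite description denotes: a quotient exists by divisibility and is unique
  because Laurent polynomials form an integral domain.\<close>

lemma schur_poly_mult_alternant: "schur_poly \<rho> * alternant (replicate (length \<rho>) 0) = alternant \<rho>"
  unfolding schur_poly_def
proof (rule theI')
  let ?V = "alternant (replicate (length \<rho>) 0)"
  obtain S where S: "S * ?V = alternant \<rho>"
    using alternant_0_dvd[of \<rho>] by (metis dvdE mult.commute)
  show "\<exists>!S. S * ?V = alternant \<rho>"
  proof (rule ex1I[of _ S])
    fix T assume "T * ?V = alternant \<rho>"
    then show "T = S" using S alternant_0_neq_0 by (metis mult_right_cancel)
  qed (rule S)
qed

lemma laurent_eval_schur_poly: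
  assumes "0 \<notin> set xs" "length \<rho> = length xs"
  shows "laurent_eval (schur_poly \<rho>) xs * vdm (length xs) (\<lambda>i. xs ! i) =
    det_fun (length xs) (\<lambda>i j. (xs ! i) powi (\<rho> ! j + int (length xs) - int (j + 1)))"
  using arg_cong[OF schur_poly_mult_alternant[of \<rho>], of "\<lambda>S. laurent_eval S xs"] assms
  by (simp add: laurent_eval_mult laurent_eval_alternant_0 del: length_replicate)
     (simp add: laurent_eval_alternant)

lemma tendsto_laurent_eval:
  assumes "0 \<notin> set xs" "\<And>i. i < length xs \<Longrightarrow> ((\<lambda>m. f m i) \<longlongrightarrow> xs ! i) F"
  shows "((\<lambda>m. laurent_eval S (map (f m) [0..<length xs])) \<longlongrightarrow> laurent_eval S xs) F"
proof -
  have "((\<lambda>m. \<Sum>e\<in>Poly_Mapping.keys S. Poly_Mapping.lookup S e *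
      (\<Prod>i<length xs. (f m i) powi (Poly_Mapping.lookup e i))) \<longlongrightarrow> laurent_eval S xs) F"
    unfolding laurent_eval_def using assms
    by (intro tendsto_intros) (auto simp: in_set_conv_nth)
  then show ?thesis by (simp add: laurent_eval_def)
qed


section \<open>The integral representation of the quotient of Schur polynomials\<close>

lemma has_bochner_integral_inverse_1_plus_square:
  assumes "0 < r"
  shows "has_bochner_integral lborel (\<lambda>s::real. 1 / (1 + (r * s)\<^sup>2)) (pi / r)"
proof -
  have lim: "((\<lambda>s. arctan (r * s) / r) \<longlongrightarrow> (pi / 2) / r) at_top"
    using assms
    by (intro tendsto_intros filterlim_compose[OF tendsto_arctan_at_top]
        filterlim_tendsto_pos_mult_at_top[OF tendsto_const _ filterlim_ident]) auto
  have lim': "((\<lambda>s. arctan (r * s) / r) \<longlongrightarrow> (- (pi / 2)) / r) at_bot"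
    using assms
    by (intro tendsto_intros filterlim_compose[OF tendsto_arctan_at_bot]
        filterlim_tendsto_pos_mult_at_bot[OF tendsto_const _ filterlim_ident]) auto
  have D: "DERIV (\<lambda>s. arctan (r * s) / r) s :> 1 / (1 + (r * s)\<^sup>2)" for s
  proof -
    have "DERIV (\<lambda>s. arctan (r * s) / r) s :> inverse (1 + (r * s)\<^sup>2) * r / r"
      using assms by (auto intro!: derivative_eq_intros)
    then show ?thesis using assms by (simp add: inverse_eq_divide)
  qed
  have cont: "isCont (\<lambda>s. 1 / (1 + (r * s)\<^sup>2)) s" for s
    by (intro continuous_intros) (smt (verit) zero_le_power2)
  have "set_integrable lborel (einterval (-\<infinity>) \<infinity>) (\<lambda>s. 1 / (1 + (r * s)\<^sup>2))"
    "(LBINT s=-\<infinity>..\<infinity>. 1 / (1 + (r * s)\<^sup>2)) = (pi / 2) / r - (- (pi / 2)) / r"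
    using D cont lim lim'
    by (intro interval_integral_FTC_nonneg[where F = "\<lambda>s. arctan (r * s) / r"];
        simp add: ereal_tendsto_simps)+
  then show ?thesis
    by (simp add: has_bochner_integral_iff interval_lebesgue_integral_def set_integrable_def
        set_lebesgue_integral_def einterval_def add_divide_distrib[symmetric])
qed

text \<open>The division by \<pi> is chosen so that the value is exactly the quotient s_\<rho> /
  s_\<delta>.\<close>

definition lap_integral :: "real list \<Rightarrow> real" where
  "lap_integral rs = (LINT s|lborel. s\<^sup>2 / (\<Prod>r\<leftarrow>rs. 1 + (r * s)\<^sup>2)) / pi"

text \<open>Scaling row i by 1 + y_i u clears the denominator in column 0 and adds u times column j
  - 1 to each later column j. This is multiplication by the unitriangular matrix \<open>U\<close>,
  so the Vandermonde determinant is recovered.\<close>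

lemma det_cauchy_column:
  fixes y :: "nat \<Rightarrow> real"
  assumes u: "0 \<le> u" and y: "\<And>i. i < n \<Longrightarrow> 0 < y i" and n: "0 < n"
  shows "det_fun n (\<lambda>i j. if j = 0 then y i ^ (n - 1) / (1 + y i * u) else y i ^ (n - 1 - j)) =
    vdm n y / (\<Prod>i<n. 1 + y i * u)"
proof -
  let ?f = "\<lambda>i j. if j = 0 then y i ^ (n - 1) / (1 + y i * u) else y i ^ (n - 1 - j)"
  define U :: "nat \<Rightarrow> nat \<Rightarrow> real"
    where "U k j = (if k = j then 1 else 0) + (if 0 < j \<and> k = j - 1 then u else 0)" for k j
  have pos: "0 < 1 + y i * u" if "i < n" for i
    using y[OF that] u by (simp add: add_pos_nonneg)
  have "(\<Prod>i<n. 1 + y i * u) * det_fun n ?f = det_fun n (\<lambda>i j. (1 + y i * u) * ?f i j)"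
    by (rule det_fun_scale_rows[symmetric])
  also have "\<dots> = det_fun n (\<lambda>i j. \<Sum>k<n. y i ^ (n - 1 - k) * U k j)"
  proof (rule det_fun_cong)
    fix i j assume ij: "i < n" "j < n"
    have "(\<Sum>k<n. y i ^ (n - 1 - k) * U k j) =
        (\<Sum>k<n. if k = j then y i ^ (n - 1 - k) else 0) +
        (\<Sum>k<n. if k = j - 1 then (if 0 < j then y i ^ (n - 1 - k) * u else 0) else 0)"
      unfolding sum.distrib[symmetric] by (intro sum.cong) (auto simp: U_def distrib_left)
    also have "\<dots> = y i ^ (n - 1 - j) + (if 0 < j then y i ^ (n - 1 - (j - 1)) * u else 0)"
      using ij by auto
    also have "\<dots> = (1 + y i * u) * ?f i j"
    proof (cases j)
      case 0
      then show ?thesis using pos[OF ij(1)] by simp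
    next
      case (Suc l)
      have "n - 1 - l = Suc (n - 1 - j)" using ij Suc by simp
      then show ?thesis using Suc by (simp add: algebra_simps)
    qed
    finally show "(1 + y i * u) * ?f i j = (\<Sum>k<n. y i ^ (n - 1 - k) * U k j)" by simp
  qed
  also have "\<dots> = vdm n y * det_fun n U"
    unfolding vdm_def by (rule det_fun_mult)
  also have "det_fun n U = 1"
    by (subst det_fun_upper) (auto simp: U_def intro!: prod.neutral)
  finally have eq: "(\<Prod>i<n. 1 + y i * u) * det_fun n ?f = vdm n y" by simp
  have "(\<Prod>i<n. 1 + y i * u) \<noteq> 0" using pos by (auto simp: less_le)
  with eq show ?thesis by (simp add: field_simps)
qed

text \<open>In the second column, \<open>x\<^bsup>2n-5\<^esup> = (1/\<pi>) \<integral> x\<^bsup>2n-4\<^esup> / (1 + x\<^sup>2 s\<^sup>2) ds\<close>; the other columns are even powers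
  of \<open>x\<close>, so the determinant under the integral is of Cauchy type.\<close>

lemma det_rho_integral:
  assumes len: "length rs = n" and n: "2 \<le> n" and pos: "\<And>r. r \<in> set rs \<Longrightarrow> 0 < r"
  shows "det_fun n (\<lambda>i j. (rs ! i) powi (rho n ! j + int n - int (j + 1))) =
    lap_integral rs * vdm n (\<lambda>i. (rs ! i)\<^sup>2)"
proof -
  define r where "r i = rs ! i" for i
  define y where "y i = (r i)\<^sup>2" for i
  have r: "0 < r i" if "i < n" for i using that len pos by (simp add: r_def)
  have y: "0 < y i" if "i < n" for i using r[OF that] by (simp add: y_def)
  define g where "g f = det_fun n (\<lambda>i j. if j = 0 then f i else y i ^ (n - 1 - j))" for f
  obtain c where c: "g f = (\<Sum>i<n. f i * c i)" for f
    using det_fun_col0[of n "\<lambda>i j. y i ^ (n - 1 - j)"] n unfolding g_def by auto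
  \<comment> \<open>The vector y^(n-2) already stands in column 1.\<close>
  have g0: "g (\<lambda>i. y i ^ (n - 2)) = 0"
    unfolding g_def using n by (intro det_fun_identical_cols[of 0 n 1]) (auto simp: numeral_2_eq_2)
  have g_u: "g (\<lambda>i. y i ^ (n - 2) / (1 + y i * u)) = - (u * vdm n y / (\<Prod>i<n. 1 + y i * u))"
    if u: "0 \<le> u" for u
  proof -
    \<comment> \<open>One division step raises the numerator to the y^(n-1) of
      \<open>det_cauchy_column\<close>, and its polynomial part is killed by \<open>g0\<close>. The
      factor u left over becomes the numerator s^2 of \<open>lap_integral\<close>.\<close>
    have "y i ^ (n - 2) / (1 + y i * u) = y i ^ (n - 2) - u * (y i ^ (n - 1) / (1 + y i * u))"
      if "i < n" for i
    proof -
      have "1 + y i * u \<noteq> 0"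
        using mult_nonneg_nonneg[OF less_imp_le[OF y[OF that]] u] by linarith
      moreover have "y i ^ (n - 1) = y i * y i ^ (n - 2)"
        using n by (metis Suc_1 Suc_diff_le diff_Suc_Suc power_Suc)
      ultimately show ?thesis by (simp add: field_simps)
    qed
    then have "g (\<lambda>i. y i ^ (n - 2) / (1 + y i * u)) =
        g (\<lambda>i. y i ^ (n - 2)) - u * g (\<lambda>i. y i ^ (n - 1) / (1 + y i * u))"
      unfolding c by (simp add: left_diff_distrib sum_subtractf sum_distrib_left mult.assoc)
    also have "g (\<lambda>i. y i ^ (n - 1) / (1 + y i * u)) = vdm n y / (\<Prod>i<n. 1 + y i * u)"
      unfolding g_def using y u n by (intro det_cauchy_column) auto
    finally show ?thesis by (simp add: g0)
  qed
  have ys: "1 + y i * s\<^sup>2 = 1 + (r i * s)\<^sup>2" for i s by (simp add: y_def power_mult_distrib)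
  have "has_bochner_integral lborel (\<lambda>s. \<Sum>i<n. (y i ^ (n - 2) * (1 / (1 + (r i * s)\<^sup>2))) * c i)
      (\<Sum>i<n. (y i ^ (n - 2) * (pi / r i)) * c i)"
    using r by (intro has_bochner_integral_sum has_bochner_integral_mult_left
        has_bochner_integral_mult_right has_bochner_integral_inverse_1_plus_square) auto
  also have "(\<Sum>i<n. (y i ^ (n - 2) * (pi / r i)) * c i) = pi * g (\<lambda>i. y i ^ (n - 2) / r i)"
    by (simp add: c sum_distrib_left mult_ac)
  also have "(\<lambda>s. \<Sum>i<n. (y i ^ (n - 2) * (1 / (1 + (r i * s)\<^sup>2))) * c i) =
      (\<lambda>s. g (\<lambda>i. y i ^ (n - 2) / (1 + y i * s\<^sup>2)))"
    by (simp add: c ys)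
  also have "\<dots> = (\<lambda>s. - vdm n y * (s\<^sup>2 / (\<Prod>r\<leftarrow>rs. 1 + (r * s)\<^sup>2)))"
  proof
    fix s :: real
    show "g (\<lambda>i. y i ^ (n - 2) / (1 + y i * s\<^sup>2)) = - vdm n y * (s\<^sup>2 / (\<Prod>r\<leftarrow>rs. 1 + (r * s)\<^sup>2))"
      unfolding g_u[OF zero_le_power2] unfolding ys
      by (simp add: prod.list_conv_set_nth len atLeast0LessThan r_def)
  qed
  finally have "pi * g (\<lambda>i. y i ^ (n - 2) / r i) = - vdm n y * (LINT s|lborel. s\<^sup>2 / (\<Prod>r\<leftarrow>rs. 1 + (r * s)\<^sup>2))"
    by (simp add: has_bochner_integral_iff del: integral_mult_right_zero integral_mult_left_zero integral_minus
         add: integral_mult_right_zero[symmetric] integral_minus[symmetric])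
  then have g_int: "g (\<lambda>i. y i ^ (n - 2) / r i) = - lap_integral rs * vdm n y"
    by (simp add: lap_integral_def field_simps)
  define e where "e j = rho n ! j + int n - int (j + 1)" for j
  have e: "e 0 = int (2 * (n - 2))" "e 1 = int (2 * (n - 2)) - 1"
    "\<And>j. 2 \<le> j \<Longrightarrow> j < n \<Longrightarrow> e j = int (2 * (n - 1 - j))"
    using n by (auto simp: e_def rho_def simp del: upt_Suc)
  \<comment> \<open>The swap moves the only odd exponent into column 0, the column that g varies.
    Its sign cancels the one in \<open>g_int\<close>.\<close>
  have "- det_fun n (\<lambda>i j. r i powi e j) = det_fun n (\<lambda>i j. r i powi e (if j = 0 then 1 else if j = 1 then 0 else j))"
    by (rule det_fun_swap01[OF n, symmetric])
  also have "\<dots> = g (\<lambda>i. y i ^ (n - 2) / r i)"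
    unfolding g_def
  proof (rule det_fun_cong)
    fix i j assume ij: "i < n" "j < n"
    have p: "r i powi int (2 * k) = y i ^ k" for k
      by (simp only: power_int_of_nat y_def power_mult)
    consider "j = 0" | "j = 1" | "2 \<le> j" by linarith
    then show "r i powi e (if j = 0 then 1 else if j = 1 then 0 else j) =
        (if j = 0 then y i ^ (n - 2) / r i else y i ^ (n - 1 - j))"
    proof cases
      case 1
      have "r i powi e 1 = y i ^ (n - 2) / r i"
        using r[OF ij(1)] p[of "n - 2"] by (simp only: e) (simp add: power_int_diff)
      then show ?thesis using 1 by simp
    next
      case 2
      then show ?thesis using p[of "n - 2"] by (simp add: e numeral_2_eq_2)
    next
      case 3
      then show ?thesis using p[of "n - 1 - j"] ij by (simp add: e)
    qed
  qed
  finally show ?thesis using g_int unfolding e_def r_def y_def by simp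
qed

lemma det_delta:
  fixes x :: "nat \<Rightarrow> real"
  shows "det_fun n (\<lambda>i j. (x i) powi (delta n ! j + int n - int (j + 1))) = vdm n (\<lambda>i. (x i)\<^sup>2)"
  unfolding vdm_def
proof (rule det_fun_cong)
  fix i j assume ij: "i < n" "j < n"
  have "delta n ! j + int n - int (j + 1) = int (2 * (n - 1 - j))"
    using ij by (auto simp: delta_def simp del: upt_Suc)
  then show "x i powi (delta n ! j + int n - int (j + 1)) = (x i)\<^sup>2 ^ (n - 1 - j)"
    by (simp only: power_int_of_nat power_mult)
qed

lemma vdm_of_real: "vdm n (\<lambda>i. complex_of_real (x i)) = of_real (vdm n x)"
  unfolding vdm_def det_fun_hom[OF of_real_hom.comm_ring_hom_axioms] by simp

text \<open>Distinct entries allow division by their Vandermonde determinant. The determinants for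
  \<delta> and \<rho> are, up to the factor \<open>lap_integral rs\<close>, Vandermonde determinants
  in the squares, and x^2 - y^2 = (x - y) (x + y) leaves the product of the sums of pairs.\<close>

lemma laurent_eval_schur_distinct:
  fixes rs :: "real list"
  assumes pos: "\<And>r. r \<in> set rs \<Longrightarrow> 0 < r" and dist: "distinct rs" and n: "2 \<le> length rs"
  defines "n \<equiv> length rs" and "xs \<equiv> map complex_of_real rs"
  shows "laurent_eval (schur_poly (delta n)) xs = of_real (\<Prod>i<n. \<Prod>l<i. rs ! i + rs ! l)"
    "laurent_eval (schur_poly (rho n)) xs = of_real (lap_integral rs * (\<Prod>i<n. \<Prod>l<i. rs ! i + rs ! l))"
proof -
  have nz: "0 \<notin> set xs" using pos[of 0] by (auto simp: xs_def)
  have len: "length xs = n" "length (rho n) = n" "length (delta n) = n"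
    by (simp_all add: xs_def n_def rho_def delta_def del: upt_Suc)
  let ?V = "\<lambda>x. vdm n (x :: nat \<Rightarrow> real)"
  have inj: "inj_on (\<lambda>i. rs ! i) {..<n}"
    using dist by (auto simp: n_def inj_on_def nth_eq_iff_index_eq)
  have V: "?V (\<lambda>i. rs ! i) \<noteq> 0" by (rule vdm_neq_0[OF inj])
  obtain c :: real where c: "c * c = 1" "\<And>x. ?V x = c * (\<Prod>i<n. \<Prod>l<i. x i - x l)"
    using vdm_prod[where 'a = real and n = n] by blast
  have V2: "?V (\<lambda>i. (rs ! i)\<^sup>2) = (\<Prod>i<n. \<Prod>l<i. rs ! i + rs ! l) * ?V (\<lambda>i. rs ! i)"
  proof -
    have "(\<Prod>i<n. \<Prod>l<i. (rs ! i)\<^sup>2 - (rs ! l)\<^sup>2) =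
      (\<Prod>i<n. \<Prod>l<i. rs ! i + rs ! l) * (\<Prod>i<n. \<Prod>l<i. rs ! i - rs ! l)"
      unfolding prod.distrib[symmetric] by (simp add: power2_eq_square algebra_simps)
    then show ?thesis by (simp add: c(2))
  qed
  have ev: "laurent_eval (schur_poly \<sigma>) xs * of_real (?V (\<lambda>i. rs ! i)) =
      of_real (det_fun n (\<lambda>i j. (rs ! i) powi (\<sigma> ! j + int n - int (j + 1))))"
    if "length \<sigma> = n" for \<sigma>
  proof -
    have 1: "vdm n (\<lambda>i. xs ! i) = vdm n (\<lambda>i. complex_of_real (rs ! i))"
      unfolding vdm_def by (rule det_fun_cong) (simp add: xs_def n_def)
    have 2: "det_fun n (\<lambda>i j. (xs ! i) powi (\<sigma> ! j + int n - int (j + 1))) =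
      of_real (det_fun n (\<lambda>i j. (rs ! i) powi (\<sigma> ! j + int n - int (j + 1))))"
      unfolding det_fun_hom[OF of_real_hom.comm_ring_hom_axioms]
      by (rule det_fun_cong) (simp add: xs_def n_def)
    show ?thesis
      using laurent_eval_schur_poly[OF nz, of \<sigma>] that by (simp only: len 1 2 vdm_of_real)
  qed
  have V': "complex_of_real (?V (\<lambda>i. rs ! i)) \<noteq> 0" using V by simp
  show "laurent_eval (schur_poly (delta n)) xs = of_real (\<Prod>i<n. \<Prod>l<i. rs ! i + rs ! l)"
  proof -
    have "laurent_eval (schur_poly (delta n)) xs * of_real (?V (\<lambda>i. rs ! i)) =
      of_real (\<Prod>i<n. \<Prod>l<i. rs ! i + rs ! l) * of_real (?V (\<lambda>i. rs ! i))"
      unfolding ev[OF len(3)] det_delta V2 by (rule of_real_mult)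
    then show ?thesis by (simp only: mult_right_cancel[OF V'])
  qed
  show "laurent_eval (schur_poly (rho n)) xs = of_real (lap_integral rs * (\<Prod>i<n. \<Prod>l<i. rs ! i + rs ! l))"
  proof -
    have "laurent_eval (schur_poly (rho n)) xs * of_real (?V (\<lambda>i. rs ! i)) =
      of_real (lap_integral rs * (\<Prod>i<n. \<Prod>l<i. rs ! i + rs ! l)) * of_real (?V (\<lambda>i. rs ! i))"
      unfolding ev[OF len(2)] using n pos
      by (subst det_rho_integral) (auto simp: n_def[symmetric] V2)
    then show ?thesis by (simp only: mult_right_cancel[OF V'])
  qed
qed

section \<open>Continuity of the integral in the entries, and the passage to repeated
  entries\<close>

lemma prod_list_mono_ge_1:
  fixes f g :: "'a \<Rightarrow> real"
  assumes "\<And>x. x \<in> set xs \<Longrightarrow> 0 \<le> f x \<and> f x \<le> g x"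
  shows "0 \<le> (\<Prod>x\<leftarrow>xs. f x) \<and> (\<Prod>x\<leftarrow>xs. f x) \<le> (\<Prod>x\<leftarrow>xs. g x)"
  using assms by (induction xs) (auto intro!: mult_mono intro: order_trans)

text \<open>One factor of the denominator is kept as an integrable majorant, a second one cancels
  s^2, and the others are at least 1.\<close>

lemma integrable_lap:
  assumes pos: "\<And>r. r \<in> set rs \<Longrightarrow> 0 < r" and n: "2 \<le> length rs"
  shows "integrable lborel (\<lambda>s::real. s\<^sup>2 / (\<Prod>r\<leftarrow>rs. 1 + (r * s)\<^sup>2))"
proof -
  obtain p q ts where rs: "rs = p # q # ts"
    using n by (metis Suc_le_length_iff numeral_2_eq_2)
  have p: "0 < p" and q: "0 < q" using pos rs by auto
  have "integrable lborel (\<lambda>s. (1 / q\<^sup>2) * (1 / (1 + (p * s)\<^sup>2)))"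
    using has_bochner_integral_inverse_1_plus_square[OF p]
    by (intro integrable_mult_right) (auto simp: has_bochner_integral_iff)
  then show ?thesis
  proof (rule Bochner_Integration.integrable_bound)
    have [measurable]: "(\<lambda>s. \<Prod>r\<leftarrow>ts. 1 + (r * s)\<^sup>2) \<in> borel_measurable borel" for ts :: "real list"
      by (induction ts) auto
    show "(\<lambda>s. s\<^sup>2 / (\<Prod>r\<leftarrow>rs. 1 + (r * s)\<^sup>2)) \<in> borel_measurable lborel"
      by measurable
    show "AE s in lborel. norm (s\<^sup>2 / (\<Prod>r\<leftarrow>rs. 1 + (r * s)\<^sup>2)) \<le> norm ((1 / q\<^sup>2) * (1 / (1 + (p * s)\<^sup>2)))"
    proof (intro AE_I2)
      fix s :: real
      have ts: "1 \<le> (\<Prod>r\<leftarrow>ts. 1 + (r * s)\<^sup>2)"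
        using prod_list_mono_ge_1[of ts "\<lambda>_. 1" "\<lambda>r. 1 + (r * s)\<^sup>2"] by (simp add: map_replicate_const)
      have "q\<^sup>2 * s\<^sup>2 \<le> 1 + (q * s)\<^sup>2" by (simp add: power_mult_distrib)
      also have "\<dots> \<le> (1 + (q * s)\<^sup>2) * (\<Prod>r\<leftarrow>ts. 1 + (r * s)\<^sup>2)"
        using mult_left_mono[OF ts, of "1 + (q * s)\<^sup>2"] by simp
      finally have le: "q\<^sup>2 * s\<^sup>2 \<le> (1 + (q * s)\<^sup>2) * (\<Prod>r\<leftarrow>ts. 1 + (r * s)\<^sup>2)" .
      have P: "0 < (1 + (q * s)\<^sup>2) * (\<Prod>r\<leftarrow>ts. 1 + (r * s)\<^sup>2)"
        using ts by (intro mult_pos_pos) (auto intro: add_pos_nonneg)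
      have "s\<^sup>2 / ((1 + (q * s)\<^sup>2) * (\<Prod>r\<leftarrow>ts. 1 + (r * s)\<^sup>2)) \<le> 1 / q\<^sup>2"
        using le P q by (simp add: divide_simps mult_ac)
      moreover have "0 < 1 + (p * s)\<^sup>2" by (auto intro: add_pos_nonneg)
      ultimately have "s\<^sup>2 / ((1 + (q * s)\<^sup>2) * (\<Prod>r\<leftarrow>ts. 1 + (r * s)\<^sup>2)) / (1 + (p * s)\<^sup>2)
          \<le> (1 / q\<^sup>2) / (1 + (p * s)\<^sup>2)"
        by (intro divide_right_mono) auto
      moreover have "0 \<le> s\<^sup>2 / (\<Prod>r\<leftarrow>rs. 1 + (r * s)\<^sup>2)"
        using prod_list_mono_ge_1[of rs "\<lambda>_. 0" "\<lambda>r. 1 + (r * s)\<^sup>2"]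
          prod_list_mono_ge_1[of rs "\<lambda>_. 1" "\<lambda>r. 1 + (r * s)\<^sup>2"]
        by (intro divide_nonneg_nonneg) (auto simp: map_replicate_const)
      ultimately have "norm (s\<^sup>2 / (\<Prod>r\<leftarrow>rs. 1 + (r * s)\<^sup>2)) \<le> (1 / q\<^sup>2) * (1 / (1 + (p * s)\<^sup>2))"
        unfolding real_norm_def by (subst abs_of_nonneg) (simp_all add: rs mult_ac)
      then show "norm (s\<^sup>2 / (\<Prod>r\<leftarrow>rs. 1 + (r * s)\<^sup>2)) \<le> norm ((1 / q\<^sup>2) * (1 / (1 + (p * s)\<^sup>2)))"
        by simp
    qed
  qed
qed

text \<open>Approaching the entries from above only makes the denominators larger, so the limit
  integrand is itself the dominating function.\<close>

lemma tendsto_lap_integral: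
  assumes pos: "\<And>r. r \<in> set rs \<Longrightarrow> 0 < r" and n: "2 \<le> length rs"
    and f: "\<And>i. i < length rs \<Longrightarrow> (\<lambda>m. f m i) \<longlonglongrightarrow> rs ! i"
    and ge: "\<And>m i. i < length rs \<Longrightarrow> rs ! i \<le> f m i"
  shows "(\<lambda>m. lap_integral (map (f m) [0..<length rs])) \<longlonglongrightarrow> lap_integral rs"
  unfolding lap_integral_def
proof (intro tendsto_divide tendsto_const integral_dominated_convergence
    [where w = "\<lambda>s. s\<^sup>2 / (\<Prod>r\<leftarrow>rs. 1 + (r * s)\<^sup>2)"])
  have [measurable]: "(\<lambda>s. \<Prod>r\<leftarrow>ts. 1 + (r * s)\<^sup>2) \<in> borel_measurable borel" for ts :: "real list"
    by (induction ts) auto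
  show "(\<lambda>s. s\<^sup>2 / (\<Prod>r\<leftarrow>rs. 1 + (r * s)\<^sup>2)) \<in> borel_measurable lborel"
    "\<And>m. (\<lambda>s. s\<^sup>2 / (\<Prod>r\<leftarrow>map (f m) [0..<length rs]. 1 + (r * s)\<^sup>2)) \<in> borel_measurable lborel"
    by measurable
  show "integrable lborel (\<lambda>s. s\<^sup>2 / (\<Prod>r\<leftarrow>rs. 1 + (r * s)\<^sup>2))"
    by (rule integrable_lap[OF pos n])
  have pr: "(\<Prod>r\<leftarrow>rs. 1 + (r * s)\<^sup>2) = (\<Prod>i\<leftarrow>[0..<length rs]. 1 + (rs ! i * s)\<^sup>2)" for s
    by (subst map_nth[of rs, symmetric]) (simp only: map_map o_def)
  have P: "(\<Prod>i\<leftarrow>is. 1 + (h i * s)\<^sup>2) > 0" for h :: "nat \<Rightarrow> real" and "is" s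
    by (induction "is") (auto intro!: mult_pos_pos add_pos_nonneg)
  show "AE s in lborel. (\<lambda>m. s\<^sup>2 / (\<Prod>r\<leftarrow>map (f m) [0..<length rs]. 1 + (r * s)\<^sup>2))
      \<longlonglongrightarrow> s\<^sup>2 / (\<Prod>r\<leftarrow>rs. 1 + (r * s)\<^sup>2)"
  proof (intro AE_I2 tendsto_divide tendsto_const)
    fix s :: real
    have "(\<lambda>m. \<Prod>i\<in>{0..<length rs}. 1 + (f m i * s)\<^sup>2) \<longlonglongrightarrow> (\<Prod>i\<in>{0..<length rs}. 1 + (rs ! i * s)\<^sup>2)"
      using f by (intro tendsto_intros) auto
    then show "(\<lambda>m. \<Prod>r\<leftarrow>map (f m) [0..<length rs]. 1 + (r * s)\<^sup>2) \<longlonglongrightarrow> (\<Prod>r\<leftarrow>rs. 1 + (r * s)\<^sup>2)"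
      by (simp add: pr o_def prod.distinct_set_conv_list[symmetric])
    show "(\<Prod>r\<leftarrow>rs. 1 + (r * s)\<^sup>2) \<noteq> 0" unfolding pr using P by (metis less_irrefl)
  qed
  show "AE s in lborel. norm (s\<^sup>2 / (\<Prod>r\<leftarrow>map (f m) [0..<length rs]. 1 + (r * s)\<^sup>2))
      \<le> s\<^sup>2 / (\<Prod>r\<leftarrow>rs. 1 + (r * s)\<^sup>2)" for m
  proof (intro AE_I2)
    fix s :: real
    have "(\<Prod>i\<leftarrow>[0..<length rs]. 1 + (rs ! i * s)\<^sup>2) \<le> (\<Prod>i\<leftarrow>[0..<length rs]. 1 + (f m i * s)\<^sup>2)"
    proof (rule conjunct2[OF prod_list_mono_ge_1])
      fix i assume "i \<in> set [0..<length rs]"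
      then have i: "i < length rs" by simp
      have "0 < rs ! i" "rs ! i \<le> f m i" using ge i pos by auto
      then have "(rs ! i * s)\<^sup>2 \<le> (f m i * s)\<^sup>2"
        by (simp add: power_mult_distrib mult_right_mono power_mono)
      then show "0 \<le> 1 + (rs ! i * s)\<^sup>2 \<and> 1 + (rs ! i * s)\<^sup>2 \<le> 1 + (f m i * s)\<^sup>2" by simp
    qed
    then show "norm (s\<^sup>2 / (\<Prod>r\<leftarrow>map (f m) [0..<length rs]. 1 + (r * s)\<^sup>2)) \<le> s\<^sup>2 / (\<Prod>r\<leftarrow>rs. 1 + (r * s)\<^sup>2)"
      unfolding pr using P by (simp add: o_def abs_of_pos divide_left_mono)
  qed
qed simp

text \<open>Evaluations of Laurent polynomials, \<open>lap_integral\<close> and the product of sums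
  of pairs are all continuous under the perturbation \<open>f\<close>, so the formulas for distinct
  entries persist in the limit. Positivity of that product makes s_\<delta> nonzero, also for
  repeated entries.\<close>

lemma schur_rho_eq:
  assumes pos: "\<And>m. m \<in> set a \<Longrightarrow> 0 < (m::int)" and n: "2 \<le> length a"
  shows "schur (rho (length a)) a = of_real (lap_integral (map of_int a)) * schur (delta (length a)) a"
    "schur (delta (length a)) a \<noteq> 0"
proof -
  define n where "n = length a"
  define rs :: "real list" where "rs = map of_int a"
  define xs where "xs = map complex_of_real rs"
  have len: "length rs = n" by (simp add: rs_def n_def)
  have rpos: "0 < r" if "r \<in> set rs" for r using that pos by (auto simp: rs_def)
  define f where "f m i = rs ! i + real i / real (m + 1)" for m i
  define R where "R m = map (f m) [0..<n]" for m
  have f_lim: "(\<lambda>m. f m i) \<longlonglongrightarrow> rs ! i" for i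
  proof -
    have "(\<lambda>m. rs ! i + real i * inverse (real (Suc m))) \<longlonglongrightarrow> rs ! i + real i * 0"
      by (intro tendsto_intros LIMSEQ_inverse_real_of_nat)
    then show ?thesis by (simp add: f_def[abs_def] divide_inverse)
  qed
  have ge: "rs ! i \<le> f m i" for i m by (simp add: f_def)
  have fpos: "0 < f m i" if "i < n" for m i
    using rpos[of "rs ! i"] ge[of i m] that len by simp
  have xs: "xs = map (of_int :: int \<Rightarrow> complex) a" "length xs = n" "0 \<notin> set xs"
    "\<And>i. i < n \<Longrightarrow> xs ! i = of_real (rs ! i)"
    using rpos[of 0] len by (auto simp: xs_def rs_def)
  text \<open>The perturbed entries are integers plus distinct fractions \<open>i/(m+1)\<close> with \<open>i < n \<le> m + 1\<close>.\<close>
  have dist: "distinct (R m)" if m: "n \<le> m" for m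
  proof -
    have "i = j" if ij: "i < n" "j < n" "f m i = f m j" for i j
    proof -
      have "real_of_int (a ! i - a ! j) * real (m + 1) = real j - real i"
        using ij by (simp add: f_def rs_def n_def field_simps)
      then have "(a ! i - a ! j) * int (m + 1) = int j - int i"
        by (metis (no_types, lifting) of_int_diff of_int_eq_iff of_int_mult of_int_of_nat_eq)
      moreover have "\<bar>int j - int i\<bar> < int (m + 1)" using ij m by simp
      ultimately have "\<bar>a ! i - a ! j\<bar> * int (m + 1) < 1 * int (m + 1)"
        by (metis abs_mult abs_of_nat mult_1)
      then have "\<bar>a ! i - a ! j\<bar> < 1" by (rule mult_right_less_imp_less) simp
      then have "a ! i = a ! j" by simp
      then show "i = j" using \<open>(a ! i - a ! j) * int (m + 1) = int j - int i\<close> by simp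
    qed
    then show ?thesis by (auto simp: R_def distinct_map inj_on_def)
  qed
  define D where "D ts = (\<Prod>i<n. \<Prod>l<i. ts ! i + ts ! l :: real)" for ts
  have R: "laurent_eval (schur_poly (delta n)) (map complex_of_real (R m)) = of_real (D (R m))"
    "laurent_eval (schur_poly (rho n)) (map complex_of_real (R m)) = of_real (lap_integral (R m) * D (R m))"
    if "n \<le> m" for m
  proof -
    have *: "\<And>r. r \<in> set (R m) \<Longrightarrow> 0 < r" "2 \<le> length (R m)" "length (R m) = n"
      using fpos n by (auto simp: R_def n_def)
    show "laurent_eval (schur_poly (delta n)) (map complex_of_real (R m)) = of_real (D (R m))"
      "laurent_eval (schur_poly (rho n)) (map complex_of_real (R m)) = of_real (lap_integral (R m) * D (R m))"
      using laurent_eval_schur_distinct[OF *(1) dist[OF that] *(2)] by (simp_all only: *(3) D_def)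
  qed
  have lim: "(\<lambda>m. laurent_eval S (map complex_of_real (R m))) \<longlonglongrightarrow> laurent_eval S xs" for S
  proof -
    have "(\<lambda>m. laurent_eval S (map (\<lambda>i. complex_of_real (f m i)) [0..<length xs])) \<longlonglongrightarrow> laurent_eval S xs"
      using xs f_lim by (intro tendsto_laurent_eval) (auto intro!: tendsto_intros)
    then show ?thesis by (simp add: R_def o_def xs(2))
  qed
  have limD: "(\<lambda>m. D (R m)) \<longlonglongrightarrow> D rs"
  proof -
    have "(\<lambda>m. \<Prod>i<n. \<Prod>l<i. f m i + f m l) \<longlonglongrightarrow> (\<Prod>i<n. \<Prod>l<i. rs ! i + rs ! l)"
      by (intro tendsto_intros f_lim)
    moreover have "(\<Prod>i<n. \<Prod>l<i. f m i + f m l) = D (R m)" for m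
      unfolding D_def by (intro prod.cong) (auto simp: R_def)
    ultimately show ?thesis by (simp add: D_def)
  qed
  have limJ: "(\<lambda>m. lap_integral (R m)) \<longlonglongrightarrow> lap_integral rs"
    using tendsto_lap_integral[where rs = rs and f = f] rpos f_lim ge n len by (simp add: R_def n_def)
  have delta: "laurent_eval (schur_poly (delta n)) xs = of_real (D rs)"
  proof (rule LIMSEQ_unique[OF lim])
    have "(\<lambda>m. complex_of_real (D (R m))) \<longlonglongrightarrow> of_real (D rs)"
      by (intro tendsto_intros limD)
    then show "(\<lambda>m. laurent_eval (schur_poly (delta n)) (map complex_of_real (R m))) \<longlonglongrightarrow> of_real (D rs)"
      by (rule Lim_transform_eventually) (auto simp: R intro!: eventually_sequentiallyI[of n])
  qed
  have rho: "laurent_eval (schur_poly (rho n)) xs = of_real (lap_integral rs * D rs)"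
  proof (rule LIMSEQ_unique[OF lim])
    have "(\<lambda>m. complex_of_real (lap_integral (R m) * D (R m))) \<longlonglongrightarrow> of_real (lap_integral rs * D rs)"
      by (intro tendsto_intros limD limJ)
    then show "(\<lambda>m. laurent_eval (schur_poly (rho n)) (map complex_of_real (R m))) \<longlonglongrightarrow> of_real (lap_integral rs * D rs)"
      by (rule Lim_transform_eventually) (auto simp: R simp del: of_real_mult intro!: eventually_sequentiallyI[of n])
  qed
  have "0 < D rs"
    unfolding D_def using rpos len by (intro prod_pos) (auto intro!: add_pos_pos)
  then show "schur (rho (length a)) a = of_real (lap_integral (map of_int a)) * schur (delta (length a)) a"
    "schur (delta (length a)) a \<noteq> 0"
    using delta rho by (simp_all add: schur_def xs(1) n_def rs_def)
qed

section \<open>Counting monomials of given degree and weight\<close>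

fun cnt :: "int list \<Rightarrow> nat \<Rightarrow> int \<Rightarrow> nat" where
  "cnt [] n w = (if n = 0 \<and> w = 0 then 1 else 0)"
| "cnt (m # ms) n w = (\<Sum>k\<le>n. cnt ms (n - k) (w - int k * m))"

lemma cnt_Cons_0: "cnt (m # ms) 0 w = cnt ms 0 w"
  by simp

text \<open>A monomial either avoids the first variable or has that variable as a factor to be
  divided out.\<close>

lemma cnt_Cons_Suc: "cnt (m # ms) (Suc n) w = cnt ms (Suc n) w + cnt (m # ms) n (w - m)"
  unfolding cnt.simps(2) by (subst sum.atMost_Suc_shift) (simp add: algebra_simps)

lemma cnt_swap: "cnt (a # b # ms) = cnt (b # a # ms)"
proof (intro ext)
  fix n w
  \<comment> \<open>The triangle k + l \<le> n is written as a square with a condition, so that the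
    two sums can be exchanged.\<close>
  have *: "cnt (a # b # ms) n w = (\<Sum>k\<le>n. \<Sum>l\<le>n.
      if k + l \<le> n then cnt ms (n - (k + l)) (w - int k * a - int l * b) else 0)" for a b
    unfolding cnt.simps(2)
  proof (rule sum.cong)
    fix k assume k: "k \<in> {..n}"
    have "(\<Sum>l\<le>n - k. cnt ms (n - k - l) (w - int k * a - int l * b)) =
      (\<Sum>l\<in>{l\<in>{..n}. k + l \<le> n}. cnt ms (n - (k + l)) (w - int k * a - int l * b))"
      using k by (intro sum.cong) auto
    also have "\<dots> = (\<Sum>l\<le>n. if k + l \<le> n then cnt ms (n - (k + l)) (w - int k * a - int l * b) else 0)"
      by (rule sum.inter_filter) simp
    finally show "(\<Sum>l\<le>n - k. cnt ms (n - k - l) (w - int k * a - int l * b)) = \<dots>" .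
  qed simp
  show "cnt (a # b # ms) n w = cnt (b # a # ms) n w"
    unfolding * by (subst sum.swap) (intro sum.cong refl, auto simp: algebra_simps)
qed

lemma cnt_move_front: "cnt (xs @ a # ys) = cnt (a # xs @ ys)"
proof (induction xs)
  case (Cons x xs)
  have "cnt ((x # xs) @ a # ys) = cnt (x # a # xs @ ys)"
    using Cons by (intro ext) simp
  then show ?case by (simp add: cnt_swap del: cnt.simps)
qed simp

lemma cnt_mset: "mset xs = mset ys \<Longrightarrow> cnt xs = cnt ys"
proof (induction xs arbitrary: ys)
  case (Cons x xs)
  then have "x \<in> set ys" by (metis list.set_intros(1) set_mset_mset)
  then obtain us vs where ys: "ys = us @ x # vs" by (meson split_list)
  have "cnt xs = cnt (us @ vs)" using Cons ys by simp
  then show ?case unfolding ys cnt_move_front by (intro ext) simp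
qed simp

text \<open>The growth in n is polynomial, which gives convergence for t < 1, and the bound is
  uniform in w, which \<open>gval_integral\<close> relies on.\<close>

lemma cnt_le: "cnt ms n w \<le> (n + 1) ^ length ms"
proof (induction ms arbitrary: n w)
  case (Cons m ms)
  have "cnt (m # ms) n w \<le> (\<Sum>k\<le>n. (n + 1) ^ length ms)"
    unfolding cnt.simps
    by (intro sum_mono order.trans[OF Cons] power_mono) auto
  then show ?case by simp
qed simp

lemma cnt_eq_0_pos:
  assumes "\<And>m. m \<in> set ms \<Longrightarrow> 0 < m" "w < int n"
  shows "cnt ms n w = 0"
  using assms
proof (induction ms arbitrary: n w)
  case (Cons m ms)
  have "cnt ms (n - k) (w - int k * m) = 0" if "k \<le> n" for k
  proof (rule Cons.IH)
    have "int k * 1 \<le> int k * m" using Cons.prems(1)[of m] by (intro mult_left_mono) auto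
    then show "w - int k * m < int (n - k)" using Cons.prems(2) that by simp
  qed (use Cons.prems in auto)
  then show ?case by simp
qed auto

lemma cnt_uminus: "cnt (map uminus ms) n (- w) = cnt ms n w"
proof (induction ms arbitrary: n w)
  case (Cons m ms)
  have "cnt (map uminus ms) (n - k) (- w - int k * - m) = cnt ms (n - k) (w - int k * m)" for k
    using Cons[of "n - k" "w - int k * m"] by (simp add: algebra_simps)
  then show ?case by simp
qed simp

section \<open>Rationality of the generating functions\<close>

definition genf :: "int list \<Rightarrow> int \<Rightarrow> complex fps" where
  "genf ms w = Abs_fps (\<lambda>n. of_nat (cnt ms n w))"

lemma genf_Cons: "genf (m # ms) w = genf ms w + fps_X * genf (m # ms) (w - m)"
proof (rule fps_ext)
  fix n show "fps_nth (genf (m # ms) w) n = fps_nth (genf ms w + fps_X * genf (m # ms) (w - m)) n"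
    by (cases n) (simp_all add: genf_def cnt_Cons_Suc del: cnt.simps, simp add: cnt_Cons_0)
qed

lemma genf_Cons_iterate:
  "genf (m # ms) w = (\<Sum>i<b. fps_X ^ i * genf ms (w - int i * m)) + fps_X ^ b * genf (m # ms) (w - int b * m)"
proof (induction b)
  case (Suc b)
  show ?case
    by (subst Suc, subst genf_Cons) (simp add: algebra_simps)
qed simp

definition rational_fps :: "complex fps \<Rightarrow> bool" where
  "rational_fps F \<longleftrightarrow> (\<exists>P Q. Q \<noteq> 0 \<and> F * fps_of_poly Q = fps_of_poly P)"

lemma rational_fps_poly: "rational_fps (fps_of_poly P)"
  unfolding rational_fps_def by (intro exI[of _ P] exI[of _ 1]) simp

lemma rational_fps_add:
  assumes "rational_fps F" "rational_fps G"
  shows "rational_fps (F + G)"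
proof -
  from assms obtain P Q R S where *: "Q \<noteq> 0" "F * fps_of_poly Q = fps_of_poly P"
    "S \<noteq> 0" "G * fps_of_poly S = fps_of_poly R"
    unfolding rational_fps_def by blast
  have "(F + G) * fps_of_poly (Q * S) = F * fps_of_poly Q * fps_of_poly S + G * fps_of_poly S * fps_of_poly Q"
    by (simp add: fps_of_poly_mult algebra_simps)
  also have "\<dots> = fps_of_poly (P * S + R * Q)"
    by (simp add: * fps_of_poly_mult fps_of_poly_add)
  finally show ?thesis unfolding rational_fps_def using * by (metis mult_eq_0_iff)
qed

lemma rational_fps_mult_poly:
  assumes "rational_fps F"
  shows "rational_fps (fps_of_poly R * F)"
proof -
  from assms obtain P Q where *: "Q \<noteq> 0" "F * fps_of_poly Q = fps_of_poly P"
    unfolding rational_fps_def by blast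
  have "fps_of_poly R * F * fps_of_poly Q = fps_of_poly (R * P)"
    by (simp add: fps_of_poly_mult * mult.assoc)
  then show ?thesis unfolding rational_fps_def using * by blast
qed

lemma rational_fps_X_power: "rational_fps F \<Longrightarrow> rational_fps (fps_X ^ n * F)"
  using rational_fps_mult_poly[of F "monom 1 n"] by (simp add: fps_of_poly_monom)

lemma rational_fps_sum: "(\<And>i. i \<in> I \<Longrightarrow> rational_fps (F i)) \<Longrightarrow> rational_fps (\<Sum>i\<in>I. F i)"
  using rational_fps_poly[of 0]
  by (induction I rule: infinite_finite_induct) (auto intro: rational_fps_add)

lemma rational_fps_diff:
  assumes "rational_fps F" "rational_fps G"
  shows "rational_fps (F - G)"
proof -
  have "fps_of_poly [:-1:] * G = - G" by (simp add: fps_of_poly_pCons fps_eq_iff)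
  then show ?thesis
    using rational_fps_add[OF assms(1) rational_fps_mult_poly[OF assms(2), of "[:-1:]"]] by simp
qed

lemma rational_fps_cancel:
  assumes "rational_fps ((1 - fps_X ^ n) * F)" "0 < n"
  shows "rational_fps F"
proof -
  from assms obtain P Q where *: "Q \<noteq> 0" "(1 - fps_X ^ n) * F * fps_of_poly Q = fps_of_poly P"
    unfolding rational_fps_def by blast
  have X: "fps_of_poly (1 - monom 1 n) = (1 - fps_X ^ n :: complex fps)"
    by (simp add: fps_of_poly_diff fps_of_poly_monom)
  have "F * fps_of_poly ((1 - monom 1 n) * Q) = fps_of_poly P"
    using * by (simp only: fps_of_poly_mult X mult_ac)
  moreover have "1 - monom 1 n \<noteq> (0 :: complex poly)"
  proof
    assume "1 - monom 1 n = (0 :: complex poly)"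
    then have "poly (1 - monom 1 n) 0 = (0 :: complex)" by simp
    then show False using assms(2) by (simp add: poly_monom power_0_left)
  qed
  ultimately show ?thesis unfolding rational_fps_def using * by (metis mult_eq_0_iff)
qed

text \<open>With positive integer weights the degree is at most the weight, so for fixed w only
  finitely many terms survive and the series is a polynomial.\<close>

lemma genf_poly_pos:
  assumes "\<And>m. m \<in> set ms \<Longrightarrow> 0 < m"
  shows "rational_fps (genf ms w)"
proof -
  have "genf ms w = fps_of_poly (\<Sum>n\<le>nat \<bar>w\<bar>. monom (of_nat (cnt ms n w)) n)"
  proof (rule fps_ext)
    fix n
    have "cnt ms n w = 0" if "\<not> n \<le> nat \<bar>w\<bar>"
      using that assms by (intro cnt_eq_0_pos) auto
    then show "fps_nth (genf ms w) n = fps_nth (fps_of_poly (\<Sum>n\<le>nat \<bar>w\<bar>. monom (of_nat (cnt ms n w)) n)) n"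
      by (auto simp: genf_def coeff_sum)
  qed
  then show ?thesis by (simp add: rational_fps_poly)
qed

text \<open>With \<open>X = t z\<^sup>a\<close> and \<open>Y = t z\<^sup>-\<^sup>b\<close> one has \<open>X\<^sup>b Y\<^sup>a = t\<^bsup>a+b\<^esup>\<close>, so \<open>1 - t\<^bsup>a+b\<^esup>\<close> lies in the ideal generated by
  \<open>1 - X\<close> and \<open>1 - Y\<close>; this trades a pair of weights of opposite signs for a single weight.\<close>

lemma genf_opposite:
  assumes "0 < a" "0 < b"
  shows "(1 - fps_X ^ (a + b)) * genf (int a # - int b # ms) w =
    (\<Sum>i<b. fps_X ^ i * genf (- int b # ms) (w - int i * int a)) +
    fps_X ^ b * (\<Sum>j<a. fps_X ^ j * genf (int a # ms) (w - int b * int a - int j * - int b))"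
proof -
  let ?G = "genf (int a # - int b # ms)"
  have 1: "?G w = (\<Sum>i<b. fps_X ^ i * genf (- int b # ms) (w - int i * int a)) + fps_X ^ b * ?G (w - int b * int a)"
    by (rule genf_Cons_iterate)
  have sw: "?G = genf (- int b # int a # ms)" by (simp add: genf_def fun_eq_iff cnt_swap del: cnt.simps)
  have 2: "?G (w - int b * int a) = (\<Sum>j<a. fps_X ^ j * genf (int a # ms) (w - int b * int a - int j * - int b)) + fps_X ^ a * ?G w"
    unfolding sw by (subst genf_Cons_iterate[of _ _ _ a]) (simp add: mult.commute)
  have "(1 - x ^ (a + b)) * g = s + x ^ b * r" if "g = s + x ^ b * (r + x ^ a * g)" for x g s r :: "complex fps"
  proof -
    have "s + x ^ b * r = (s + x ^ b * (r + x ^ a * g)) - x ^ b * x ^ a * g" by (simp add: algebra_simps)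
    also have "\<dots> = g - x ^ b * x ^ a * g" by (simp only: that[symmetric])
    finally show ?thesis by (simp add: power_add algebra_simps)
  qed
  then show ?thesis using 1 unfolding 2 by blast
qed

text \<open>Induction on the number of variables. A weight 0 contributes a factor 1 / (1 - X), a
  pair of weights of opposite signs is traded for shorter lists, and weights of one sign give a
  polynomial.\<close>

lemma rational_genf: "rational_fps (genf ms w)"
proof (induction "length ms" arbitrary: ms w rule: less_induct)
  case less
  have perm: "genf xs = genf ys" if "mset xs = mset ys" for xs ys
    using cnt_mset[OF that] by (simp add: genf_def fun_eq_iff)
  consider "0 \<in> set ms" | a b where "0 < a" "0 < b" "int a \<in> set ms" "- int b \<in> set ms"
    | "\<And>m. m \<in> set ms \<Longrightarrow> 0 < m" | "\<And>m. m \<in> set ms \<Longrightarrow> m < 0"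
  proof -
    have "\<exists>a b. 0 < a \<and> 0 < b \<and> int a \<in> set ms \<and> - int b \<in> set ms"
      if "0 \<notin> set ms" "m \<in> set ms" "\<not> 0 < m" "m' \<in> set ms" "\<not> m' < 0" for m m'
    proof (rule exI[of _ "nat m'"], rule exI[of _ "nat (- m)"])
      have "m \<noteq> 0" "m' \<noteq> 0" using that by auto
      then show "0 < nat m' \<and> 0 < nat (- m) \<and> int (nat m') \<in> set ms \<and> - int (nat (- m)) \<in> set ms"
        using that by auto
    qed
    then show thesis using that by blast
  qed
  then show ?case
  proof cases
    case 1
    then have ms: "genf ms = genf (0 # remove1 0 ms)" by (intro perm) simp
    have "(1 - fps_X ^ 1) * genf (0 # remove1 0 ms) w = genf (remove1 0 ms) w"
      using genf_Cons[of 0 "remove1 0 ms" w] by (simp add: algebra_simps)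
    moreover have "rational_fps (genf (remove1 0 ms) w)"
      using length_pos_if_in_set[OF 1] 1 by (intro less) (simp add: length_remove1)
    ultimately show ?thesis
      using rational_fps_cancel[of 1] by (simp add: ms)
  next
    case 2
    let ?r = "remove1 (- int b) (remove1 (int a) ms)"
    have b: "- int b \<in> set (remove1 (int a) ms)" using 2 by (simp add: in_set_remove1)
    have front: "mset xs = add_mset x (mset (remove1 x xs))" if "x \<in> set xs" for x :: int and xs
      using that by simp
    have "mset ms = mset (int a # - int b # ?r)"
      unfolding mset.simps front[OF 2(3)] front[OF b] ..
    then obtain r where m: "mset ms = mset (int a # - int b # r)" by blast
    have ms: "genf ms = genf (int a # - int b # r)" "length ms = Suc (Suc (length r))"
      using perm[OF m] mset_eq_length[OF m] by simp_all
    have "rational_fps ((1 - fps_X ^ (a + b)) * genf ms w)"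
      unfolding ms(1) genf_opposite[OF 2(1,2)]
      by (intro rational_fps_add rational_fps_sum rational_fps_X_power less) (simp_all add: ms(2))
    then show ?thesis by (rule rational_fps_cancel) (use 2 in simp)
  next
    case 3
    then show ?thesis by (rule genf_poly_pos)
  next
    case 4
    have "genf ms w = genf (map uminus ms) (- w)" by (simp add: genf_def cnt_uminus)
    moreover have "rational_fps (genf (map uminus ms) (- w))"
      using 4 by (intro genf_poly_pos) auto
    ultimately show ?thesis by simp
  qed
qed

section \<open>Coefficients of the Laurent expansion as limits\<close>

text \<open>In s = 1 - t let F be p(s) / q(s). If s^N p / q converges along one sequence tending to
  0, the power of s dividing q must also divide s^N p. So s^N p / q is a power series in s, and its
  constant term is the limit.\<close>

lemma laurent_at_one_limit:
  fixes F :: "complex fps" and \<epsilon> :: "nat \<Rightarrow> real"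
  assumes rat: "rational_fps F"
    and conv: "\<And>t::real. 0 < t \<Longrightarrow> t < 1 \<Longrightarrow> summable (\<lambda>n. fps_nth F n * of_real t ^ n)"
    and \<epsilon>: "\<And>k. 0 < \<epsilon> k" "\<And>k. \<epsilon> k < 1" "\<epsilon> \<longlonglongrightarrow> 0"
    and lim: "(\<lambda>k. of_real (\<epsilon> k) ^ N * suminf (\<lambda>n. fps_nth F n * of_real (1 - \<epsilon> k) ^ n)) \<longlonglongrightarrow> l"
  shows "fls_nth (laurent_at_one F) (- int N) = l"
proof -
  from rat obtain P Q where Q: "Q \<noteq> 0" and FQ: "F * fps_of_poly Q = fps_of_poly P"
    unfolding rational_fps_def by blast
  define p where "p = pcompose P [:1, -1:]"
  define q where "q = pcompose Q [:1, -1:]"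
  have q: "q \<noteq> 0" using Q by (simp add: q_def pcompose_one_minus_eq_0_iff)
  define f where "f k = suminf (\<lambda>n. fps_nth F n * complex_of_real (1 - \<epsilon> k) ^ n)" for k
  define e where "e k = complex_of_real (\<epsilon> k)" for k
  have e0: "e k \<noteq> 0" for k using \<epsilon>(1)[of k] by (simp add: e_def)
  have e: "e \<longlonglongrightarrow> 0" using tendsto_of_real[OF \<epsilon>(3), where 'a = complex] by (simp add: e_def[abs_def])
  have poly_e: "(\<lambda>k. poly g (e k)) \<longlonglongrightarrow> poly g 0" for g by (intro tendsto_intros e)
  have fq: "f k * poly q (e k) = poly p (e k)" for k
  proof -
    define t where "t = 1 - \<epsilon> k"
    have t: "0 < t" "t < 1" using \<epsilon>(1,2)[of k] by (auto simp: t_def)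
    \<comment> \<open>Convergence at (t + 1) / 2, still below 1, puts t strictly inside the disc of
      convergence, where values of power series may be multiplied.\<close>
    have "ereal (norm (complex_of_real ((t + 1) / 2))) \<le> conv_radius (fps_nth F)"
      using t by (intro conv_radius_geI conv) auto
    moreover have "ereal (norm (complex_of_real t)) < ereal (norm (complex_of_real ((t + 1) / 2)))"
      using t by simp
    ultimately have "ereal (norm (complex_of_real t)) < fps_conv_radius F"
      unfolding fps_conv_radius_def by (rule less_le_trans[rotated])
    then have "eval_fps F (of_real t) * eval_fps (fps_of_poly Q) (of_real t) = eval_fps (fps_of_poly P) (of_real t)"
      unfolding FQ[symmetric] by (intro eval_fps_mult[symmetric]) auto
    then show ?thesis
      by (simp add: f_def eval_fps_def[of F] t_def p_def q_def poly_pcompose e_def)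
  qed
  obtain q1 where q1: "q = [:- 0, 1:] ^ order 0 q * q1" "\<not> [:- 0, 1:] dvd q1"
    using order_decomp[OF q] by blast
  define b where "b = order 0 q"
  have qX: "q = monom 1 b * q1" using q1(1) by (simp add: b_def monom_altdef)
  have q10: "poly q1 0 \<noteq> 0" using q1(2) by (simp add: poly_eq_0_iff_dvd)
  have u: "e k ^ N * f k * poly q1 (e k) * e k ^ b = e k ^ N * poly p (e k)" for k
    using fq[of k] by (simp add: qX poly_monom mult_ac)
  have lim': "(\<lambda>k. e k ^ N * f k * poly q1 (e k)) \<longlonglongrightarrow> l * poly q1 0"
    using lim by (intro tendsto_intros poly_e) (simp add: e_def f_def)
  obtain r where r: "monom 1 N * p = monom 1 b * r"
  proof (cases "p = 0")
    case True
    then show ?thesis using that[of 0] by simp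
  next
    case False
    obtain p1 where p1: "p = [:- 0, 1:] ^ order 0 p * p1" "\<not> [:- 0, 1:] dvd p1"
      using order_decomp[OF False] by blast
    define a where "a = order 0 p"
    have pX: "p = monom 1 a * p1" using p1(1) by (simp add: a_def monom_altdef)
    have p10: "poly p1 0 \<noteq> 0" using p1(2) by (simp add: poly_eq_0_iff_dvd)
    \<comment> \<open>Otherwise p1 along the sequence would be a convergent factor times a positive
      power of \<open>e k\<close>, hence tend to 0, against \<open>p10\<close>.\<close>
    have "b \<le> N + a"
    proof (rule ccontr)
      assume "\<not> b \<le> N + a"
      then obtain c where c: "b = N + a + Suc c" by (metis less_imp_Suc_add not_le add_Suc_right)
      have "poly p1 (e k) = e k ^ N * f k * poly q1 (e k) * e k ^ Suc c" for k
      proof -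
        have "e k ^ (N + a) * poly p1 (e k) = e k ^ N * poly p (e k)"
          by (simp add: pX poly_monom power_add)
        also have "\<dots> = e k ^ (N + a) * (e k ^ N * f k * poly q1 (e k) * e k ^ Suc c)"
          unfolding u[symmetric] by (simp only: c power_add mult_ac)
        finally show ?thesis using e0[of k] by simp
      qed
      moreover have "(\<lambda>k. e k ^ N * f k * poly q1 (e k) * e k ^ Suc c) \<longlonglongrightarrow> (l * poly q1 0) * 0 ^ Suc c"
        by (intro tendsto_intros lim' e)
      ultimately have "(\<lambda>k. poly p1 (e k)) \<longlonglongrightarrow> 0" by simp
      then show False using poly_e[of p1] p10 LIMSEQ_unique by blast
    qed
    then have "monom 1 N * p = monom 1 b * (monom 1 (N + a - b) * p1)"
      by (simp add: pX mult.assoc[symmetric] mult_monom)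
    then show ?thesis by (rule that)
  qed
  have "poly r (e k) = e k ^ N * f k * poly q1 (e k)" for k
  proof -
    have "poly (monom 1 N * p) (e k) = poly (monom 1 b * r) (e k)" by (simp only: r)
    then have "e k ^ b * poly r (e k) = e k ^ N * poly p (e k)" by (simp add: poly_monom)
    also have "\<dots> = e k ^ b * (e k ^ N * f k * poly q1 (e k))"
      unfolding u[symmetric] by (simp only: mult_ac)
    finally show ?thesis using e0[of k] by simp
  qed
  then have "(\<lambda>k. poly r (e k)) \<longlonglongrightarrow> l * poly q1 0" using lim' by simp
  then have r0: "poly r 0 = l * poly q1 0" using poly_e[of r] LIMSEQ_unique by blast
  define G where "G = fps_of_poly r * inverse (fps_of_poly q1)"
  have nz: "fps_nth (fps_of_poly q1) 0 \<noteq> 0" using q10 by (simp add: poly_0_coeff_0)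
  have Gq: "G * fps_of_poly q1 = fps_of_poly r"
    using nz by (simp add: G_def mult.assoc inverse_mult_eq_1)
  have G0: "fps_nth G 0 = l"
    using q10 r0 by (simp add: G_def poly_0_coeff_0 fps_mult_nth)
  define E where "E = laurent_at_one F"
  have E: "E = fps_to_fls (fps_of_poly p) / fps_to_fls (fps_of_poly q)"
    unfolding E_def laurent_at_one_eqI[OF Q FQ] by (simp add: poly_in_one_minus_def p_def q_def)
  have q': "fps_to_fls (fps_of_poly q) \<noteq> 0" using q by simp
  have "fls_X ^ N * E * fps_to_fls (fps_of_poly q) = fls_X ^ N * fps_to_fls (fps_of_poly p)"
    using q' by (simp add: E)
  also have "fls_X ^ N = fps_to_fls (fps_of_poly (monom 1 N :: complex poly))"
    by (simp add: fps_of_poly_monom fps_to_fls_power)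
  also have "\<dots> * fps_to_fls (fps_of_poly p) = fps_to_fls (fps_of_poly (monom 1 b) * fps_of_poly r)"
    by (simp only: fls_times_fps_to_fls[symmetric] fps_of_poly_mult[symmetric] r)
  also have "\<dots> = fps_to_fls G * fps_to_fls (fps_of_poly q)"
    by (simp only: fls_times_fps_to_fls[symmetric] Gq[symmetric] qX fps_of_poly_mult mult_ac)
  finally have "fls_X ^ N * E = fps_to_fls G" using q' by (simp add: fps_of_poly_monom fps_to_fls_power)
  then have "fls_nth (fls_shift (- int N) E) 0 = fls_nth (fps_to_fls G) 0"
    by (simp add: fls_X_power_times_conv_shift)
  then show ?thesis by (simp add: G0 E_def)
qed


section \<open>An integral formula for the generating functions\<close>

lemma summable_poly_geometric:
  fixes t :: real
  assumes "0 < t" "t < 1"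
  shows "summable (\<lambda>n. real ((n + 1) ^ d) * t ^ n)"
proof -
  have "(\<lambda>n. t * ((real (n + 2)) / real (n + 1)) ^ d) \<longlonglongrightarrow> t * 1 ^ d"
  proof (intro tendsto_intros)
    have "(\<lambda>n. 1 + inverse (real (Suc n))) \<longlonglongrightarrow> 1 + 0"
      by (intro tendsto_intros LIMSEQ_inverse_real_of_nat)
    moreover have "1 + inverse (real (Suc n)) = real (n + 2) / real (n + 1)" for n
      by (simp add: field_simps)
    ultimately show "(\<lambda>n. real (n + 2) / real (n + 1)) \<longlonglongrightarrow> 1" by simp
  qed
  then have "eventually (\<lambda>n. t * ((real (n + 2)) / real (n + 1)) ^ d < (t + 1) / 2) sequentially"
    using assms by (intro order_tendstoD) auto
  then obtain N where N: "\<And>n. N \<le> n \<Longrightarrow> t * ((real (n + 2)) / real (n + 1)) ^ d < (t + 1) / 2"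
    by (auto simp: eventually_sequentially)
  show ?thesis
  proof (rule summable_ratio_test[of "(t + 1) / 2" N])
    fix n assume n: "N \<le> n"
    have "real ((Suc n + 1) ^ d) * t ^ Suc n =
        (t * ((real (n + 2)) / real (n + 1)) ^ d) * (real ((n + 1) ^ d) * t ^ n)"
      by (simp add: power_divide)
    also have "\<dots> \<le> ((t + 1) / 2) * (real ((n + 1) ^ d) * t ^ n)"
      using N[OF n] assms by (intro mult_right_mono) auto
    finally show "norm (real ((Suc n + 1) ^ d) * t ^ Suc n) \<le> (t + 1) / 2 * norm (real ((n + 1) ^ d) * t ^ n)"
      using assms by simp
  qed (use assms in auto)
qed

definition gval :: "int list \<Rightarrow> int \<Rightarrow> real \<Rightarrow> real" where
  "gval ms w t = suminf (\<lambda>n. real (cnt ms n w) * t ^ n)"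

lemma cnt_term_le:
  assumes "0 < t"
  shows "real (cnt ms n w) * t ^ n \<le> real ((n + 1) ^ length ms) * t ^ n"
  using assms by (intro mult_right_mono of_nat_mono cnt_le) auto

lemma summable_cnt:
  fixes t :: real
  assumes "0 < t" "t < 1"
  shows "summable (\<lambda>n. real (cnt ms n w) * t ^ n)"
proof (rule summable_comparison_test'[OF summable_poly_geometric[OF assms, of "length ms"]])
  fix n
  have "norm (real (cnt ms n w) * t ^ n) = real (cnt ms n w) * t ^ n" using assms by simp
  also have "\<dots> \<le> real ((n + 1) ^ length ms) * t ^ n" by (rule cnt_term_le[OF assms(1)])
  finally show "norm (real (cnt ms n w) * t ^ n) \<le> real ((n + 1) ^ length ms) * t ^ n" .
qed

lemma gval_bounds:
  assumes "0 < t" "t < 1"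
  shows "0 \<le> gval ms w t" "gval ms w t \<le> suminf (\<lambda>n. real ((n + 1) ^ length ms) * t ^ n)"
  unfolding gval_def
  by (rule suminf_nonneg[OF summable_cnt[OF assms]], use assms in simp)
     (rule suminf_le[OF cnt_term_le[OF assms(1)] summable_cnt[OF assms] summable_poly_geometric[OF assms]])

lemma gval_Cons:
  assumes "0 < t" "t < 1"
  shows "gval (m # ms) w t = gval ms w t + t * gval (m # ms) (w - m) t"
proof -
  note s = summable_cnt[OF assms]
  have "gval (m # ms) w t = real (cnt ms 0 w) + suminf (\<lambda>n. real (cnt (m # ms) (Suc n) w) * t ^ Suc n)"
    unfolding gval_def by (subst suminf_split_head[OF s]) (simp add: cnt_Cons_0)
  also have "(\<lambda>n. real (cnt (m # ms) (Suc n) w) * t ^ Suc n) =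
    (\<lambda>n. real (cnt ms (Suc n) w) * t ^ Suc n + t * (real (cnt (m # ms) n (w - m)) * t ^ n))"
    by (simp only: cnt_Cons_Suc) (simp add: algebra_simps fun_eq_iff del: cnt.simps)
  also have "suminf \<dots> = suminf (\<lambda>n. real (cnt ms (Suc n) w) * t ^ Suc n) +
      suminf (\<lambda>n. t * (real (cnt (m # ms) n (w - m)) * t ^ n))"
    using summable_Suc_iff[THEN iffD2, OF s[of ms w]] by (intro suminf_add[symmetric] summable_mult s)
  also have "suminf (\<lambda>n. t * (real (cnt (m # ms) n (w - m)) * t ^ n)) = t * gval (m # ms) (w - m) t"
    unfolding gval_def by (rule suminf_mult[OF s])
  also have "suminf (\<lambda>n. real (cnt ms (Suc n) w) * t ^ Suc n) = gval ms w t - real (cnt ms 0 w)"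
    unfolding gval_def by (subst suminf_split_head[OF s]) simp
  finally show ?thesis by simp
qed

text \<open>The generating function of all \<open>cnt ms n w\<close> in t and e^(i \<theta>), in
  closed form.\<close>

definition char_fun :: "int list \<Rightarrow> real \<Rightarrow> real \<Rightarrow> complex" where
  "char_fun ms t \<theta> = (\<Prod>m\<leftarrow>ms. 1 / (1 - of_real t * cis (of_int m * \<theta>)))"

lemma one_minus_cis_neq_0: "0 < t \<Longrightarrow> t < 1 \<Longrightarrow> 1 - of_real t * cis x \<noteq> 0"
proof
  assume t: "0 < t" "t < 1" "1 - of_real t * cis x = 0"
  then have "norm (of_real t * cis x) = norm (1::complex)" by simp
  then show False using t by (simp add: norm_mult)
qed

lemma continuous_on_char_fun [continuous_intros]:
  assumes "0 < t" "t < 1"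
  shows "continuous_on S (char_fun ms t)"
  unfolding char_fun_def
proof (induction ms)
  case (Cons m ms)
  have "continuous_on S (\<lambda>\<theta>. 1 / (1 - of_real t * cis (of_int m * \<theta>)) * (\<Prod>m\<leftarrow>ms. 1 / (1 - of_real t * cis (of_int m * \<theta>))))"
    using one_minus_cis_neq_0[OF assms] by (intro continuous_intros Cons) auto
  then show ?case by simp
qed simp

lemma char_fun_Cons:
  assumes "0 < t" "t < 1"
  shows "char_fun (m # ms) t \<theta> = char_fun ms t \<theta> + of_real t * cis (of_int m * \<theta>) * char_fun (m # ms) t \<theta>"
  using one_minus_cis_neq_0[OF assms, of "of_int m * \<theta>"] by (simp add: char_fun_def field_simps)

lemma integral_cis:
  "integral {c..c + 2 * pi} (\<lambda>\<theta>. cis (of_int w * \<theta>)) = (if w = 0 then of_real (2 * pi) else 0)"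
proof (cases "w = 0")
  case False
  let ?F = "\<lambda>\<theta>. cis (of_int w * \<theta>) / (\<i> * of_int w)"
  have "((\<lambda>\<theta>. cis (of_int w * \<theta>)) has_integral (?F (c + 2 * pi) - ?F c)) {c..c + 2 * pi}"
  proof (rule fundamental_theorem_of_calculus)
    fix x
    have "((\<lambda>\<theta>. cis (of_int w * \<theta>)) has_vector_derivative (of_int w * (\<i> * cis (of_int w * x)))) (at x within {c..c + 2 * pi})"
      unfolding cis_conv_exp
      by (rule derivative_eq_intros has_vector_derivative_real_field | simp)+
    then have "(?F has_vector_derivative (of_int w * (\<i> * cis (of_int w * x))) / (\<i> * of_int w)) (at x within {c..c + 2 * pi})"
      by (rule has_vector_derivative_divide)
    then show "(?F has_vector_derivative cis (of_int w * x)) (at x within {c..c + 2 * pi})"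
      using False by simp
  qed simp
  moreover have "cis (of_int w * (c + 2 * pi)) = cis (of_int w * c)"
  proof -
    have "of_int w * (c + 2 * pi) = of_int w * c + 2 * pi * of_int w" by (simp add: algebra_simps)
    then show ?thesis using cis_multiple_2pi[of "of_int w"] by (simp only: cis_mult[symmetric]) simp
  qed
  ultimately show ?thesis using False by (simp add: integral_unique)
qed (simp add: scaleR_conv_of_real)

text \<open>Splitting off the first factor gives both sides the recursion J w = I w + t J (w - m),
  where I belongs to the shorter list. The difference \<Delta> then satisfies \<Delta> w = t
  \<Delta> (w - m) and is bounded uniformly in w, so iteration forces it to be 0. The endpoint c is
  free because both - \<pi> and - \<pi> / 2 will be needed.\<close>

lemma gval_integral:
  assumes t: "0 < t" "t < 1"
  shows "integral {c..c + 2 * pi} (\<lambda>\<theta>. cis (- of_int w * \<theta>) * char_fun ms t \<theta>) = of_real (2 * pi * gval ms w t)"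
proof (induction ms arbitrary: w)
  case Nil
  have "gval [] w t = (if w = 0 then 1 else 0)"
  proof -
    have "(\<lambda>n. real (cnt [] n w) * t ^ n) = (\<lambda>n. if n = 0 then (if w = 0 then 1 else 0) else 0)"
      by (auto simp: fun_eq_iff)
    then show ?thesis unfolding gval_def
      using suminf_finite[of "{0}" "\<lambda>n. if n = 0 then (if w = 0 then 1 else 0) else (0::real)"] by simp
  qed
  then show ?case using integral_cis[of c "- w"] by (simp add: char_fun_def)
next
  case (Cons m ms)
  let ?h = "char_fun (m # ms) t"
  define J where "J w = integral {c..c + 2 * pi} (\<lambda>\<theta>. cis (- of_int w * \<theta>) * ?h \<theta>)" for w :: int
  define \<Delta> where "\<Delta> w = J w - of_real (2 * pi * gval (m # ms) w t)" for w
  have J: "J w = of_real (2 * pi * gval ms w t) + of_real t * J (w - m)" for w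
  proof -
    have "(\<lambda>\<theta>. cis (- of_int w * \<theta>) * ?h \<theta>) =
        (\<lambda>\<theta>. cis (- of_int w * \<theta>) * char_fun ms t \<theta> + of_real t * (cis (- of_int (w - m) * \<theta>) * ?h \<theta>))"
    proof
      fix \<theta>
      have "cis (- of_int (w - m) * \<theta>) = cis (- of_int w * \<theta>) * cis (of_int m * \<theta>)"
        by (simp add: cis_mult algebra_simps)
      then show "cis (- of_int w * \<theta>) * ?h \<theta> =
        cis (- of_int w * \<theta>) * char_fun ms t \<theta> + of_real t * (cis (- of_int (w - m) * \<theta>) * ?h \<theta>)"
        by (subst char_fun_Cons[OF t]) (simp add: algebra_simps)
    qed
    then have "J w = integral {c..c + 2 * pi} (\<lambda>\<theta>. cis (- of_int w * \<theta>) * char_fun ms t \<theta> +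
        of_real t * (cis (- of_int (w - m) * \<theta>) * ?h \<theta>))"
      unfolding J_def by (rule arg_cong)
    also have "\<dots> = integral {c..c + 2 * pi} (\<lambda>\<theta>. cis (- of_int w * \<theta>) * char_fun ms t \<theta>) + of_real t * J (w - m)"
      unfolding J_def
      by (subst Henstock_Kurzweil_Integration.integral_add)
         (auto intro!: integrable_continuous_real continuous_intros t)
    finally show ?thesis by (simp only: Cons)
  qed
  have \<Delta>: "\<Delta> w = of_real t * \<Delta> (w - m)" for w
    unfolding \<Delta>_def by (subst J, subst gval_Cons[OF t]) (simp add: algebra_simps)
  obtain B where B: "\<And>w. norm (\<Delta> w) \<le> B"
  proof -
    have "compact (?h ` {c..c + 2 * pi})"
      by (intro compact_continuous_image continuous_intros t) auto
    then obtain b where b: "\<And>\<theta>. \<theta> \<in> {c..c + 2 * pi} \<Longrightarrow> norm (?h \<theta>) \<le> b"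
      by (meson bounded_iff compact_imp_bounded imageI)
    have "norm (J w) \<le> b * (c + 2 * pi - c)" for w
      unfolding J_def using b by (intro integral_bound) (auto simp: norm_mult intro!: continuous_intros t)
    moreover have "norm (complex_of_real (2 * pi * gval (m # ms) w t)) \<le>
        2 * pi * suminf (\<lambda>n. real ((n + 1) ^ length (m # ms)) * t ^ n)" for w
      using gval_bounds[OF t, of "m # ms" w] by (simp only: norm_of_real) (simp add: abs_mult)
    ultimately have "norm (\<Delta> w) \<le> b * (c + 2 * pi - c) + 2 * pi * suminf (\<lambda>n. real ((n + 1) ^ length (m # ms)) * t ^ n)" for w
      unfolding \<Delta>_def by (meson add_mono norm_triangle_ineq4 order_trans)
    then show thesis by (rule that)
  qed
  have "norm (\<Delta> w) \<le> t ^ k * B" for w k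
  proof (induction k arbitrary: w)
    case (Suc k)
    have "norm (\<Delta> w) = t * norm (\<Delta> (w - m))" using t by (subst \<Delta>) (simp add: norm_mult)
    also have "\<dots> \<le> t * (t ^ k * B)" using Suc t by (intro mult_left_mono) auto
    finally show ?case by simp
  qed (simp add: B)
  moreover have "(\<lambda>k. t ^ k * B) \<longlonglongrightarrow> 0 * B" using t by (intro tendsto_intros) auto
  ultimately have "norm (\<Delta> w) \<le> 0"
    by (intro tendsto_lowerbound[of "\<lambda>k. t ^ k * B"]) auto
  then show ?case by (simp add: \<Delta>_def J_def)
qed

lemma norm_one_minus_cis:
  "(1 - of_real t * cis x) * (1 - of_real t * cis (- x)) = of_real ((1 - t)\<^sup>2 + 4 * t * (sin (x / 2))\<^sup>2)"
proof -
  have 1: "cos x = 1 - 2 * (sin (x / 2))\<^sup>2" using cos_double_sin[of "x / 2"] by simp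
  have 2: "(sin x)\<^sup>2 + (cos x)\<^sup>2 = 1" by simp
  have "(1 - t * cos x) * (1 - t * cos x) + (t * sin x) * (t * sin x) =
      1 - 2 * t * cos x + t\<^sup>2 * ((sin x)\<^sup>2 + (cos x)\<^sup>2)"
    unfolding power2_eq_square distrib_left by (simp add: algebra_simps)
  also have "\<dots> = (1 - t)\<^sup>2 + 4 * t * (sin (x / 2))\<^sup>2"
    by (subst 2, subst 1) (simp add: power2_eq_square algebra_simps)
  finally have Re: "(1 - t * cos x) * (1 - t * cos x) + (t * sin x) * (t * sin x) = (1 - t)\<^sup>2 + 4 * t * (sin (x / 2))\<^sup>2" .
  show ?thesis
  proof (rule complex_eqI)
    show "Re ((1 - of_real t * cis x) * (1 - of_real t * cis (- x))) = Re (of_real ((1 - t)\<^sup>2 + 4 * t * (sin (x / 2))\<^sup>2))"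
      unfolding Re_complex_of_real Re[symmetric] by simp
  qed (simp add: algebra_simps)
qed

text \<open>The factors of m and - m are complex conjugates, so each pair contributes a real number;
  each weight 0 contributes 1 / (1 - t).\<close>

lemma char_fun_symmetric:
  assumes sym: "image_mset uminus (mset ms) = mset ms"
  defines "a \<equiv> filter (\<lambda>m. 0 < m) ms"
  shows "char_fun ms t \<theta> =
      of_real (1 / ((1 - t) ^ length (filter (\<lambda>m. m = 0) ms) *
        (\<Prod>m\<leftarrow>a. (1 - t)\<^sup>2 + 4 * t * (sin (of_int m * \<theta> / 2))\<^sup>2)))"
    and "length ms = 2 * length a + length (filter (\<lambda>m. m = 0) ms)"
proof -
  define g where "g m = 1 / (1 - of_real t * cis (of_int m * \<theta>))" for m :: int
  have neg: "filter_mset (\<lambda>m. m < 0) (mset ms) = image_mset uminus (filter_mset (\<lambda>m. 0 < m) (mset ms))"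
    by (subst sym[symmetric]) (simp add: filter_mset_image_mset)
  have split: "mset ms = filter_mset (\<lambda>m. 0 < m) (mset ms) + (filter_mset (\<lambda>m. m < 0) (mset ms) + filter_mset (\<lambda>m. m = 0) (mset ms))"
    by (rule multiset_eqI) (auto simp: not_less)
  have "char_fun ms t \<theta> = (\<Prod>m\<in>#mset ms. g m)"
    by (simp add: char_fun_def g_def prod_mset_prod_list flip: mset_map)
  also have "\<dots> = (\<Prod>m\<in>#mset a. g m * g (- m)) * (\<Prod>m\<in>#mset (filter (\<lambda>m. m = 0) ms). g m)"
    by (subst split) (simp add: neg a_def prod_mset.distrib image_mset.compositionality o_def mult_ac)
  also have "(\<Prod>m\<in>#mset (filter (\<lambda>m. m = 0) ms). g m) = (\<Prod>m\<in>#mset (filter (\<lambda>m. m = 0) ms). g 0)"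
    by (intro arg_cong[where f = prod_mset] image_mset_cong) auto
  also have "\<dots> = of_real (1 / (1 - t) ^ length (filter (\<lambda>m. m = 0) ms))"
    by (simp add: g_def power_divide del: mset_filter)
  also have "(\<Prod>m\<in>#mset a. g m * g (- m)) =
      of_real (1 / (\<Prod>m\<leftarrow>a. (1 - t)\<^sup>2 + 4 * t * (sin (of_int m * \<theta> / 2))\<^sup>2))"
  proof -
    have "g m * g (- m) = of_real (1 / ((1 - t)\<^sup>2 + 4 * t * (sin (of_int m * \<theta> / 2))\<^sup>2))" for m
      using norm_one_minus_cis[of t "of_int m * \<theta>"] by (simp add: g_def)
    then have "(\<Prod>m\<in>#mset a. g m * g (- m)) = (\<Prod>m\<leftarrow>a. of_real (1 / ((1 - t)\<^sup>2 + 4 * t * (sin (of_int m * \<theta> / 2))\<^sup>2)))"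
      by (simp add: prod_mset_prod_list flip: mset_map)
    also have "\<dots> = of_real (1 / (\<Prod>m\<leftarrow>a. (1 - t)\<^sup>2 + 4 * t * (sin (of_int m * \<theta> / 2))\<^sup>2))"
      by (induction a) auto
    finally show ?thesis .
  qed
  finally show "char_fun ms t \<theta> =
      of_real (1 / ((1 - t) ^ length (filter (\<lambda>m. m = 0) ms) *
        (\<Prod>m\<leftarrow>a. (1 - t)\<^sup>2 + 4 * t * (sin (of_int m * \<theta> / 2))\<^sup>2)))"
    by (simp add: mult_ac)
  have "size (mset ms) = size (mset a) + (size (mset a) + size (mset (filter (\<lambda>m. m = 0) ms)))"
    by (subst split) (simp add: neg a_def)
  then have "length ms = length a + (length a + length (filter (\<lambda>m. m = 0) ms))" by (simp only: size_mset)
  then show "length ms = 2 * length a + length (filter (\<lambda>m. m = 0) ms)" by simp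
qed


section \<open>The behaviour of the integral as \<open>t\<close> tends to 1\<close>

text \<open>Here z counts the zero weights, and each positive weight m in a stands for the pair m, -
  m.\<close>

definition kern :: "nat \<Rightarrow> nat \<Rightarrow> int list \<Rightarrow> real \<Rightarrow> real \<Rightarrow> real" where
  "kern L z a t \<theta> = 2 * sin (real (L + 1) * \<theta>) * sin \<theta> /
     ((1 - t) ^ z * (\<Prod>m\<leftarrow>a. (1 - t)\<^sup>2 + 4 * t * (sin (of_int m * \<theta> / 2))\<^sup>2))"

lemma prod_list_pos:
  fixes f :: "'a \<Rightarrow> real"
  assumes "\<And>x. x \<in> set xs \<Longrightarrow> 0 < f x"
  shows "0 < (\<Prod>x\<leftarrow>xs. f x)"
  using assms by (induction xs) auto

lemma continuous_on_kern:
  assumes "0 < t" "t < 1"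
  shows "continuous_on S (kern L z a t)"
proof -
  have pos: "0 < (1 - t)\<^sup>2 + 4 * t * (sin (of_int m * \<theta> / 2))\<^sup>2" for m \<theta>
    using assms by (intro add_pos_nonneg) auto
  have "continuous_on S (\<lambda>\<theta>. \<Prod>m\<leftarrow>a. (1 - t)\<^sup>2 + 4 * t * (sin (of_int m * \<theta> / 2))\<^sup>2)"
    by (induction a) (auto intro!: continuous_intros)
  moreover have "(1 - t) ^ z * (\<Prod>m\<leftarrow>a. (1 - t)\<^sup>2 + 4 * t * (sin (of_int m * \<theta> / 2))\<^sup>2) \<noteq> 0" for \<theta>
  proof -
    have "0 < (1 - t) ^ z * (\<Prod>m\<leftarrow>a. (1 - t)\<^sup>2 + 4 * t * (sin (of_int m * \<theta> / 2))\<^sup>2)"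
      using assms by (intro mult_pos_pos prod_list_pos pos) auto
    then show ?thesis by (rule less_imp_neq[THEN not_sym])
  qed
  ultimately show ?thesis
    unfolding kern_def by (intro continuous_intros) auto
qed

text \<open>Symmetry makes \<open>char_fun\<close> real, so taking real parts turns the two
  exponentials into cos (L \<theta>) - cos ((L + 2) \<theta>), which is the product of sines in
  \<open>kern\<close>.\<close>

lemma gval_diff_integral:
  assumes t: "0 < t" "t < 1" and sym: "image_mset uminus (mset ms) = mset ms"
  shows "2 * pi * (gval ms (- int L) t - gval ms (int L + 2) t) =
    integral {c..c + 2 * pi} (kern L (length (filter (\<lambda>m. m = 0) ms)) (filter (\<lambda>m. 0 < m) ms) t)"
proof -
  let ?z = "length (filter (\<lambda>m. m = 0) ms)" and ?a = "filter (\<lambda>m. 0 < m) ms"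
  define D where "D \<theta> = (1 - t) ^ ?z * (\<Prod>m\<leftarrow>?a. (1 - t)\<^sup>2 + 4 * t * (sin (of_int m * \<theta> / 2))\<^sup>2)" for \<theta>
  let ?f = "\<lambda>w \<theta>. cis (- of_int w * \<theta>) * char_fun ms t \<theta>"
  have int: "?f w integrable_on {c..c + 2 * pi}" for w
    by (intro integrable_continuous_real continuous_intros t)
  have eq: "integral {c..c + 2 * pi} (\<lambda>\<theta>. ?f (- int L) \<theta> - ?f (int L + 2) \<theta>) =
      of_real (2 * pi * gval ms (- int L) t) - of_real (2 * pi * gval ms (int L + 2) t)"
    by (subst Henstock_Kurzweil_Integration.integral_diff[OF int int]) (simp only: gval_integral[OF t])
  have "2 * pi * (gval ms (- int L) t - gval ms (int L + 2) t) =
      Re (integral {c..c + 2 * pi} (\<lambda>\<theta>. ?f (- int L) \<theta> - ?f (int L + 2) \<theta>))"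
    unfolding eq by (simp add: algebra_simps)
  also have "\<dots> = integral {c..c + 2 * pi} (Re \<circ> (\<lambda>\<theta>. ?f (- int L) \<theta> - ?f (int L + 2) \<theta>))"
    by (intro integral_linear[symmetric] bounded_linear_Re integrable_diff int)
  also have "Re \<circ> (\<lambda>\<theta>. ?f (- int L) \<theta> - ?f (int L + 2) \<theta>) = kern L ?z ?a t"
  proof
    fix \<theta>
    have "cos (real L * \<theta>) - cos (real (L + 2) * \<theta>) = 2 * sin (real (L + 1) * \<theta>) * sin \<theta>"
      unfolding cos_diff_cos by (simp add: algebra_simps add_divide_distrib)
    moreover have "cos (- (\<theta> * real L) - \<theta> * 2) = cos (\<theta> * real L + \<theta> * 2)"
      using cos_minus[of "\<theta> * real L + \<theta> * 2"] by simp
    ultimately show "(Re \<circ> (\<lambda>\<theta>. ?f (- int L) \<theta> - ?f (int L + 2) \<theta>)) \<theta> = kern L ?z ?a t \<theta>"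
      unfolding char_fun_symmetric(1)[OF sym] kern_def D_def[symmetric]
      by (simp add: diff_divide_distrib[symmetric] algebra_simps)
  qed
  finally show ?thesis .
qed

lemma abs_sin_mult_le: "\<bar>sin (real n * x)\<bar> \<le> real n * \<bar>sin x\<bar>"
proof (induction n)
  case (Suc n)
  have "\<bar>sin (real (Suc n) * x)\<bar> = \<bar>sin (real n * x) * cos x + cos (real n * x) * sin x\<bar>"
    by (simp add: algebra_simps sin_add)
  also have "\<dots> \<le> \<bar>sin (real n * x)\<bar> * \<bar>cos x\<bar> + \<bar>cos (real n * x)\<bar> * \<bar>sin x\<bar>"
    by (metis abs_mult abs_triangle_ineq)
  also have "\<dots> \<le> \<bar>sin (real n * x)\<bar> * 1 + 1 * \<bar>sin x\<bar>"
    by (intro add_mono mult_left_mono mult_right_mono) auto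
  finally show ?case using Suc by (simp add: algebra_simps)
qed simp

lemma tendsto_sin_mult_div:
  assumes "e \<longlonglongrightarrow> 0" "\<And>k. e k \<noteq> (0::real)"
  shows "(\<lambda>k. sin (c * e k) / e k) \<longlonglongrightarrow> c"
proof -
  have "DERIV (\<lambda>h. sin (c * h)) 0 :> c"
    by (auto intro!: derivative_eq_intros)
  then have "((\<lambda>h. sin (c * h) / h) \<longlongrightarrow> c) (at 0)"
    by (simp add: DERIV_def)
  moreover have "filterlim e (at 0) sequentially"
    using assms by (simp add: filterlim_at)
  ultimately show ?thesis by (rule filterlim_compose)
qed

text \<open>In the variable x = \<theta> / (1 - t) the hypothesis \<open>dom\<close> bounds the
  scaled integrand by a constant times 1 / (1 + (r x)^2), uniformly in t. It isolates all that has
  to be known about the weights away from \<theta> = 0.\<close>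

lemma kern_limit:
  fixes a :: "int list" and \<Theta> :: real
  assumes pos: "\<And>m. m \<in> set a \<Longrightarrow> 0 < m" and len: "2 \<le> length a" and \<Theta>: "0 < \<Theta>" and r: "0 < r"
    and dom: "\<And>t \<theta>. 1 / 2 \<le> t \<Longrightarrow> t < 1 \<Longrightarrow> \<bar>\<theta>\<bar> \<le> \<Theta> \<Longrightarrow>
      (sin \<theta> / (1 - t))\<^sup>2 * (1 + (r * \<theta> / (1 - t))\<^sup>2) \<le>
      2 * (\<Prod>m\<leftarrow>a. 1 + 4 * t * (sin (of_int m * \<theta> / 2) / (1 - t))\<^sup>2)"
  defines "\<epsilon> \<equiv> \<lambda>k. 1 / real (k + 2)"
  shows "(\<lambda>k. \<epsilon> k ^ (z + 2 * length a - 3) * integral {-\<Theta>..\<Theta>} (kern L z a (1 - \<epsilon> k)))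
    \<longlonglongrightarrow> 2 * pi * real (L + 1) * lap_integral (map of_int a)"
proof -
  \<comment> \<open>The kernel has z + 2 \<open>length a\<close> powers of
    \<open>\<epsilon> k\<close> in its denominator. The substitution returns one power and the two
    sines return one each, hence the 3.\<close>
  define N where "N = z + 2 * length a - 3"
  have N: "N + 3 = z + 2 * length a" using len by (simp add: N_def)
  have \<epsilon>: "0 < \<epsilon> k" "\<epsilon> k \<le> 1 / 2" for k by (auto simp: \<epsilon>_def field_simps)
  have \<epsilon>0: "\<epsilon> \<longlonglongrightarrow> 0"
    using LIMSEQ_ignore_initial_segment[OF LIMSEQ_inverse_real_of_nat, of 1]
    by (simp add: \<epsilon>_def divide_inverse numeral_2_eq_2)
  define P where "P k \<theta> = (\<Prod>m\<leftarrow>a. 1 + 4 * (1 - \<epsilon> k) * (sin (of_int m * \<theta> / 2) / \<epsilon> k)\<^sup>2)" for k \<theta>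
  have P: "0 < P k \<theta>" for k \<theta>
    unfolding P_def using \<epsilon>[of k] by (intro prod_list_pos add_pos_nonneg) auto
  define g where "g k x = indicator {-\<Theta>..\<Theta>} (\<epsilon> k * x) *
    (2 * (sin (real (L + 1) * (\<epsilon> k * x)) / \<epsilon> k) * (sin (\<epsilon> k * x) / \<epsilon> k) / P k (\<epsilon> k * x))" for k and x :: real
  have scaled: "\<epsilon> k ^ N * integral {-\<Theta>..\<Theta>} (kern L z a (1 - \<epsilon> k)) = (LINT x|lborel. g k x)" for k
  proof -
    let ?K = "kern L z a (1 - \<epsilon> k)"
    have K: "continuous_on {-\<Theta>..\<Theta>} ?K" using \<epsilon>[of k] by (intro continuous_on_kern) auto
    have "integral {-\<Theta>..\<Theta>} ?K = (LINT \<theta>|lborel. indicator {-\<Theta>..\<Theta>} \<theta> * ?K \<theta>)"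
      using set_borel_integral_eq_integral(2)[OF borel_integrable_atLeastAtMost'[OF K]]
      by (simp add: set_lebesgue_integral_def)
    also have "\<dots> = \<bar>\<epsilon> k\<bar> *\<^sub>R (LINT x|lborel. indicator {-\<Theta>..\<Theta>} (0 + \<epsilon> k * x) * ?K (0 + \<epsilon> k * x))"
      using \<epsilon>(1)[of k] by (intro lborel_integral_real_affine) auto
    finally have "\<epsilon> k ^ N * integral {-\<Theta>..\<Theta>} ?K =
        (LINT x|lborel. \<epsilon> k ^ Suc N * (indicator {-\<Theta>..\<Theta>} (\<epsilon> k * x) * ?K (\<epsilon> k * x)))"
      using \<epsilon>(1)[of k] by simp
    also have "(\<lambda>x. \<epsilon> k ^ Suc N * (indicator {-\<Theta>..\<Theta>} (\<epsilon> k * x) * ?K (\<epsilon> k * x))) = g k"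
    proof
      fix x
      define \<theta> where "\<theta> = \<epsilon> k * x"
      have "(\<epsilon> k)\<^sup>2 + 4 * (1 - \<epsilon> k) * (sin (of_int m * \<theta> / 2))\<^sup>2 =
          (\<epsilon> k)\<^sup>2 * (1 + 4 * (1 - \<epsilon> k) * (sin (of_int m * \<theta> / 2) / \<epsilon> k)\<^sup>2)" for m
        using \<epsilon>(1)[of k] by (simp add: field_simps)
      then have "(\<Prod>m\<leftarrow>a. (\<epsilon> k)\<^sup>2 + 4 * (1 - \<epsilon> k) * (sin (of_int m * \<theta> / 2))\<^sup>2) =
          (\<Prod>m\<leftarrow>a. (\<epsilon> k)\<^sup>2 * (1 + 4 * (1 - \<epsilon> k) * (sin (of_int m * \<theta> / 2) / \<epsilon> k)\<^sup>2))"
        by simp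
      also have "\<dots> = \<epsilon> k ^ (2 * length a) * P k \<theta>"
        unfolding P_def by (induction a) (auto simp: power2_eq_square)
      finally have "?K \<theta> = 2 * sin (real (L + 1) * \<theta>) * sin \<theta> / (\<epsilon> k ^ (N + 3) * P k \<theta>)"
        unfolding kern_def N by (simp add: power_add mult.assoc)
      moreover have "\<epsilon> k ^ (N + 3) = \<epsilon> k ^ Suc N * (\<epsilon> k * \<epsilon> k)"
        by (simp add: numeral_3_eq_3)
      ultimately have eq: "\<epsilon> k ^ Suc N * ?K \<theta> =
          2 * (sin (real (L + 1) * \<theta>) / \<epsilon> k) * (sin \<theta> / \<epsilon> k) / P k \<theta>"
        using \<epsilon>(1)[of k] by simp
      have "\<epsilon> k ^ Suc N * (I * ?K \<theta>) = I * (\<epsilon> k ^ Suc N * ?K \<theta>)" for I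
        by (rule mult.left_commute)
      then show "\<epsilon> k ^ Suc N * (indicator {-\<Theta>..\<Theta>} (\<epsilon> k * x) * ?K (\<epsilon> k * x)) = g k x"
        by (simp only: g_def \<theta>_def[symmetric] eq)
    qed
    finally show ?thesis .
  qed
  have "(\<lambda>k. LINT x|lborel. g k x) \<longlonglongrightarrow>
      (LINT x|lborel. 2 * real (L + 1) * (x\<^sup>2 / (\<Prod>m\<leftarrow>map of_int a. 1 + (m * x)\<^sup>2)))"
  proof (rule integral_dominated_convergence[where w = "\<lambda>x. 4 * real (L + 1) * (1 / (1 + (r * x)\<^sup>2))"])
    have [measurable]: "(\<lambda>x. \<Prod>m\<leftarrow>ts. 1 + (m * x)\<^sup>2) \<in> borel_measurable borel" for ts :: "real list"
      by (induction ts) auto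
    have [measurable]: "(\<lambda>x. P k (\<epsilon> k * x)) \<in> borel_measurable borel" for k
      unfolding P_def by (induction a) auto
    show "(\<lambda>x. 2 * real (L + 1) * (x\<^sup>2 / (\<Prod>m\<leftarrow>map of_int a. 1 + (m * x)\<^sup>2))) \<in> borel_measurable lborel"
      "\<And>k. g k \<in> borel_measurable lborel"
      unfolding g_def by measurable
    show "integrable lborel (\<lambda>x. 4 * real (L + 1) * (1 / (1 + (r * x)\<^sup>2)))"
      using has_bochner_integral_inverse_1_plus_square[OF r]
      by (intro integrable_mult_right) (auto simp: has_bochner_integral_iff)
    \<comment> \<open>The estimate |sin ((L + 1) \<theta>)| \<le> (L + 1) |sin \<theta>| trades the
      first sine for the second, so that the square controlled by \<open>dom\<close>
      appears.\<close>
    show "AE x in lborel. norm (g k x) \<le> 4 * real (L + 1) * (1 / (1 + (r * x)\<^sup>2))" for k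
    proof (intro AE_I2)
      fix x
      define \<theta> where "\<theta> = \<epsilon> k * x"
      have x: "r * \<theta> / \<epsilon> k = r * x" using \<epsilon>(1)[of k] by (simp add: \<theta>_def)
      have pos': "0 < 1 + (r * x)\<^sup>2" by (intro add_pos_nonneg) auto
      show "norm (g k x) \<le> 4 * real (L + 1) * (1 / (1 + (r * x)\<^sup>2))"
      proof (cases "\<bar>\<theta>\<bar> \<le> \<Theta>")
        case True
        have "(sin \<theta> / \<epsilon> k)\<^sup>2 * (1 + (r * x)\<^sup>2) \<le> 2 * P k \<theta>"
          using dom[of "1 - \<epsilon> k" \<theta>] \<epsilon>[of k] True by (simp add: P_def x del: times_divide_eq_right times_divide_eq_left)
        moreover have "X / p \<le> 2 * (1 / q)" if "X * q \<le> 2 * p" "0 < p" "0 < q" for X p q :: real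
          using that by (simp add: field_simps)
        ultimately have S: "(sin \<theta> / \<epsilon> k)\<^sup>2 / P k \<theta> \<le> 2 * (1 / (1 + (r * x)\<^sup>2))"
          using P[of k \<theta>] pos' by blast
        have "norm (g k x) \<le> \<bar>2 * (sin (real (L + 1) * \<theta>) / \<epsilon> k) * (sin \<theta> / \<epsilon> k) / P k \<theta>\<bar>"
          by (simp add: g_def \<theta>_def indicator_def)
        also have "\<dots> = 2 * \<bar>sin (real (L + 1) * \<theta>)\<bar> * (\<bar>sin \<theta>\<bar> / (\<epsilon> k)\<^sup>2 / P k \<theta>)"
          using P[of k \<theta>] \<epsilon>(1)[of k] by (simp add: abs_mult power2_eq_square)
        also have "\<dots> \<le> 2 * (real (L + 1) * \<bar>sin \<theta>\<bar>) * (\<bar>sin \<theta>\<bar> / (\<epsilon> k)\<^sup>2 / P k \<theta>)"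
          using P[of k \<theta>] by (intro mult_right_mono mult_left_mono abs_sin_mult_le) auto
        also have "\<dots> = 2 * real (L + 1) * ((\<bar>sin \<theta>\<bar> * \<bar>sin \<theta>\<bar>) / (\<epsilon> k)\<^sup>2 / P k \<theta>)"
          by (simp only: times_divide_eq_right mult.assoc)
        also have "\<dots> = 2 * real (L + 1) * ((sin \<theta> / \<epsilon> k)\<^sup>2 / P k \<theta>)"
          by (simp add: power2_eq_square)
        also have "\<dots> \<le> 2 * real (L + 1) * (2 * (1 / (1 + (r * x)\<^sup>2)))"
          using S by (intro mult_left_mono) auto
        finally show ?thesis by simp
      next
        case False
        then have "\<theta> \<notin> {-\<Theta>..\<Theta>}" by auto
        then have "g k x = 0" by (simp add: g_def \<theta>_def)
        then show ?thesis using pos' by simp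
      qed
    qed
    show "AE x in lborel. (\<lambda>k. g k x) \<longlonglongrightarrow> 2 * real (L + 1) * (x\<^sup>2 / (\<Prod>m\<leftarrow>map of_int a. 1 + (m * x)\<^sup>2))"
    proof (intro AE_I2)
      fix x :: real
      have ne: "\<epsilon> k \<noteq> 0" for k using \<epsilon>(1)[of k] by simp
      have sl: "(\<lambda>k. sin (c * x * \<epsilon> k) / \<epsilon> k) \<longlonglongrightarrow> c * x" for c
        by (rule tendsto_sin_mult_div[OF \<epsilon>0 ne])
      have "(\<lambda>k. P k (\<epsilon> k * x)) \<longlonglongrightarrow> (\<Prod>m\<leftarrow>a. 1 + 4 * (1 - 0) * (of_int m / 2 * x)\<^sup>2)"
        unfolding P_def
      proof (induction a)
        case (Cons m a)
        have "(\<lambda>k. 1 + 4 * (1 - \<epsilon> k) * (sin (of_int m / 2 * x * \<epsilon> k) / \<epsilon> k)\<^sup>2) \<longlonglongrightarrow> 1 + 4 * (1 - 0) * (of_int m / 2 * x)\<^sup>2"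
          by (intro tendsto_intros \<epsilon>0 sl)
        from tendsto_mult[OF this Cons] show ?case by (simp add: mult_ac)
      qed simp
      also have "(\<Prod>m\<leftarrow>a. 1 + 4 * (1 - 0) * (of_int m / 2 * x)\<^sup>2) = (\<Prod>m\<leftarrow>map of_int a. 1 + (m * x)\<^sup>2)"
        by (simp add: power_mult_distrib power_divide o_def)
      finally have P_lim: "(\<lambda>k. P k (\<epsilon> k * x)) \<longlonglongrightarrow> (\<Prod>m\<leftarrow>map of_int a. 1 + (m * x)\<^sup>2)" .
      have nz: "(\<Prod>m\<leftarrow>map of_int a. 1 + (m * x)\<^sup>2) \<noteq> 0"
        by (rule less_imp_neq[THEN not_sym], rule prod_list_pos) (simp add: add_pos_nonneg)
      have "(\<lambda>k. 2 * (sin (real (L + 1) * x * \<epsilon> k) / \<epsilon> k) * (sin (1 * x * \<epsilon> k) / \<epsilon> k) / P k (\<epsilon> k * x))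
        \<longlonglongrightarrow> 2 * (real (L + 1) * x) * (1 * x) / (\<Prod>m\<leftarrow>map of_int a. 1 + (m * x)\<^sup>2)"
        by (intro tendsto_intros sl P_lim nz)
      also have "2 * (real (L + 1) * x) * (1 * x) / (\<Prod>m\<leftarrow>map of_int a. 1 + (m * x)\<^sup>2) =
          2 * real (L + 1) * (x\<^sup>2 / (\<Prod>m\<leftarrow>map of_int a. 1 + (m * x)\<^sup>2))"
        by (simp add: power2_eq_square)
      finally have lim: "(\<lambda>k. 2 * (sin (real (L + 1) * x * \<epsilon> k) / \<epsilon> k) * (sin (1 * x * \<epsilon> k) / \<epsilon> k) / P k (\<epsilon> k * x))
        \<longlonglongrightarrow> 2 * real (L + 1) * (x\<^sup>2 / (\<Prod>m\<leftarrow>map of_int a. 1 + (m * x)\<^sup>2))" .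
      \<comment> \<open>For fixed x the cut-off at \<Theta> is eventually inactive.\<close>
      have "(\<lambda>k. \<bar>\<epsilon> k * x\<bar>) \<longlonglongrightarrow> \<bar>0 * x\<bar>" by (intro tendsto_intros \<epsilon>0)
      then have "eventually (\<lambda>k. \<bar>\<epsilon> k * x\<bar> < \<Theta>) sequentially"
        using \<Theta> by (intro order_tendstoD(2)) auto
      then show "(\<lambda>k. g k x) \<longlonglongrightarrow> 2 * real (L + 1) * (x\<^sup>2 / (\<Prod>m\<leftarrow>map of_int a. 1 + (m * x)\<^sup>2))"
      proof (intro Lim_transform_eventually[OF lim], eventually_elim)
        case (elim k)
        then have "indicator {-\<Theta>..\<Theta>} (\<epsilon> k * x) = (1::real)" by (auto simp: indicator_def abs_less_iff)
        then show ?case by (simp add: g_def mult_ac)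
      qed
    qed
  qed
  also have "(LINT x|lborel. 2 * real (L + 1) * (x\<^sup>2 / (\<Prod>m\<leftarrow>map of_int a. 1 + (m * x)\<^sup>2))) =
      2 * pi * real (L + 1) * lap_integral (map of_int a)"
    unfolding lap_integral_def by (subst integral_mult_right_zero) simp
  finally show ?thesis unfolding scaled[symmetric] N_def .
qed


section \<open>Domination\<close>

lemma abs_sin_ge:
  fixes u :: real
  assumes "\<bar>u\<bar> \<le> pi / 2"
  shows "\<bar>u\<bar> / 2 \<le> \<bar>sin u\<bar>"
proof -
  \<comment> \<open>The number 8 / 5 is a rational bound for \<pi> / 2 whose square is below 3; then
    the cubic Taylor error |u|^3 / 6 is at most |u| / 2.\<close>
  have "\<bar>u\<bar> \<le> 8 / 5" using assms pi_approx by simp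
  then have "\<bar>u\<bar>\<^sup>2 \<le> (8 / 5)\<^sup>2" by (intro power_mono) auto
  then have "\<bar>u\<bar>\<^sup>2 \<le> 3" by (simp add: power2_eq_square)
  then have "\<bar>u\<bar> * \<bar>u\<bar>\<^sup>2 \<le> \<bar>u\<bar> * 3" by (intro mult_left_mono) auto
  moreover have "\<bar>sin u - u\<bar> \<le> \<bar>u\<bar> ^ 3 / 6"
    using Maclaurin_sin_bound[of u 3] by (simp add: numeral_3_eq_3 sin_coeff_def fact_numeral field_simps)
  ultimately have "\<bar>sin u - u\<bar> \<le> \<bar>u\<bar> / 2" by (simp add: power3_eq_cube power2_eq_square)
  then show ?thesis by linarith
qed

text \<open>The two half-angles differ by \<theta>, so by the addition formula both sines can be
  small only where sin \<theta> is small.\<close>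

lemma sin_square_le_pair:
  fixes \<theta> p :: real
  shows "(sin \<theta>)\<^sup>2 \<le> 2 * ((sin (p * \<theta> / 2))\<^sup>2 + (sin ((p + 2) * \<theta> / 2))\<^sup>2)"
proof -
  define x y where "x = sin (p * \<theta> / 2)" and "y = sin ((p + 2) * \<theta> / 2)"
  have "sin \<theta> = sin ((p + 2) * \<theta> / 2 - p * \<theta> / 2)"
    by (rule arg_cong[of _ _ sin]) (simp add: field_simps)
  also have "\<bar>\<dots>\<bar> = \<bar>y * cos (p * \<theta> / 2) - cos ((p + 2) * \<theta> / 2) * x\<bar>"
    by (simp only: sin_diff x_def y_def)
  also have "\<dots> \<le> \<bar>y\<bar> * \<bar>cos (p * \<theta> / 2)\<bar> + \<bar>cos ((p + 2) * \<theta> / 2)\<bar> * \<bar>x\<bar>"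
    by (metis abs_mult abs_triangle_ineq4)
  also have "\<dots> \<le> \<bar>y\<bar> * 1 + 1 * \<bar>x\<bar>"
    by (intro add_mono mult_left_mono mult_right_mono) auto
  finally have "\<bar>sin \<theta>\<bar>\<^sup>2 \<le> (\<bar>x\<bar> + \<bar>y\<bar>)\<^sup>2" by (intro power_mono) auto
  also have "\<dots> \<le> 2 * (\<bar>x\<bar>\<^sup>2 + \<bar>y\<bar>\<^sup>2)"
    using zero_le_power2[of "\<bar>x\<bar> - \<bar>y\<bar>"] by (simp add: power2_eq_square algebra_simps)
  finally show ?thesis by (simp add: x_def y_def)
qed

lemma prod_mset_le_prod_list:
  fixes \<phi> :: "'a \<Rightarrow> real"
  assumes sub: "A \<subseteq># mset a" and ge: "\<And>m. 1 \<le> \<phi> m"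
  shows "(\<Prod>m\<in>#A. \<phi> m) \<le> (\<Prod>m\<leftarrow>a. \<phi> m)"
proof -
  obtain B where B: "mset a = A + B" using sub by (metis subset_mset.le_iff_add)
  have *: "1 \<le> (\<Prod>m\<in>#M. \<phi> m)" for M
  proof (induction M)
    case (add x M)
    have "1 * 1 \<le> \<phi> x * (\<Prod>m\<in>#M. \<phi> m)"
      using add ge[of x] by (intro mult_mono) auto
    then show ?case by simp
  qed simp
  have "(\<Prod>m\<in>#A. \<phi> m) * 1 \<le> (\<Prod>m\<in>#A. \<phi> m) * (\<Prod>m\<in>#B. \<phi> m)"
    using *[of A] *[of B] by (intro mult_left_mono) auto
  also have "\<dots> = (\<Prod>m\<in>#mset a. \<phi> m)" by (simp add: B)
  finally show ?thesis by (simp add: prod_mset_prod_list flip: mset_map)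
qed

text \<open>The half-angle of the weight p stays in [- \<pi> / 2, \<pi> / 2], so its factor is
  bounded below by a multiple of \<theta> and supplies the decay. The factors in A, taken from the
  remaining weights, absorb the square of sin \<theta>.\<close>

lemma dominated_by_sub_mset:
  fixes t \<theta> :: real and p :: int
  assumes t: "1 / 2 \<le> t" "t < 1" and p: "0 < p" and \<theta>: "\<bar>of_int p * \<theta> / 2\<bar> \<le> pi / 2"
    and sub: "add_mset p A \<subseteq># mset a"
    and A: "A = {#p#} \<or> A = {#2#} \<or> A = {#q, q + 2#}"
  defines "\<phi> \<equiv> \<lambda>m::int. 1 + 4 * t * (sin (of_int m * \<theta> / 2) / (1 - t))\<^sup>2"
  assumes "p = 1 \<or> p = 2"
  shows "(sin \<theta> / (1 - t))\<^sup>2 * (1 + (1 / 4 * \<theta> / (1 - t))\<^sup>2) \<le> 2 * (\<Prod>m\<leftarrow>a. \<phi> m)"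
proof -
  define e where "e = 1 - t"
  have e: "0 < e" using t by (simp add: e_def)
  have \<phi>1: "1 \<le> \<phi> m" for m using t by (simp add: \<phi>_def)
  have \<phi>2: "1 + 2 * (sin (of_int m * \<theta> / 2) / e)\<^sup>2 \<le> \<phi> m" for m
    unfolding \<phi>_def e_def using t by (intro add_left_mono mult_right_mono) auto
  \<comment> \<open>The constant 1 / 4 is 1 / 2 from the half-angle, as p is at least 1, times 1 / 2
    from \<open>abs_sin_ge\<close>.\<close>
  have first: "1 + (1 / 4 * \<theta> / e)\<^sup>2 \<le> \<phi> p"
  proof -
    have "\<bar>\<theta>\<bar> \<le> \<bar>of_int p * \<theta>\<bar>"
      using p by (simp add: abs_mult mult_le_cancel_right1)
    then have "\<bar>\<theta> / 4\<bar> \<le> \<bar>of_int p * \<theta> / 2\<bar> / 2" by simp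
    also have "\<dots> \<le> \<bar>sin (of_int p * \<theta> / 2)\<bar>" by (rule abs_sin_ge[OF \<theta>])
    finally have "(\<theta> / 4)\<^sup>2 \<le> (sin (of_int p * \<theta> / 2))\<^sup>2" by (rule abs_le_square_iff[THEN iffD1])
    then have "(\<theta> / 4)\<^sup>2 / e\<^sup>2 \<le> (sin (of_int p * \<theta> / 2))\<^sup>2 / e\<^sup>2" by (intro divide_right_mono) auto
    then have "(1 / 4 * \<theta> / e)\<^sup>2 \<le> (sin (of_int p * \<theta> / 2) / e)\<^sup>2" by (simp add: power_divide)
    also have "\<dots> \<le> 2 * (sin (of_int p * \<theta> / 2) / e)\<^sup>2" by simp
    finally show ?thesis using \<phi>2[of p] by linarith
  qed
  have \<phi>_2: "(sin \<theta> / e)\<^sup>2 \<le> 2 * \<phi> 2"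
  proof -
    have "1 + 2 * (sin \<theta> / e)\<^sup>2 \<le> \<phi> 2" using \<phi>2[of 2] by simp
    then show ?thesis using zero_le_power2[of "sin \<theta> / e"] by linarith
  qed
  have \<phi>_1: "(sin \<theta> / e)\<^sup>2 \<le> 2 * \<phi> 1"
  proof -
    have "(sin \<theta>)\<^sup>2 = 4 * (sin (\<theta> / 2))\<^sup>2 * (cos (\<theta> / 2))\<^sup>2"
      using sin_double[of "\<theta> / 2"] by (simp add: power_mult_distrib)
    also have "\<dots> \<le> 4 * (sin (\<theta> / 2))\<^sup>2 * 1"
      by (intro mult_left_mono) (auto simp: power2_eq_1_iff abs_square_le_1)
    finally have "(sin \<theta>)\<^sup>2 / e\<^sup>2 \<le> (4 * (sin (\<theta> / 2))\<^sup>2 * 1) / e\<^sup>2" by (intro divide_right_mono) auto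
    then have "(sin \<theta> / e)\<^sup>2 \<le> 4 * (sin (\<theta> / 2) / e)\<^sup>2" by (simp add: power_divide)
    then show ?thesis using \<phi>2[of 1] by simp
  qed
  have second: "(sin \<theta> / e)\<^sup>2 \<le> 2 * (\<Prod>m\<in>#A. \<phi> m)"
    using A
  proof (elim disjE)
    assume A: "A = {#q, q + 2#}"
    define x y where "x = (sin (of_int q * \<theta> / 2))\<^sup>2 / e\<^sup>2" and "y = (sin ((of_int q + 2) * \<theta> / 2))\<^sup>2 / e\<^sup>2"
    have xy: "0 \<le> x" "0 \<le> y" by (simp_all add: x_def y_def)
    have "(sin \<theta>)\<^sup>2 / e\<^sup>2 \<le> 2 * ((sin (of_int q * \<theta> / 2))\<^sup>2 + (sin ((of_int q + 2) * \<theta> / 2))\<^sup>2) / e\<^sup>2"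
      by (intro divide_right_mono sin_square_le_pair) auto
    then have "(sin \<theta> / e)\<^sup>2 \<le> 2 * (x + y)" by (simp add: x_def y_def power_divide add_divide_distrib)
    also have "\<dots> \<le> (1 + 2 * x) * (1 + 2 * y)"
      using mult_nonneg_nonneg[OF xy] by (simp add: algebra_simps)
    also have "\<dots> \<le> \<phi> q * \<phi> (q + 2)"
      using \<phi>2[of q] \<phi>2[of "q + 2"] \<phi>1[of q]
      by (intro mult_mono) (auto simp: x_def y_def power_divide)
    also have "\<dots> \<le> 2 * (\<phi> q * \<phi> (q + 2))"
      using \<phi>1[of q] \<phi>1[of "q + 2"] by simp
    finally show ?thesis by (simp add: A)
  qed (use \<phi>_1 \<phi>_2 \<open>p = 1 \<or> p = 2\<close> in auto)
  have "(sin \<theta> / e)\<^sup>2 * (1 + (1 / 4 * \<theta> / e)\<^sup>2) \<le> (2 * (\<Prod>m\<in>#A. \<phi> m)) * \<phi> p"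
    using second first order_trans[OF zero_le_power2 second] by (intro mult_mono) auto
  also have "\<dots> = 2 * (\<Prod>m\<in>#add_mset p A. \<phi> m)" by simp
  also have "\<dots> \<le> 2 * (\<Prod>m\<leftarrow>a. \<phi> m)"
    by (intro mult_left_mono prod_mset_le_prod_list sub \<phi>1) auto
  finally show ?thesis by (simp add: e_def)
qed

text \<open>For p = 1 the integral runs over the whole period [- \<pi>, \<pi>]. For p = 2 it is
  folded onto [- \<pi> / 2, \<pi> / 2], where p \<theta> / 2 again has absolute value at most \<pi>
  / 2, and the fold produces the factor 1 + (-1)^L.\<close>

lemma laurent_coeff_genf:
  fixes ms :: "int list" and L :: nat
  assumes sym: "image_mset uminus (mset ms) = mset ms"
  defines "a \<equiv> filter (\<lambda>m. 0 < m) ms"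
  assumes sub: "add_mset p A \<subseteq># mset a" and A: "A = {#p#} \<or> A = {#2#} \<or> A = {#q, q + 2#}"
    and p: "p = 1 \<or> p = 2 \<and> (\<forall>m\<in>set ms. even m)"
  shows "fls_nth (laurent_at_one (genf ms (- int L) - genf ms (int L + 2))) (3 - int (length ms)) =
    (if p = 1 then 1 else 1 + (-1) ^ L) * of_nat (L + 1) * of_real (lap_integral (map of_int a))"
proof -
  define z where "z = length (filter (\<lambda>m. m = 0) ms)"
  define N where "N = z + 2 * length a - 3"
  have len: "2 \<le> length a"
    using size_mset_mono[OF sub] A by auto
  have N: "3 - int (length ms) = - int N"
    using len char_fun_symmetric(2)[OF sym] by (simp add: N_def z_def a_def)
  have apos: "\<And>m. m \<in> set a \<Longrightarrow> 0 < m" by (simp add: a_def)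
  define \<epsilon> where "\<epsilon> k = 1 / real (k + 2)" for k
  have \<epsilon>: "0 < \<epsilon> k" "\<epsilon> k < 1" for k by (auto simp: \<epsilon>_def field_simps)
  have \<epsilon>0: "\<epsilon> \<longlonglongrightarrow> 0"
    using LIMSEQ_ignore_initial_segment[OF LIMSEQ_inverse_real_of_nat, of 1]
    by (simp add: \<epsilon>_def[abs_def] divide_inverse numeral_2_eq_2)
  define F where "F = genf ms (- int L) - genf ms (int L + 2)"
  have F_nth: "fps_nth F n * of_real t ^ n =
      of_real (real (cnt ms n (- int L)) * t ^ n - real (cnt ms n (int L + 2)) * t ^ n)" for n t
    by (simp add: F_def genf_def left_diff_distrib)
  have F_sums: "(\<lambda>n. fps_nth F n * of_real t ^ n) sums of_real (gval ms (- int L) t - gval ms (int L + 2) t)"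
    if "0 < t" "t < 1" for t
    unfolding F_nth gval_def using that
    by (intro sums_of_real sums_diff summable_sums summable_cnt)
  define \<Theta> where "\<Theta> = (if p = 1 then pi else pi / 2)"
  define \<kappa> :: real where "\<kappa> = (if p = 1 then 1 else 1 + (-1) ^ L)"
  have H: "2 * pi * (gval ms (- int L) t - gval ms (int L + 2) t) = \<kappa> * integral {-\<Theta>..\<Theta>} (kern L z a t)"
    if t: "0 < t" "t < 1" for t
  proof (cases "p = 1")
    case True
    then show ?thesis
      using gval_diff_integral[OF t sym, of L "- pi"] by (simp add: \<kappa>_def \<Theta>_def z_def a_def)
  next
    case False
    then have even: "even m" if "m \<in> set a" for m using p that by (auto simp: a_def)
    let ?K = "kern L z a t"
    \<comment> \<open>Even weights make the denominator \<pi>-periodic. In the numerator one sine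
      gains (-1)^(L+1) and the other gains -1.\<close>
    have per: "?K (\<theta> + pi) = (-1) ^ L * ?K \<theta>" for \<theta>
    proof -
      have "(sin (of_int m * (\<theta> + pi) / 2))\<^sup>2 = (sin (of_int m * \<theta> / 2))\<^sup>2" if m: "m \<in> set a" for m
      proof -
        obtain j where j: "m = int j + int j" using even[OF m] apos[OF m]
          by (metis evenE mult_2 zero_less_imp_eq_int of_nat_add even_of_nat of_nat_eq_iff)
        have "of_int m * (\<theta> + pi) / 2 = of_int m * \<theta> / 2 + real j * pi" by (simp add: j field_simps)
        then have "sin (of_int m * (\<theta> + pi) / 2) = (-1) ^ j * sin (of_int m * \<theta> / 2)"
          by (simp only: sin_add cos_npi sin_npi) simp
        then show ?thesis by (simp add: power_mult_distrib flip: power_mult)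
      qed
      then have "(\<Prod>m\<leftarrow>a. (1 - t)\<^sup>2 + 4 * t * (sin (of_int m * (\<theta> + pi) / 2))\<^sup>2) =
          (\<Prod>m\<leftarrow>a. (1 - t)\<^sup>2 + 4 * t * (sin (of_int m * \<theta> / 2))\<^sup>2)"
        by (intro arg_cong[where f = prod_list] map_cong) auto
      moreover have "sin (real (L + 1) * (\<theta> + pi)) = (-1) ^ (L + 1) * sin (real (L + 1) * \<theta>)"
        unfolding distrib_left sin_add cos_npi sin_npi by simp
      ultimately show ?thesis by (simp only: kern_def) (simp add: sin_add)
    qed
    have int: "?K integrable_on {c..d}" for c d
      by (intro integrable_continuous_real continuous_on_kern t)
    have "integral {- pi / 2..- pi / 2 + 2 * pi} ?K =
        integral {- pi / 2..pi / 2} ?K + integral {pi / 2..- pi / 2 + 2 * pi} ?K"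
      by (intro Henstock_Kurzweil_Integration.integral_combine[symmetric] int) auto
    also have "integral {pi / 2..- pi / 2 + 2 * pi} ?K = integral {- pi / 2 + pi..pi / 2 + pi} ?K"
      by (simp add: field_simps)
    also have "\<dots> = integral {- pi / 2..pi / 2} (?K \<circ> (+) pi)"
      by (rule integral_shift_Icc_real[symmetric])
    also have "?K \<circ> (+) pi = (\<lambda>\<theta>. (-1) ^ L * ?K \<theta>)"
      using per by (auto simp: add.commute)
    also have "integral {- pi / 2..pi / 2} (\<lambda>\<theta>. (-1) ^ L * ?K \<theta>) = (-1) ^ L * integral {- pi / 2..pi / 2} ?K"
      by simp
    finally show ?thesis
      using False gval_diff_integral[OF t sym, of L "- pi / 2"]
      by (simp add: \<kappa>_def \<Theta>_def z_def a_def distrib_right)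
  qed
  have "(\<lambda>k. \<epsilon> k ^ N * integral {-\<Theta>..\<Theta>} (kern L z a (1 - \<epsilon> k)))
      \<longlonglongrightarrow> 2 * pi * real (L + 1) * lap_integral (map of_int a)"
    unfolding \<epsilon>_def N_def
  proof (rule kern_limit[OF apos len, where r = "1 / 4"])
    fix t \<theta> :: real assume t: "1 / 2 \<le> t" "t < 1" and "\<bar>\<theta>\<bar> \<le> \<Theta>"
    then have "\<bar>of_int p * \<theta> / 2\<bar> \<le> pi / 2" using p by (auto simp: \<Theta>_def)
    then show "(sin \<theta> / (1 - t))\<^sup>2 * (1 + (1 / 4 * \<theta> / (1 - t))\<^sup>2) \<le>
      2 * (\<Prod>m\<leftarrow>a. 1 + 4 * t * (sin (of_int m * \<theta> / 2) / (1 - t))\<^sup>2)"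
      using p by (intro dominated_by_sub_mset[OF t _ _ sub A]) auto
  qed (auto simp: \<Theta>_def)
  then have "(\<lambda>k. \<kappa> / (2 * pi) * (\<epsilon> k ^ N * integral {-\<Theta>..\<Theta>} (kern L z a (1 - \<epsilon> k))))
      \<longlonglongrightarrow> \<kappa> / (2 * pi) * (2 * pi * real (L + 1) * lap_integral (map of_int a))"
    by (rule tendsto_mult[OF tendsto_const])
  also have "(\<lambda>k. \<kappa> / (2 * pi) * (\<epsilon> k ^ N * integral {-\<Theta>..\<Theta>} (kern L z a (1 - \<epsilon> k)))) =
      (\<lambda>k. \<epsilon> k ^ N * (gval ms (- int L) (1 - \<epsilon> k) - gval ms (int L + 2) (1 - \<epsilon> k)))"
  proof
    fix k
    have "gval ms (- int L) (1 - \<epsilon> k) - gval ms (int L + 2) (1 - \<epsilon> k) =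
        \<kappa> * integral {-\<Theta>..\<Theta>} (kern L z a (1 - \<epsilon> k)) / (2 * pi)"
      using H[of "1 - \<epsilon> k"] \<epsilon>[of k] by (simp add: eq_divide_eq mult_ac)
    then show "\<kappa> / (2 * pi) * (\<epsilon> k ^ N * integral {-\<Theta>..\<Theta>} (kern L z a (1 - \<epsilon> k))) =
      \<epsilon> k ^ N * (gval ms (- int L) (1 - \<epsilon> k) - gval ms (int L + 2) (1 - \<epsilon> k))" by simp
  qed
  also have "\<kappa> / (2 * pi) * (2 * pi * real (L + 1) * lap_integral (map of_int a)) =
      \<kappa> * real (L + 1) * lap_integral (map of_int a)" by simp
  finally have lim: "(\<lambda>k. \<epsilon> k ^ N * (gval ms (- int L) (1 - \<epsilon> k) - gval ms (int L + 2) (1 - \<epsilon> k)))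
      \<longlonglongrightarrow> \<kappa> * real (L + 1) * lap_integral (map of_int a)" .
  have "fls_nth (laurent_at_one F) (- int N) = of_real (\<kappa> * real (L + 1) * lap_integral (map of_int a))"
  proof (rule laurent_at_one_limit[where \<epsilon> = \<epsilon>])
    show "rational_fps F" unfolding F_def by (intro rational_fps_diff rational_genf)
    show "summable (\<lambda>n. fps_nth F n * of_real t ^ n)" if "0 < t" "t < 1" for t
      using F_sums[OF that] by (rule sums_summable)
    have "suminf (\<lambda>n. fps_nth F n * of_real (1 - \<epsilon> k) ^ n) =
        of_real (gval ms (- int L) (1 - \<epsilon> k) - gval ms (int L + 2) (1 - \<epsilon> k))" for k
      using F_sums[of "1 - \<epsilon> k"] \<epsilon>[of k] by (intro sums_unique[symmetric]) auto
    then have "(\<lambda>k. of_real (\<epsilon> k) ^ N * suminf (\<lambda>n. fps_nth F n * of_real (1 - \<epsilon> k) ^ n)) =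
       (\<lambda>k. complex_of_real (\<epsilon> k ^ N * (gval ms (- int L) (1 - \<epsilon> k) - gval ms (int L + 2) (1 - \<epsilon> k))))"
      by (simp only: of_real_mult of_real_power)
    then show "(\<lambda>k. of_real (\<epsilon> k) ^ N * suminf (\<lambda>n. fps_nth F n * of_real (1 - \<epsilon> k) ^ n))
        \<longlonglongrightarrow> complex_of_real (\<kappa> * real (L + 1) * lap_integral (map of_int a))"
      using tendsto_of_real[OF lim, where 'a = complex] by simp
  qed (use \<epsilon> \<epsilon>0 in auto)
  then show ?thesis by (simp add: F_def N \<kappa>_def)
qed

section \<open>Linear maps between function spaces\<close>

global_interpretation cfun_pair: vector_space_pair
  "fscale :: complex \<Rightarrow> ('x \<Rightarrow> complex) \<Rightarrow> 'x \<Rightarrow> complex"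
  "fscale :: complex \<Rightarrow> ('y \<Rightarrow> complex) \<Rightarrow> 'y \<Rightarrow> complex"
  by unfold_locales

abbreviation clinear :: "(('x \<Rightarrow> complex) \<Rightarrow> 'y \<Rightarrow> complex) \<Rightarrow> bool" where
  "clinear \<equiv> Vector_Spaces.linear fscale fscale"

lemma fscale_apply: "fscale c f x = c * f x"
  by (simp add: fscale_def)

lemma sum_fun_apply: "(\<Sum>i\<in>A. f i) x = (\<Sum>i\<in>A. f i x :: complex)"
  by (induction A rule: infinite_finite_induct) auto

lemmas fun_ops = fun_eq_iff fscale_apply plus_fun_apply zero_fun_apply minus_apply uminus_apply

declare plus_fun_apply [simp del] zero_fun_apply [simp del] minus_apply [simp del] uminus_apply [simp del]

lemma clinearI:
  assumes "\<And>f g. T (f + g) = T f + T g" "\<And>c f. T (fscale c f) = fscale c (T f)"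
  shows "clinear T"
  by unfold_locales (use assms in auto)

lemma clinear_simps:
  assumes "clinear T"
  shows "T (f + g) = T f + T g" "T (fscale c f) = fscale c (T f)" "T 0 = 0" "T (f - g) = T f - T g"
    "T (sum h A) = (\<Sum>i\<in>A. T (h i))"
proof -
  interpret Vector_Spaces.linear fscale fscale T by fact
  show "T (f + g) = T f + T g" "T (fscale c f) = fscale c (T f)" "T 0 = 0" "T (f - g) = T f - T g"
    "T (sum h A) = (\<Sum>i\<in>A. T (h i))"
    by (rule add scale zero diff sum)+
qed

lemma clinear_subspace_kernel:
  assumes "clinear T" "cfun.subspace S"
  shows "cfun.subspace {f \<in> S. T f = 0}"
  using assms(2) clinear_simps[OF assms(1)]
  by (auto simp: cfun.subspace_def)

lemma clinear_inj_onI: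
  assumes "clinear T" "cfun.subspace S" "\<And>f. f \<in> S \<Longrightarrow> T f = 0 \<Longrightarrow> f = 0"
  shows "inj_on T S"
proof (rule inj_onI)
  fix f g assume "f \<in> S" "g \<in> S" "T f = T g"
  then have "f - g = 0"
    using assms by (intro assms(3)) (auto simp: cfun.subspace_diff clinear_simps)
  then show "f = g" by simp
qed

lemma dim_image_inj:
  assumes T: "clinear T" and S: "cfun.subspace S" and inj: "inj_on T S"
  shows "cfun.dim (T ` S) = cfun.dim S"
proof -
  obtain B where B: "B \<subseteq> S" "cfun.independent B" "S \<subseteq> cfun.span B" "card B = cfun.dim S"
    by (rule cfun.basis_exists)
  have span: "cfun.span B = S" using B S by (metis cfun.span_minimal subset_antisym)
  have "cfun.independent (T ` B)"
    using cfun_pair.linear_independent_injective_image[OF T B(2)] inj span by simp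
  moreover have "T ` S \<subseteq> cfun.span (T ` B)"
    using cfun_pair.linear_span_image[OF T, of B] span by simp
  ultimately have "card (T ` B) = cfun.dim (T ` S)"
    using B(1) by (intro cfun.basis_card_eq_dim) auto
  moreover have "card (T ` B) = card B" using inj_on_subset[OF inj B(1)] by (rule card_image)
  ultimately show ?thesis using B(4) by simp
qed

lemma subspace_eq_of_dim:
  assumes "cfun.subspace S" "cfun.subspace V" "S \<subseteq> V" "V \<subseteq> cfun.span F" "finite F" "cfun.dim S = cfun.dim V"
  shows "S = V"
proof -
  obtain B where B: "B \<subseteq> S" "cfun.independent B" "S \<subseteq> cfun.span B" "card B = cfun.dim S"
    by (rule cfun.basis_exists)
  obtain B' where B': "B \<subseteq> B'" "B' \<subseteq> V" "cfun.independent B'" "V \<subseteq> cfun.span B'"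
    using cfun.maximal_independent_subset_extend[of B V] B assms(3) by (metis order_trans)
  have "card B' = cfun.dim V" using B' by (intro cfun.basis_card_eq_dim)
  moreover have "finite B'" using cfun.independent_span_bound[OF assms(5) B'(3)] B'(2) assms(4) by auto
  ultimately have "B = B'" using B'(1) B(4) assms(6) by (intro card_subset_eq) auto
  then have "V \<subseteq> S" using B'(4) B(1) assms(1) by (metis cfun.span_minimal order_trans)
  then show ?thesis using assms(3) by auto
qed

lemma rank_nullity_subspace:
  assumes T: "clinear T" and S: "cfun.subspace S" and fin: "S \<subseteq> cfun.span F" "finite F"
  shows "cfun.dim S = cfun.dim (T ` S) + cfun.dim {f \<in> S. T f = 0}"
proof -
  let ?K = "{f \<in> S. T f = 0}"
  have K: "cfun.subspace ?K" by (rule clinear_subspace_kernel[OF T S])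
  obtain A where A: "A \<subseteq> ?K" "cfun.independent A" "?K \<subseteq> cfun.span A" "card A = cfun.dim ?K"
    by (rule cfun.basis_exists)
  obtain B where B: "A \<subseteq> B" "B \<subseteq> S" "cfun.independent B" "S \<subseteq> cfun.span B"
    using cfun.maximal_independent_subset_extend[of A S] A by auto
  have finB: "finite B" using cfun.independent_span_bound[OF fin(2) B(3)] B(2) fin(1) by auto
  have cardB: "card B = cfun.dim S" using B by (intro cfun.basis_card_eq_dim)
  let ?C = "B - A"
  have indC: "cfun.independent ?C" using B(3) by (rule cfun.independent_mono) auto
  have spanC: "cfun.span ?C \<subseteq> S" using B(2) S by (intro cfun.span_minimal) auto
  have inj: "inj_on T (cfun.span ?C)"
  proof (rule clinear_inj_onI[OF T cfun.subspace_span])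
    fix f assume f: "f \<in> cfun.span ?C" "T f = 0"
    then have fA: "f \<in> cfun.span A" using spanC A(3) by auto
    \<comment> \<open>Since f lies in the spans of both A and B - A, its coordinates in the basis B
      are supported on two disjoint sets.\<close>
    have "cfun.representation B f b = 0" for b
    proof (cases "b \<in> A")
      case True
      have "cfun.representation B f b = cfun.representation ?C f b"
        using cfun.representation_extend[OF B(3) f(1)] by auto
      then show ?thesis using True cfun.representation_ne_zero[of ?C f b] by auto
    next
      case False
      have "cfun.representation B f b = cfun.representation A f b"
        using cfun.representation_extend[OF B(3) fA B(1)] by auto
      then show ?thesis using False cfun.representation_ne_zero[of A f b] by auto
    qed
    then show "f = 0"
      using cfun.sum_nonzero_representation_eq[OF B(3), of f] fA cfun.span_mono[OF B(1)] by auto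
  qed
  have "cfun.dim (T ` S) = card ?C"
  proof -
    have "cfun.independent (T ` ?C)" by (rule cfun_pair.linear_independent_injective_image[OF T indC inj])
    moreover have "T ` S \<subseteq> cfun.span (T ` ?C)"
    proof -
      have "T ` B \<subseteq> cfun.span (T ` ?C)"
      proof
        fix x assume "x \<in> T ` B"
        then obtain b where b: "b \<in> B" "x = T b" by blast
        show "x \<in> cfun.span (T ` ?C)"
        proof (cases "b \<in> A")
          case True
          then have "x = 0" using A(1) b by auto
          then show ?thesis using cfun.span_zero by simp
        next
          case False
          then show ?thesis using b by (intro cfun.span_base) auto
        qed
      qed
      then have "cfun.span (T ` B) \<subseteq> cfun.span (T ` ?C)" by (intro cfun.span_minimal) auto
      moreover have "T ` S \<subseteq> cfun.span (T ` B)"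
        using cfun_pair.linear_span_image[OF T, of B] B(4) by auto
      ultimately show ?thesis by blast
    qed
    ultimately have "card (T ` ?C) = cfun.dim (T ` S)"
      using B(2) by (intro cfun.basis_card_eq_dim) auto
    moreover have "card (T ` ?C) = card ?C"
      using inj cfun.span_superset by (intro card_image) (rule inj_on_subset)
    ultimately show ?thesis by simp
  qed
  moreover have "card B = card ?C + card A"
    using finB B(1) by (metis add.commute card_mono card_Diff_subset finite_subset le_add_diff_inverse)
  ultimately show ?thesis using cardB A(4) by simp
qed

section \<open>Highest weight theory for a finite-dimensional graded module\<close>

text \<open>The Cartan element is not an operator here: it acts on \<open>M w\<close> as the scalar
  w, which makes \<open>comm\<close> the bracket relation. The assumption \<open>bounded\<close>
  makes X nilpotent on each weight vector.\<close>

locale sl2_action =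
  fixes M :: "int \<Rightarrow> ('x \<Rightarrow> complex) set" and X Y :: "('x \<Rightarrow> complex) \<Rightarrow> 'x \<Rightarrow> complex" and F
  assumes X: "clinear X" and Y: "clinear Y"
    and sub: "cfun.subspace (M w)"
    and XM: "f \<in> M w \<Longrightarrow> X f \<in> M (w + 2)" and YM: "f \<in> M w \<Longrightarrow> Y f \<in> M (w - 2)"
    and comm: "f \<in> M w \<Longrightarrow> X (Y f) = Y (X f) + fscale (of_int w) f"
    and fin: "finite F" "M w \<subseteq> cfun.span F"
    and bounded: "\<exists>K. \<forall>w>K. M w \<subseteq> {0}"
begin

text \<open>If \<open>X (Y v) = 0\<close> and \<open>v\<close> has weight 2, then \<open>Y (X\<^bsup>n+1\<^esup> v) = - (n + 1) (n + 2) X\<^sup>n v\<close>; since \<open>X\<close> is nilpotent, \<open>v = 0\<close>.\<close>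

lemma weight_2_XY_eq_0:
  assumes v: "v \<in> M 2" "X (Y v) = 0"
  shows "v = 0"
proof -
  have iter: "(X ^^ n) v \<in> M (2 + 2 * int n) \<and>
      Y ((X ^^ Suc n) v) = fscale (- (of_nat (n + 1) * of_nat (n + 2))) ((X ^^ n) v)" for n
  proof (induction n)
    case 0
    have "Y (X v) = fscale (-2) v" using comm[OF v(1)] v(2)
      by (simp add: fun_ops) (metis add.inverse_inverse add_eq_0_iff)
    then show ?case using v(1) by simp
  next
    case (Suc n)
    define u where "u = (X ^^ Suc n) v"
    have u: "u \<in> M (2 + 2 * int (Suc n))"
      using XM[of "(X ^^ n) v" "2 + 2 * int n"] Suc by (simp add: u_def)
    have "X (Y u) = X (fscale (- (of_nat (n + 1) * of_nat (n + 2))) ((X ^^ n) v))"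
      by (simp only: u_def conjunct2[OF Suc])
    also have "\<dots> = fscale (- (of_nat (n + 1) * of_nat (n + 2))) u"
      by (simp only: clinear_simps(2)[OF X]) (simp add: u_def)
    finally have "X (Y u) = fscale (- (of_nat (n + 1) * of_nat (n + 2))) u" .
    with comm[OF u] have "Y (X u) = fscale (- (of_nat (n + 1) * of_nat (n + 2))) u - fscale (of_int (2 + 2 * int (Suc n))) u"
      by simp
    also have "\<dots> = fscale (- (of_nat (Suc n + 1) * of_nat (Suc n + 2))) u"
      by (simp add: fun_ops algebra_simps)
    finally show ?case using u by (simp add: u_def)
  qed
  obtain K where K: "\<And>w. K < w \<Longrightarrow> M w \<subseteq> {0}" using bounded by blast
  have "(X ^^ nat \<bar>K\<bar>) v \<in> M (2 + 2 * int (nat \<bar>K\<bar>))" using iter by blast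
  moreover have "K < 2 + 2 * int (nat \<bar>K\<bar>)" by linarith
  ultimately have top: "(X ^^ nat \<bar>K\<bar>) v = 0" using K by blast
  have down: "(X ^^ n) v = 0" if "(X ^^ Suc n) v = 0" for n
  proof -
    have "fscale (- (of_nat (n + 1) * of_nat (n + 2))) ((X ^^ n) v) = 0"
      using iter[of n] that clinear_simps(3)[OF Y] by simp
    moreover have "(of_nat (n + 1) * of_nat (n + 2) :: complex) \<noteq> 0"
      by (metis add_eq_0_iff_both_eq_0 mult_eq_0_iff of_nat_eq_0_iff one_neq_zero zero_neq_numeral)
    ultimately show ?thesis by (simp add: fun_ops)
  qed
  have "(X ^^ (nat \<bar>K\<bar> - n)) v = 0" for n
  proof (induction n)
    case (Suc n)
    show ?case
    proof (cases "n < nat \<bar>K\<bar>")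
      case True
      show ?thesis by (rule down) (simp only: Suc_diff_Suc[OF True] Suc)
    next
      case False
      then show ?thesis using Suc by (metis diff_is_0_eq' le_SucI not_less)
    qed
  qed (simp add: top)
  from this[of "nat \<bar>K\<bar>"] show ?thesis by simp
qed

text \<open>X Y is injective on the finite-dimensional space \<open>M 2\<close>, hence bijective
  there. So X maps \<open>M 0\<close> onto \<open>M 2\<close>, and rank and nullity give the
  count.\<close>

lemma dim_kernel: "cfun.dim (M 0) = cfun.dim (M 2) + cfun.dim {f \<in> M 0. X f = 0}"
proof -
  define T where "T = X \<circ> Y"
  have T: "clinear T"
    unfolding T_def by (rule clinearI) (simp_all add: clinear_simps[OF X] clinear_simps[OF Y])
  have T_sub: "T ` M 2 \<subseteq> M 2" using YM[of _ 2] XM[of _ 0] by (auto simp: T_def)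
  have "inj_on T (M 2)"
    using weight_2_XY_eq_0 by (intro clinear_inj_onI[OF T sub]) (auto simp: T_def)
  then have "cfun.dim (T ` M 2) = cfun.dim (M 2)" by (rule dim_image_inj[OF T sub])
  then have "T ` M 2 = M 2"
    using T_sub fin cfun_pair.linear_subspace_image[OF T sub] sub
    by (intro subspace_eq_of_dim[where F = F]) auto
  then have "M 2 \<subseteq> X ` M 0" using YM[of _ 2] by (force simp: T_def)
  then have "X ` M 0 = M 2" using XM[of _ 0] by auto
  then show ?thesis using rank_nullity_subspace[OF X sub fin(2,1), of 0] by simp
qed

end

text \<open>Negating the grading exchanges the roles of X and Y, so every statement about raising
  yields one about lowering.\<close>

lemma (in sl2_action) flip: "sl2_action (\<lambda>w. M (- w)) Y X F" if "\<exists>K. \<forall>w<K. M w \<subseteq> {0}"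
proof
  fix f w
  show "f \<in> M (- w) \<Longrightarrow> Y f \<in> M (- (w + 2))" using YM[of f "- w"] by simp
  show "f \<in> M (- w) \<Longrightarrow> X f \<in> M (- (w - 2))" using XM[of f "- w"] by simp
  show "f \<in> M (- w) \<Longrightarrow> Y (X f) = X (Y f) + fscale (of_int w) f"
    using comm[of f "- w"] by (simp add: fun_ops)
  show "cfun.subspace (M (- w))" "finite F" "M (- w) \<subseteq> cfun.span F" by (rule sub fin)+
  from that obtain K where "\<forall>w<K. M w \<subseteq> {0}" by blast
  then have "\<forall>w>-K. M (- w) \<subseteq> {0}" by simp
  then show "\<exists>K. \<forall>w>K. M (- w) \<subseteq> {0}" by blast
qed (simp_all add: clinear_simps[OF X] clinear_simps[OF Y])

text \<open>If X f = 0 in weight 0, the bracket gives X (Y f) = 0. Thus Y f, which has weight 2 for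
  the flipped action, is a vector to which \<open>weight_2_XY_eq_0\<close> applies.\<close>

lemma (in sl2_action) kernel_X_imp_kernel_Y:
  assumes below: "\<exists>K. \<forall>w<K. M w \<subseteq> {0}" and f: "f \<in> M 0" "X f = 0"
  shows "Y f = 0"
proof -
  interpret flipped: sl2_action "\<lambda>w. M (- w)" Y X F by (rule flip[OF below])
  have "X (Y f) = 0" unfolding comm[OF f(1)] by (simp add: f(2) clinear_simps(3)[OF Y])
  then have "Y (X (Y f)) = 0" using clinear_simps(3)[OF Y] by simp
  moreover have "Y f \<in> M (- 2)" using YM[OF f(1)] by simp
  ultimately show ?thesis by (rule flipped.weight_2_XY_eq_0[rotated])
qed


section \<open>Polynomial functions and derivations\<close>

definition monm :: "'p multiset \<Rightarrow> ('p \<Rightarrow> complex) \<Rightarrow> complex" where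
  "monm A = (\<lambda>y. \<Prod>p\<in>#A. y p)"

definition mulc :: "'p \<Rightarrow> (('p \<Rightarrow> complex) \<Rightarrow> complex) \<Rightarrow> ('p \<Rightarrow> complex) \<Rightarrow> complex" where
  "mulc p f = (\<lambda>y. y p * f y)"

lemma mulc_monm: "mulc p (monm A) = monm (add_mset p A)"
  by (simp add: mulc_def monm_def)

lemma clinear_mulc: "clinear (mulc p)"
  by (rule clinearI) (auto simp: mulc_def fun_ops algebra_simps)

text \<open>Induction on the variables: with the others fixed, the sum is a polynomial in the value
  z of the new variable, so the coefficient of each power of z vanishes separately.\<close>

lemma power_products_independent:
  fixes c :: "'p multiset \<Rightarrow> complex"
  assumes "finite J" "finite S"
    and "\<And>A B. A \<in> S \<Longrightarrow> B \<in> S \<Longrightarrow> (\<And>p. p \<in> J \<Longrightarrow> count A p = count B p) \<Longrightarrow> A = B"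
    and "\<And>y. (\<Sum>A\<in>S. c A * (\<Prod>p\<in>J. y p ^ count A p)) = 0" and "A \<in> S"
  shows "c A = 0"
  using assms
proof (induction J arbitrary: S rule: finite_induct)
  case empty
  then have "S = {A}" by auto
  then show ?case using empty.prems(3) by simp
next
  case (insert q J)
  define n where "n = Max ((\<lambda>A. count A q) ` S)"
  have n: "count B q \<le> n" if "B \<in> S" for B
    using that insert.prems(1) by (simp add: n_def)
  show ?case
  proof (rule insert.IH[of "{B \<in> S. count B q = count A q}"])
    show "finite {B \<in> S. count B q = count A q}" "A \<in> {B \<in> S. count B q = count A q}"
      using insert.prems by auto
    show "B = B'" if "B \<in> {B \<in> S. count B q = count A q}" "B' \<in> {B \<in> S. count B q = count A q}"
      "\<And>p. p \<in> J \<Longrightarrow> count B p = count B' p" for B B'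
      using that by (intro insert.prems(2)) auto
    fix y :: "'p \<Rightarrow> complex"
    define m where "m B = (\<Prod>p\<in>J. y p ^ count B p)" for B
    have "\<forall>z. (\<Sum>i\<le>n. (\<Sum>B\<in>{B \<in> S. count B q = i}. c B * m B) * z ^ i) = 0"
    proof
      fix z
      have "(\<Sum>i\<le>n. (\<Sum>B\<in>{B \<in> S. count B q = i}. c B * m B) * z ^ i) =
          (\<Sum>i\<le>n. \<Sum>B\<in>{B \<in> S. count B q = i}. c B * m B * z ^ count B q)"
        by (intro sum.cong refl) (simp add: sum_distrib_right)
      also have "\<dots> = (\<Sum>B\<in>S. c B * m B * z ^ count B q)"
        using insert.prems(1) n by (intro sum.group) auto
      also have "\<dots> = (\<Sum>B\<in>S. c B * (\<Prod>p\<in>insert q J. (y(q := z)) p ^ count B p))"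
      proof (intro sum.cong refl)
        fix B
        have "(\<Prod>p\<in>J. (y(q := z)) p ^ count B p) = m B"
          unfolding m_def using insert.hyps by (intro prod.cong) auto
        then show "c B * m B * z ^ count B q = c B * (\<Prod>p\<in>insert q J. (y(q := z)) p ^ count B p)"
          using insert.hyps by simp
      qed
      also have "\<dots> = 0" by (rule insert.prems(3))
      finally show "(\<Sum>i\<le>n. (\<Sum>B\<in>{B \<in> S. count B q = i}. c B * m B) * z ^ i) = 0" .
    qed
    then show "(\<Sum>B\<in>{B \<in> S. count B q = count A q}. c B * (\<Prod>p\<in>J. y p ^ count B p)) = 0"
      unfolding Poly_Roots.polyfun_eq_0 m_def using n[OF \<open>A \<in> S\<close>] by blast
  qed
qed

lemma monm_independent:
  assumes "finite S" "\<And>y. (\<Sum>A\<in>S. c A * monm A y) = 0" "A \<in> S"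
  shows "c A = 0"
proof (rule power_products_independent[of "\<Union>(set_mset ` S)" S])
  show "finite (\<Union>(set_mset ` S))" using assms by auto
  show "A = B" if "A \<in> S" "B \<in> S" "\<And>p. p \<in> \<Union>(set_mset ` S) \<Longrightarrow> count A p = count B p" for A B
  proof (rule multiset_eqI)
    fix p show "count A p = count B p"
      using that by (cases "p \<in> \<Union>(set_mset ` S)") (auto simp: not_in_iff)
  qed
  fix y
  have "monm B y = (\<Prod>p\<in>\<Union>(set_mset ` S). y p ^ count B p)" if "B \<in> S" for B
    unfolding monm_def image_prod_mset_multiplicity using that assms(1)
    by (intro prod.mono_neutral_left) (auto simp: not_in_iff)
  then show "(\<Sum>B\<in>S. c B * (\<Prod>p\<in>\<Union>(set_mset ` S). y p ^ count B p)) = 0"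
    using assms(2)[of y] by simp
qed (use assms in auto)

lemma inj_monm: "inj monm"
proof (rule injI, rule ccontr)
  fix A B :: "'p multiset" assume "monm A = monm B" "A \<noteq> B"
  then have "(\<Sum>C\<in>{A, B}. (if C = A then 1 else - 1) * monm C y) = 0" for y by simp
  from monm_independent[OF _ this, of A] show False by simp
qed

lemma independent_monm: "cfun.independent (monm ` S)"
proof
  assume "cfun.dependent (monm ` S)"
  then obtain T u v where T: "T \<subseteq> monm ` S" "finite T" "(\<Sum>v\<in>T. fscale (u v) v) = 0" "v \<in> T" "u v \<noteq> 0"
    unfolding cfun.dependent_explicit by blast
  obtain T' where T': "T = monm ` T'" "finite T'"
    using T(1,2) by (metis finite_subset_image)
  have "(\<Sum>A\<in>T'. u (monm A) * monm A y) = 0" for y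
  proof -
    have "(\<Sum>v\<in>T. fscale (u v) v) y = 0" using T(3) by (simp add: zero_fun_apply)
    then show ?thesis
      unfolding T'(1) using inj_monm by (simp add: sum.reindex inj_on_subset[OF inj_monm] sum_fun_apply fscale_apply zero_fun_apply)
  qed
  then have *: "u (monm A) = 0" if "A \<in> T'" for A
    using monm_independent[where S = T' and c = "\<lambda>A. u (monm A)" and A = A] T'(2) that by simp
  obtain A where A: "v = monm A" "A \<in> T'" using T(4) unfolding T'(1) by (rule imageE)
  then show False using *[OF A(2)] T(5) by simp
qed

lemma dim_span_monm: "cfun.dim (cfun.span (monm ` S)) = card S"
  by (simp add: cfun.dim_eq_card_independent independent_monm card_image inj_on_subset[OF inj_monm])

definition deriv_monm :: "('p \<Rightarrow> complex) \<Rightarrow> ('p \<Rightarrow> 'p) \<Rightarrow> 'p multiset \<Rightarrow> ('p \<Rightarrow> complex) \<Rightarrow> complex" where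
  "deriv_monm c \<sigma> A = (\<lambda>y. \<Sum>p\<in>#A. c p * y (\<sigma> p) * monm (A - {#p#}) y)"

text \<open>The derivation of the polynomial functions that sends the coordinate \<open>y\<^sub>p\<close> to \<open>c\<^sub>p y\<^bsub>\<sigma> p\<^esub>\<close>, extended to a
  linear map on all functions.\<close>

definition derivation :: "('p \<Rightarrow> complex) \<Rightarrow> ('p \<Rightarrow> 'p) \<Rightarrow> (('p \<Rightarrow> complex) \<Rightarrow> complex) \<Rightarrow> ('p \<Rightarrow> complex) \<Rightarrow> complex" where
  "derivation c \<sigma> = cfun_pair.construct (range monm) (\<lambda>f. deriv_monm c \<sigma> (the_inv monm f))"

lemma clinear_derivation: "clinear (derivation c \<sigma>)"
  unfolding derivation_def by (rule cfun_pair.linear_construct[OF independent_monm])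

lemmas derivation_simps = clinear_simps[OF clinear_derivation]

lemma derivation_monm: "derivation c \<sigma> (monm A) = deriv_monm c \<sigma> A"
  unfolding derivation_def
  by (subst cfun_pair.construct_basis[OF independent_monm]) (simp_all add: the_inv_f_f[OF inj_monm])

lemma derivation_monm_empty: "derivation c \<sigma> (monm {#}) = 0"
  by (simp add: derivation_monm deriv_monm_def fun_ops)

text \<open>The Leibniz rule one coordinate at a time, the form in which all inductions over
  monomials use it.\<close>

lemma derivation_monm_add:
  "derivation c \<sigma> (monm (add_mset p A)) =
     fscale (c p) (monm (add_mset (\<sigma> p) A)) + mulc p (derivation c \<sigma> (monm A))"
proof
  fix y
  have "deriv_monm c \<sigma> (add_mset p A) y =
      c p * y (\<sigma> p) * monm A y + (\<Sum>q\<in>#A. c q * y (\<sigma> q) * monm (add_mset p A - {#q#}) y)"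
    by (simp add: deriv_monm_def)
  also have "(\<Sum>q\<in>#A. c q * y (\<sigma> q) * monm (add_mset p A - {#q#}) y) =
      (\<Sum>q\<in>#A. y p * (c q * y (\<sigma> q) * monm (A - {#q#}) y))"
  proof (intro arg_cong[where f = sum_mset] image_mset_cong)
    fix q assume "q \<in># A"
    then have "add_mset p A - {#q#} = add_mset p (A - {#q#})" by simp
    then show "c q * y (\<sigma> q) * monm (add_mset p A - {#q#}) y = y p * (c q * y (\<sigma> q) * monm (A - {#q#}) y)"
      by (simp add: monm_def)
  qed
  also have "\<dots> = y p * deriv_monm c \<sigma> A y"
    by (simp add: deriv_monm_def sum_mset_distrib_left image_mset.compositionality o_def)
  finally show "derivation c \<sigma> (monm (add_mset p A)) y =
     (fscale (c p) (monm (add_mset (\<sigma> p) A)) + mulc p (derivation c \<sigma> (monm A))) y"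
    by (simp add: derivation_monm fscale_apply plus_fun_apply mulc_def) (simp add: monm_def)
qed

abbreviation "polys \<equiv> cfun.span (range monm)"

lemma polys_induct [consumes 1, case_names monm add scale]:
  assumes "f \<in> polys" "\<And>A. P (monm A)" "\<And>f g. f \<in> polys \<Longrightarrow> g \<in> polys \<Longrightarrow> P f \<Longrightarrow> P g \<Longrightarrow> P (f + g)"
    "\<And>c f. f \<in> polys \<Longrightarrow> P f \<Longrightarrow> P (fscale c f)"
  shows "P f"
proof -
  have "f \<in> polys \<and> P f"
  proof (rule cfun.span_induct[OF assms(1)])
    have "P 0" using assms(4)[of "monm {#}" 0] assms(2) by (simp add: cfun.span_base)
    then show "cfun.subspace {f. f \<in> polys \<and> P f}"
      using assms(3,4) by (auto simp: cfun.subspace_def cfun.span_zero cfun.span_add cfun.span_scale)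
  qed (use assms(2) in \<open>auto intro: cfun.span_base\<close>)
  then show ?thesis by simp
qed

text \<open>Such a curve \<gamma> solves the linear differential equation y_p' = c_p y_(\<sigma> p),
  and the chain rule on a monomial is the Leibniz rule. This ties one-parameter groups to their
  derivations.\<close>

lemma derivation_curve:
  assumes f: "f \<in> polys"
    and \<gamma>: "\<And>p. ((\<lambda>s. \<gamma> s p) has_field_derivative c p * \<gamma> s (\<sigma> p)) (at s)"
  shows "((\<lambda>s. f (\<gamma> s)) has_field_derivative derivation c \<sigma> f (\<gamma> s)) (at s)"
  using f
proof (induction f rule: polys_induct)
  case (monm A)
  show ?case
  proof (induction A)
    case empty
    show ?case by (simp add: derivation_monm_empty zero_fun_apply) (simp add: monm_def)
  next
    case (add p A)
    have "((\<lambda>s. \<gamma> s p * monm A (\<gamma> s)) has_field_derivative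
        (\<gamma> s p * derivation c \<sigma> (monm A) (\<gamma> s) + c p * \<gamma> s (\<sigma> p) * monm A (\<gamma> s))) (at s)"
      by (rule DERIV_mult'[OF \<gamma> add])
    then show ?case
      by (simp add: derivation_monm_add fscale_apply plus_fun_apply mulc_def add.commute mult.assoc)
         (simp add: monm_def add.commute)
  qed
next
  case (add f g)
  show ?case
    using DERIV_add[OF add(3,4)] unfolding derivation_simps(1) by (simp only: plus_fun_apply)
next
  case (scale a f)
  show ?case
    using DERIV_cmult[OF scale(2)] unfolding derivation_simps(2) by (simp only: fscale_apply)
qed

lemma mulc_polys: "f \<in> polys \<Longrightarrow> mulc p f \<in> polys"
  by (induction f rule: polys_induct)
     (simp_all add: mulc_monm clinear_simps[OF clinear_mulc] cfun.span_base cfun.span_add cfun.span_scale)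

lemma derivation_polys: "f \<in> polys \<Longrightarrow> derivation c \<sigma> f \<in> polys"
proof (induction f rule: polys_induct)
  case (monm A)
  show ?case
    by (induction A) (simp_all add: derivation_monm_empty derivation_monm_add cfun.span_zero
        cfun.span_add cfun.span_scale cfun.span_base mulc_polys)
qed (simp_all add: derivation_simps cfun.span_add cfun.span_scale)

lemma derivation_mulc:
  assumes "f \<in> polys"
  shows "derivation c \<sigma> (mulc p f) = fscale (c p) (mulc (\<sigma> p) f) + mulc p (derivation c \<sigma> f)"
  using assms
proof (induction f rule: polys_induct)
  case (monm A)
  show ?case by (simp only: mulc_monm derivation_monm_add)
next
  case (add f g)
  then show ?case
    by (simp add: derivation_simps clinear_simps[OF clinear_mulc] cfun.scale_right_distrib)
next
  case (scale a f)
  then show ?case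
    by (simp add: derivation_simps clinear_simps[OF clinear_mulc] cfun.scale_right_distrib mult.commute)
qed

section \<open>Invariants of the Lie algebra in a space of polynomials\<close>

definition weight_mset :: "('p \<Rightarrow> int) \<Rightarrow> 'p multiset \<Rightarrow> int" where
  "weight_mset wt A = (\<Sum>p\<in>#A. wt p)"

text \<open>The map \<kappa> names the summand to which a coordinate belongs. Both derivations
  preserve it, so \<open>image_mset \<kappa>\<close> records a multidegree that they respect. The
  assumption \<open>comm\<close> is the bracket relation on the coordinate functions.\<close>

locale sl2_coordinates =
  fixes J :: "'p set" and \<kappa> :: "'p \<Rightarrow> 'k" and wt :: "'p \<Rightarrow> int"
    and cu cd :: "'p \<Rightarrow> complex" and \<sigma>u \<sigma>d :: "'p \<Rightarrow> 'p"
  assumes up: "p \<in> J \<Longrightarrow> cu p \<noteq> 0 \<Longrightarrow> \<sigma>u p \<in> J \<and> \<kappa> (\<sigma>u p) = \<kappa> p \<and> wt (\<sigma>u p) = wt p + 2"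
    and down: "p \<in> J \<Longrightarrow> cd p \<noteq> 0 \<Longrightarrow> \<sigma>d p \<in> J \<and> \<kappa> (\<sigma>d p) = \<kappa> p \<and> wt (\<sigma>d p) = wt p - 2"
    and comm: "p \<in> J \<Longrightarrow> cd p * cu (\<sigma>d p) * y (\<sigma>u (\<sigma>d p)) - cu p * cd (\<sigma>u p) * y (\<sigma>d (\<sigma>u p)) = of_int (wt p) * y p"
begin

abbreviation "U \<equiv> derivation cu \<sigma>u"
abbreviation "D \<equiv> derivation cd \<sigma>d"

lemma derivation_graded:
  assumes "\<And>p. p \<in> J \<Longrightarrow> c p \<noteq> 0 \<Longrightarrow> \<sigma> p \<in> J \<and> \<kappa> (\<sigma> p) = \<kappa> p \<and> wt (\<sigma> p) = wt p + \<delta>"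
    and "set_mset A \<subseteq> J"
  shows "derivation c \<sigma> (monm A) \<in> cfun.span (monm ` {B. set_mset B \<subseteq> J \<and>
    image_mset \<kappa> B = image_mset \<kappa> A \<and> weight_mset wt B = weight_mset wt A + \<delta>})"
  using assms(2)
proof (induction A)
  case empty
  show ?case by (simp add: derivation_monm_empty cfun.span_zero)
next
  case (add p A)
  let ?S = "\<lambda>A. {B. set_mset B \<subseteq> J \<and> image_mset \<kappa> B = image_mset \<kappa> A \<and> weight_mset wt B = weight_mset wt A + \<delta>}"
  have "fscale (c p) (monm (add_mset (\<sigma> p) A)) \<in> cfun.span (monm ` ?S (add_mset p A))"
  proof (cases "c p = 0")
    case True
    then show ?thesis by (simp add: cfun.span_zero)
  next
    case False
    then show ?thesis
      using assms(1)[of p] add.prems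
      by (intro cfun.span_scale cfun.span_base imageI) (auto simp: weight_mset_def)
  qed
  moreover have "mulc p (derivation c \<sigma> (monm A)) \<in> cfun.span (monm ` ?S (add_mset p A))"
  proof -
    have "mulc p (derivation c \<sigma> (monm A)) \<in> mulc p ` cfun.span (monm ` ?S A)"
      using add by auto
    also have "\<dots> = cfun.span (mulc p ` monm ` ?S A)"
      by (rule cfun_pair.linear_span_image[OF clinear_mulc, symmetric])
    also have "\<dots> \<subseteq> cfun.span (monm ` ?S (add_mset p A))"
      using add.prems by (intro cfun.span_mono) (auto simp: mulc_monm weight_mset_def intro!: imageI)
    finally show ?thesis .
  qed
  ultimately show ?case by (simp add: derivation_monm_add cfun.span_add)
qed

text \<open>A commutator of derivations is a derivation: the mixed terms cancel, and its effect on
  coordinates, given by \<open>comm\<close>, adds up to the weight of the monomial.\<close>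

lemma commutator_monm:
  assumes "set_mset A \<subseteq> J"
  shows "U (D (monm A)) = D (U (monm A)) + fscale (of_int (weight_mset wt A)) (monm A)"
  using assms
proof (induction A)
  case empty
  show ?case by (simp add: derivation_monm_empty derivation_simps weight_mset_def)
next
  case (add p A)
  define m where "m = monm A"
  have m: "m \<in> polys" by (simp add: m_def cfun.span_base)
  have pA: "monm (add_mset p A) = mulc p m" by (simp add: m_def mulc_monm)
  have IH: "U (D m) = D (U m) + fscale (of_int (weight_mset wt A)) m"
    using add by (simp add: m_def)
  have UD: "U (D (mulc p m)) = fscale (cd p) (fscale (cu (\<sigma>d p)) (mulc (\<sigma>u (\<sigma>d p)) m) + mulc (\<sigma>d p) (U m)) +
      (fscale (cu p) (mulc (\<sigma>u p) (D m)) + mulc p (U (D m)))"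
    by (simp only: derivation_mulc derivation_simps m mulc_polys derivation_polys)
  have DU: "D (U (mulc p m)) = fscale (cu p) (fscale (cd (\<sigma>u p)) (mulc (\<sigma>d (\<sigma>u p)) m) + mulc (\<sigma>u p) (D m)) +
      (fscale (cd p) (mulc (\<sigma>d p) (U m)) + mulc p (D (U m)))"
    by (simp only: derivation_mulc derivation_simps m mulc_polys derivation_polys)
  show ?case
  proof
    fix y
    have c: "cd p * cu (\<sigma>d p) * y (\<sigma>u (\<sigma>d p)) = cu p * cd (\<sigma>u p) * y (\<sigma>d (\<sigma>u p)) + of_int (wt p) * y p"
      using comm[of p y] add.prems by (simp add: algebra_simps)
    have "U (D (mulc p m)) y = cd p * cu (\<sigma>d p) * y (\<sigma>u (\<sigma>d p)) * m y + cd p * y (\<sigma>d p) * U m y + cu p * y (\<sigma>u p) * D m y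
        + y p * (D (U m) y + of_int (weight_mset wt A) * m y)"
      unfolding UD IH by (simp add: fun_ops mulc_def algebra_simps)
    also have "\<dots> = D (U (mulc p m)) y + of_int (wt p + weight_mset wt A) * (y p * m y)"
      unfolding c DU by (simp add: fun_ops mulc_def algebra_simps)
    finally show "U (D (monm (add_mset p A))) y = (D (U (monm (add_mset p A))) +
        fscale (of_int (weight_mset wt (add_mset p A))) (monm (add_mset p A))) y"
      unfolding pA by (simp add: fun_ops mulc_def weight_mset_def)
  qed
qed

text \<open>The common kernel of U and D lies in weight 0, since the commutator acts there by the
  weight; conversely U f = 0 in weight 0 implies D f = 0. So the invariants are the kernel of U in
  weight 0, measured by \<open>dim_kernel\<close>. The set \<K> selects the multidegrees.\<close>

lemma dim_lie_invariants:
  fixes \<K> :: "'k multiset set"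
  defines "B \<equiv> {A. set_mset A \<subseteq> J \<and> image_mset \<kappa> A \<in> \<K>}"
  assumes fin: "finite B"
  shows "card {A \<in> B. weight_mset wt A = 0} =
    card {A \<in> B. weight_mset wt A = 2} + cfun.dim {f \<in> cfun.span (monm ` B). U f = 0 \<and> D f = 0}"
proof -
  define M where "M w = cfun.span (monm ` {A \<in> B. weight_mset wt A = w})" for w
  have graded: "derivation c \<sigma> f \<in> M (w + \<delta>)"
    if "\<And>p. p \<in> J \<Longrightarrow> c p \<noteq> 0 \<Longrightarrow> \<sigma> p \<in> J \<and> \<kappa> (\<sigma> p) = \<kappa> p \<and> wt (\<sigma> p) = wt p + \<delta>" "f \<in> M w"
    for c \<sigma> f \<delta> w
  proof -
    have "derivation c \<sigma> ` M w = cfun.span (derivation c \<sigma> ` monm ` {A \<in> B. weight_mset wt A = w})"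
      unfolding M_def by (rule cfun_pair.linear_span_image[OF clinear_derivation, symmetric])
    also have "\<dots> \<subseteq> M (w + \<delta>)"
      unfolding M_def
    proof (intro cfun.span_minimal cfun.subspace_span, safe)
      fix A assume A: "A \<in> B" "w = weight_mset wt A"
      then have "derivation c \<sigma> (monm A) \<in> cfun.span (monm ` {B. set_mset B \<subseteq> J \<and>
          image_mset \<kappa> B = image_mset \<kappa> A \<and> weight_mset wt B = weight_mset wt A + \<delta>})"
        using that(1) by (intro derivation_graded) (auto simp: B_def)
      also have "\<dots> \<subseteq> cfun.span (monm ` {A' \<in> B. weight_mset wt A' = weight_mset wt A + \<delta>})"
        using A by (intro cfun.span_mono image_mono) (auto simp: B_def)
      finally show "derivation c \<sigma> (monm A) \<in> cfun.span (monm ` {A' \<in> B. weight_mset wt A' = weight_mset wt A + \<delta>})" .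
    qed
    finally show ?thesis using that(2) by blast
  qed
  have comm_M: "U (D f) = D (U f) + fscale (of_int w) f" if "f \<in> M w" for f w
  proof -
    show ?thesis
      using that unfolding M_def
    proof (rule cfun.span_induct)
      show "cfun.subspace {f. U (D f) = D (U f) + fscale (of_int w) f}"
        by (auto simp: cfun.subspace_def derivation_simps cfun.scale_right_distrib mult.commute)
      show "U (D x) = D (U x) + fscale (of_int w) x"
        if "x \<in> monm ` {A \<in> B. weight_mset wt A = w}" for x
        using that commutator_monm by (auto simp: B_def)
    qed
  qed
  have empty: "M w \<subseteq> {0}" if "w \<notin> weight_mset wt ` B" for w
  proof -
    have "{A \<in> B. weight_mset wt A = w} = {}" using that by auto
    then show ?thesis unfolding M_def by (simp only: image_empty cfun.span_empty)
  qed
  have finW: "finite (weight_mset wt ` B)" using fin by simp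
  have above: "\<exists>K. \<forall>w>K. M w \<subseteq> {0}" and below: "\<exists>K. \<forall>w<K. M w \<subseteq> {0}"
    using bdd_above_finite[OF finW] bdd_below_finite[OF finW] empty
    unfolding bdd_above_def bdd_below_def by (meson not_le)+
  interpret sl2_action M U D "monm ` B"
  proof
    show "f \<in> M w \<Longrightarrow> U f \<in> M (w + 2)" for f w by (rule graded[OF up])
    show "f \<in> M w \<Longrightarrow> D f \<in> M (w - 2)" for f w using graded[of cd \<sigma>d "-2" f w] down by simp
    show "M w \<subseteq> cfun.span (monm ` B)" for w unfolding M_def by (intro cfun.span_mono) auto
  qed (use comm_M above fin in \<open>simp_all add: derivation_simps M_def\<close>)
  have "{f \<in> cfun.span (monm ` B). U f = 0 \<and> D f = 0} = {f \<in> M 0. U f = 0}"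
  proof (intro subset_antisym subsetI)
    fix f assume "f \<in> {f \<in> M 0. U f = 0}"
    then show "f \<in> {f \<in> cfun.span (monm ` B). U f = 0 \<and> D f = 0}"
      using kernel_X_imp_kernel_Y[OF below, of f] fin(2)[of 0] by auto
  next
    fix f assume f: "f \<in> {f \<in> cfun.span (monm ` B). U f = 0 \<and> D f = 0}"
    then obtain u where u: "f = (\<Sum>v\<in>monm ` B. fscale (u v) v)"
      using cfun.span_finite[OF fin(1)] by auto
    have u': "f = (\<Sum>A\<in>B. fscale (u (monm A)) (monm A))"
      unfolding u by (simp add: sum.reindex inj_on_subset[OF inj_monm])
    \<comment> \<open>The commutator multiplies each monomial by its weight and also kills f, so by
      independence only monomials of weight 0 occur.\<close>
    have "U (D f) - D (U f) = (\<Sum>A\<in>B. fscale (u (monm A) * of_int (weight_mset wt A)) (monm A))"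
    proof -
      have "U (D (monm A)) - D (U (monm A)) = fscale (of_int (weight_mset wt A)) (monm A)" if "A \<in> B" for A
        using commutator_monm[of A] that by (simp add: B_def)
      moreover have "U (D f) - D (U f) = (\<Sum>A\<in>B. fscale (u (monm A)) (U (D (monm A)) - D (U (monm A))))"
        unfolding u' by (simp add: derivation_simps sum_subtractf cfun.scale_right_diff_distrib)
      ultimately show ?thesis by simp
    qed
    moreover have "U (D f) - D (U f) = 0" using f by (simp add: derivation_simps)
    ultimately have "(\<Sum>A\<in>B. (u (monm A) * of_int (weight_mset wt A)) * monm A y) = 0" for y
      by (metis (no_types, lifting) fscale_apply sum.cong sum_fun_apply zero_fun_apply)
    from monm_independent[OF \<open>finite B\<close> this]
    have "u (monm A) = 0" if "A \<in> B" "weight_mset wt A \<noteq> 0" for A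
      using that by fastforce
    then have "f = (\<Sum>A\<in>{A \<in> B. weight_mset wt A = 0}. fscale (u (monm A)) (monm A))"
      unfolding u' using \<open>finite B\<close> by (intro sum.mono_neutral_right) auto
    also have "\<dots> \<in> M 0"
      unfolding M_def by (intro cfun.span_sum cfun.span_scale cfun.span_base) auto
    finally show "f \<in> {f \<in> M 0. U f = 0}" using f by simp
  qed
  then show ?thesis using dim_kernel unfolding M_def dim_span_monm by simp
qed

end

section \<open>Counting multisets by weight\<close>

lemma mset_decomp: "A = filter_mset (\<lambda>x. x \<noteq> p) A + replicate_mset (count A p) p"
  by (rule multiset_eqI) simp

lemma weight_mset_add: "weight_mset wt (A + B) = weight_mset wt A + weight_mset wt B"
  by (simp add: weight_mset_def)

lemma weight_mset_replicate: "weight_mset wt (replicate_mset k p) = int k * wt p"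
  by (simp add: weight_mset_def)

text \<open>Removing all k copies of p from a multiset is the recursion that defines
  \<open>cnt\<close>.\<close>

lemma card_multisets_weight:
  assumes "distinct ps"
  shows "card {A \<in> multisets_of_size (set ps) n. weight_mset wt A = w} = cnt (map wt ps) n w"
  using assms
proof (induction ps arbitrary: n w)
  case Nil
  have "{A \<in> multisets_of_size (set []) n. weight_mset wt A = w} = (if n = 0 \<and> w = 0 then {{#}} else {})"
    by (auto simp: multisets_of_size_def weight_mset_def)
  then show ?case by simp
next
  case (Cons p ps)
  define Z where "Z n w = {A \<in> multisets_of_size (set ps) n. weight_mset wt A = w}" for n w
  have Z: "finite (Z n w)" "card (Z n w) = cnt (map wt ps) n w" for n w
    using Cons by (auto simp: Z_def intro: finite_subset[OF _ finite_multisets_of_size[of "set ps" n]])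
  have p: "p \<notin># A" if "A \<in> Z n w" for A n w
    using that Cons.prems by (auto simp: Z_def multisets_of_size_def)
  have count: "count (A + replicate_mset k p) p = k" if "A \<in> Z n w" for A n w k
    using p[OF that] by (simp add: not_in_iff)
  have "{A \<in> multisets_of_size (set (p # ps)) n. weight_mset wt A = w} =
      (\<Union>k\<le>n. (\<lambda>A. A + replicate_mset k p) ` Z (n - k) (w - int k * wt p))" (is "?L = ?R")
  proof (intro subset_antisym subsetI)
    fix A assume A: "A \<in> ?L"
    let ?A = "filter_mset (\<lambda>x. x \<noteq> p) A" and ?k = "count A p"
    have sz: "size A = size ?A + ?k" "weight_mset wt A = weight_mset wt ?A + int ?k * wt p"
      by (subst mset_decomp[of A p], simp)
         (subst mset_decomp[of A p], simp add: weight_mset_add weight_mset_replicate)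
    have "?A \<in> Z (n - ?k) (w - int ?k * wt p)" "?k \<le> n"
      using A sz by (auto simp: Z_def multisets_of_size_def)
    then show "A \<in> ?R" using mset_decomp[of A p] by blast
  next
    fix A assume "A \<in> ?R"
    then obtain k B where "k \<le> n" "B \<in> Z (n - k) (w - int k * wt p)" "A = B + replicate_mset k p" by blast
    then show "A \<in> ?L"
      by (auto simp: Z_def multisets_of_size_def weight_mset_add weight_mset_replicate split: if_splits)
  qed
  also have "card \<dots> = (\<Sum>k\<le>n. card ((\<lambda>A. A + replicate_mset k p) ` Z (n - k) (w - int k * wt p)))"
  proof (rule card_UN_disjoint)
    show "\<forall>i\<in>{..n}. \<forall>j\<in>{..n}. i \<noteq> j \<longrightarrow>
        (\<lambda>A. A + replicate_mset i p) ` Z (n - i) (w - int i * wt p) \<inter>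
        (\<lambda>A. A + replicate_mset j p) ` Z (n - j) (w - int j * wt p) = {}"
    proof (intro ballI impI equals0I)
      fix i j C assume "i \<noteq> j" "C \<in> (\<lambda>A. A + replicate_mset i p) ` Z (n - i) (w - int i * wt p) \<inter>
        (\<lambda>A. A + replicate_mset j p) ` Z (n - j) (w - int j * wt p)"
      then show False using count by (metis (no_types, lifting) IntE imageE)
    qed
  qed (auto simp: Z)
  also have "\<dots> = (\<Sum>k\<le>n. card (Z (n - k) (w - int k * wt p)))"
    by (intro sum.cong refl card_image) (auto simp: inj_on_def)
  also have "\<dots> = cnt (map wt (p # ps)) n w"
    by (simp add: Z)
  finally show ?case .
qed

text \<open>The second block carries the weights 2 j - L with j = 0, ..., L. The counts for total
  weights 0 and 2 are therefore two sums over ranges shifted by one step, and their difference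
  telescopes to its two ends.\<close>

lemma card_multisets_two_blocks:
  fixes n L :: nat
  assumes ps: "distinct ps" "p \<notin> set ps" "q \<notin> set ps" "p \<noteq> q" and wt: "wt p = 1" "wt q = -1"
  defines "B \<equiv> {A1 + A2 | A1 A2. A1 \<in> multisets_of_size (set ps) n \<and> A2 \<in> multisets_of_size {p, q} L}"
  shows "finite B"
    "int (card {A \<in> B. weight_mset wt A = 0}) - int (card {A \<in> B. weight_mset wt A = 2}) =
      int (cnt (map wt ps) n (- int L)) - int (cnt (map wt ps) n (int L + 2))"
proof -
  have "B = (\<lambda>(A1, A2). A1 + A2) ` (multisets_of_size (set ps) n \<times> multisets_of_size {p, q} L)"
    by (auto simp: B_def)
  then show "finite B" by (simp add: finite_multisets_of_size)
  define R where "R j = replicate_mset j p + replicate_mset (L - j) q" for j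
  define Z where "Z w = {A \<in> multisets_of_size (set ps) n. weight_mset wt A = w}" for w
  have Z: "finite (Z w)" "card (Z w) = cnt (map wt ps) n w" for w
    using card_multisets_weight[OF ps(1)]
    by (auto simp: Z_def intro: finite_subset[OF _ finite_multisets_of_size[of "set ps" n]])
  have two: "multisets_of_size {p, q} L = R ` {..L}"
  proof (intro subset_antisym subsetI)
    fix A assume A: "A \<in> multisets_of_size {p, q} L"
    have eq: "A = replicate_mset (count A p) p + replicate_mset (count A q) q"
    proof (rule multiset_eqI)
      fix x show "count A x = count (replicate_mset (count A p) p + replicate_mset (count A q) q) x"
      proof (cases "x \<in> {p, q}")
        case False
        then have "x \<notin># A" using A by (auto simp: multisets_of_size_def)
        then show ?thesis using False by (simp add: not_in_iff)
      qed (use ps(4) in auto)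
    qed
    have "size A = count A p + count A q"
      using arg_cong[OF eq, of size] by (simp only: size_union size_replicate_mset)
    then have cq: "count A p \<le> L" "count A q = L - count A p" using A by (auto simp: multisets_of_size_def)
    note eq
    also have "replicate_mset (count A p) p + replicate_mset (count A q) q = R (count A p)"
      by (simp only: R_def cq)
    finally show "A \<in> R ` {..L}" using cq(1) by (intro image_eqI[of _ _ "count A p"]) auto
  qed (auto simp: R_def multisets_of_size_def split: if_splits)
  have wR: "weight_mset wt (R j) = 2 * int j - int L" if "j \<le> L" for j
    using that by (simp add: R_def weight_mset_add weight_mset_replicate wt of_nat_diff)
  have cp: "count (A + R j) p = j" if "A \<in> Z w" for A w j
  proof -
    have "p \<notin># A" using that ps(2) by (auto simp: Z_def multisets_of_size_def)
    then show ?thesis using ps(4) by (simp add: R_def not_in_iff)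
  qed
  have card: "card {A \<in> B. weight_mset wt A = w} = (\<Sum>j\<le>L. cnt (map wt ps) n (w - (2 * int j - int L)))" for w
  proof -
    have "{A \<in> B. weight_mset wt A = w} = (\<Union>j\<le>L. (\<lambda>A. A + R j) ` Z (w - (2 * int j - int L)))"
      unfolding B_def two Z_def by (auto simp: weight_mset_add wR)
    also have "card \<dots> = (\<Sum>j\<le>L. card ((\<lambda>A. A + R j) ` Z (w - (2 * int j - int L))))"
    proof (rule card_UN_disjoint)
      show "\<forall>i\<in>{..L}. \<forall>j\<in>{..L}. i \<noteq> j \<longrightarrow>
          (\<lambda>A. A + R i) ` Z (w - (2 * int i - int L)) \<inter> (\<lambda>A. A + R j) ` Z (w - (2 * int j - int L)) = {}"
      proof (intro ballI impI equals0I)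
        fix i j C assume "i \<noteq> j" "C \<in> (\<lambda>A. A + R i) ` Z (w - (2 * int i - int L)) \<inter>
          (\<lambda>A. A + R j) ` Z (w - (2 * int j - int L))"
        then show False using cp by (metis (no_types, lifting) IntE imageE)
      qed
    qed (auto simp: Z)
    also have "\<dots> = (\<Sum>j\<le>L. card (Z (w - (2 * int j - int L))))"
      by (intro sum.cong refl card_image) (auto simp: inj_on_def)
    finally show ?thesis by (simp add: Z)
  qed
  let ?c = "\<lambda>w. int (cnt (map wt ps) n w)"
  \<comment> \<open>The upper limit is freed from the L inside the summand so that the telescoping
    can be proved by induction.\<close>
  have "(\<Sum>j\<le>K. ?c (0 - (2 * int j - int L))) - (\<Sum>j\<le>K. ?c (2 - (2 * int j - int L))) =
      ?c (int L - 2 * int K) - ?c (int L + 2)" for K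
    by (induction K) (simp_all add: algebra_simps)
  from this[of L] show "int (card {A \<in> B. weight_mset wt A = 0}) - int (card {A \<in> B. weight_mset wt A = 2}) =
      ?c (- int L) - ?c (int L + 2)"
    by (simp add: card)
qed

section \<open>Generators of \<open>SL\<^sub>2\<close>\<close>

definition mat2 :: "complex \<Rightarrow> complex \<Rightarrow> complex \<Rightarrow> complex \<Rightarrow> complex^2^2" where
  "mat2 a b c d = (\<chi> i j. if i = 1 then (if j = 1 then a else b) else (if j = 1 then c else d))"

lemma mat2_eta: "g = mat2 (g $ 1 $ 1) (g $ 1 $ 2) (g $ 2 $ 1) (g $ 2 $ 2)"
  by (simp add: mat2_def Finite_Cartesian_Product.vec_eq_iff forall_2)

lemma mat2_mult: "mat2 a b c d ** mat2 a' b' c' d' =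
    mat2 (a * a' + b * c') (a * b' + b * d') (c * a' + d * c') (c * b' + d * d')"
  by (simp add: mat2_def matrix_matrix_mult_def Finite_Cartesian_Product.vec_eq_iff forall_2 sum_2)

lemma mat2_one: "mat2 1 0 0 1 = Finite_Cartesian_Product.mat 1"
  by (simp add: mat2_def Finite_Cartesian_Product.mat_def Finite_Cartesian_Product.vec_eq_iff forall_2)

lemma mat2_vec: "(mat2 a b c d *v v) $ 1 = a * v $ 1 + b * v $ 2" "(mat2 a b c d *v v) $ 2 = c * v $ 1 + d * v $ 2"
  by (simp_all add: mat2_def matrix_vector_mult_def sum_2)

lemma mat2_in_SL2: "mat2 a b c d \<in> SL2 \<longleftrightarrow> a * d - b * c = 1"
  by (simp add: SL2_def det_2) (simp add: mat2_def)

lemma matrix_inv_eqI: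
  fixes A :: "complex^2^2"
  assumes "A ** B = Finite_Cartesian_Product.mat 1" "B ** A = Finite_Cartesian_Product.mat 1"
  shows "matrix_inv A = B"
  unfolding matrix_inv_def
proof (rule some_equality)
  fix B' assume "A ** B' = Finite_Cartesian_Product.mat 1 \<and> B' ** A = Finite_Cartesian_Product.mat 1"
  then show "B' = B" using assms by (metis matrix_mul_assoc matrix_mul_lid matrix_mul_rid)
qed (use assms in simp)

lemma SL2_inv:
  assumes "g \<in> SL2"
  shows "g ** matrix_inv g = Finite_Cartesian_Product.mat 1" "matrix_inv g ** g = Finite_Cartesian_Product.mat 1"
    "matrix_inv g \<in> SL2" "matrix_inv (matrix_inv g) = g"
    "a * d - b * c = 1 \<Longrightarrow> matrix_inv (mat2 a b c d) = mat2 d (- b) (- c) a"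
proof -
  have inv: "matrix_inv (mat2 a b c d) = mat2 d (- b) (- c) a"
    "mat2 a b c d ** mat2 d (- b) (- c) a = Finite_Cartesian_Product.mat 1"
    "mat2 d (- b) (- c) a ** mat2 a b c d = Finite_Cartesian_Product.mat 1"
    if "a * d - b * c = 1" for a b c d
  proof -
    show 1: "mat2 a b c d ** mat2 d (- b) (- c) a = Finite_Cartesian_Product.mat 1"
      and 2: "mat2 d (- b) (- c) a ** mat2 a b c d = Finite_Cartesian_Product.mat 1"
      using that by (simp_all add: mat2_mult mat2_one[symmetric] algebra_simps)
    show "matrix_inv (mat2 a b c d) = mat2 d (- b) (- c) a" by (rule matrix_inv_eqI[OF 1 2])
  qed
  then show "a * d - b * c = 1 \<Longrightarrow> matrix_inv (mat2 a b c d) = mat2 d (- b) (- c) a" by simp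
  obtain a b c d where g: "g = mat2 a b c d" using mat2_eta by blast
  have det: "a * d - b * c = 1" using assms unfolding g mat2_in_SL2 .
  show "g ** matrix_inv g = Finite_Cartesian_Product.mat 1" "matrix_inv g ** g = Finite_Cartesian_Product.mat 1"
    unfolding g inv(1)[OF det] using inv(2,3)[OF det] by simp_all
  then show "matrix_inv (matrix_inv g) = g" by (intro matrix_inv_eqI)
  show "matrix_inv g \<in> SL2" unfolding g inv(1)[OF det] mat2_in_SL2 using det by (simp add: algebra_simps)
qed

lemma SL2_mult: "g \<in> SL2 \<Longrightarrow> h \<in> SL2 \<Longrightarrow> g ** h \<in> SL2"
  by (simp add: SL2_def Determinants.det_mul)

lemma matrix_inv_mult:
  assumes "g \<in> SL2" "h \<in> SL2"
  shows "matrix_inv (g ** h) = matrix_inv h ** matrix_inv g"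
proof (rule matrix_inv_eqI)
  show "g ** h ** (matrix_inv h ** matrix_inv g) = Finite_Cartesian_Product.mat 1"
    by (metis SL2_inv(1) assms matrix_mul_assoc matrix_mul_rid)
  show "matrix_inv h ** matrix_inv g ** (g ** h) = Finite_Cartesian_Product.mat 1"
    by (metis SL2_inv(2) assms matrix_mul_assoc matrix_mul_rid)
qed

text \<open>If the lower left entry c is not 0, the matrix is a product of an upper, a lower and an
  upper unipotent matrix. If c = 0 then a \<noteq> 0, and a lower unipotent factor moves a into that
  corner.\<close>

lemma SL2_generated:
  assumes up: "\<And>s. P (mat2 1 s 0 1)" and low: "\<And>s. P (mat2 1 0 s 1)"
    and mult: "\<And>g h. g \<in> SL2 \<Longrightarrow> h \<in> SL2 \<Longrightarrow> P g \<Longrightarrow> P h \<Longrightarrow> P (g ** h)" and g: "g \<in> SL2"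
  shows "P g"
proof -
  have S: "mat2 1 s 0 1 \<in> SL2" "mat2 1 0 s 1 \<in> SL2" for s by (simp_all add: mat2_in_SL2)
  have *: "P (mat2 a b c d)" if det: "a * d - b * c = 1" and c: "c \<noteq> 0" for a b c d
  proof -
    \<comment> \<open>The middle factor has to carry c. The outer parameters are read off from the
      diagonal entries a and d, and the determinant condition then yields b.\<close>
    have "mat2 a b c d = mat2 1 ((a - 1) / c) 0 1 ** (mat2 1 0 c 1 ** mat2 1 ((d - 1) / c) 0 1)"
    proof -
      have "(a - 1) / c + (1 + (a - 1) / c * c) * ((d - 1) / c) = (a * d - 1) / c"
        using c by (simp add: field_simps)
      also have "\<dots> = b" using det c by (simp add: field_simps)
      finally have "b = (d - 1) / c + (a - 1) / c * (c * ((d - 1) / c) + 1)"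
        using c by (simp add: field_simps)
      then show ?thesis using c by (simp add: mat2_mult)
    qed
    then show ?thesis by (simp add: mult up low S SL2_mult)
  qed
  obtain a b c d where g2: "g = mat2 a b c d" using mat2_eta by blast
  have det: "a * d - b * c = 1" using g unfolding g2 mat2_in_SL2 .
  show ?thesis
  proof (cases "c = 0")
    case True
    have "g = mat2 1 0 (-1) 1 ** mat2 a b (a + c) (b + d)"
      by (simp add: g2 mat2_mult)
    moreover have "P (mat2 a b (a + c) (b + d))" "mat2 a b (a + c) (b + d) \<in> SL2"
      using det True by (auto intro!: * simp: mat2_in_SL2 algebra_simps)
    ultimately show ?thesis using low S mult by metis
  qed (use * det g2 in auto)
qed

section \<open>Invariance tested on the unipotent generators\<close>

definition pair_act :: "complex^2^2 \<Rightarrow> (nat \<times> (complex^2) \<Rightarrow> complex) \<times> (complex^2) \<Rightarrow>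
    (nat \<times> (complex^2) \<Rightarrow> complex) \<times> (complex^2)" where
  "pair_act g = (\<lambda>(w, v). (actW g w, g *v v))"

lemma actW_apply: "actW g w (k, v) = w (k, matrix_inv g *v v)"
  by (simp add: actW_def translate_def)

lemma actW_mult:
  assumes "g \<in> SL2" "h \<in> SL2"
  shows "actW (g ** h) w = actW g (actW h w)"
  by (auto simp: fun_eq_iff actW_apply matrix_inv_mult[OF assms] matrix_vector_mul_assoc)

lemma pair_act_mult: "g \<in> SL2 \<Longrightarrow> h \<in> SL2 \<Longrightarrow> pair_act (g ** h) x = pair_act g (pair_act h x)"
  by (cases x) (simp add: pair_act_def actW_mult matrix_vector_mul_assoc)

lemma translate_pair_act_invariant_iff:
  "(\<forall>g\<in>SL2. translate pair_act g f = f) \<longleftrightarrow>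
    (\<forall>s x. f (pair_act (mat2 1 s 0 1) x) = f x \<and> f (pair_act (mat2 1 0 s 1) x) = f x)" (is "?L \<longleftrightarrow> ?R")
proof
  assume L: ?L
  have "f (pair_act g x) = f x" if g: "g \<in> SL2" for g x
  proof -
    have "translate pair_act (matrix_inv g) f x = f x" using L SL2_inv(3)[OF g] by simp
    then show ?thesis by (simp add: translate_def SL2_inv(4)[OF g])
  qed
  then show ?R by (simp add: mat2_in_SL2)
next
  assume R: ?R
  have "\<forall>x. f (pair_act g x) = f x" if "g \<in> SL2" for g
    by (rule SL2_generated[OF _ _ _ that]) (use R in \<open>simp_all add: pair_act_mult del: split_paired_All\<close>)
  then show ?L by (auto simp: translate_def fun_eq_iff SL2_inv(3))
qed


section \<open>Coordinates on \<open>W \<times> \<complex>\<^sup>2\<close>\<close>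

text \<open>Coordinates of a tuple of binary forms of degrees \<open>d k\<close>: \<open>y (k, i)\<close> is the coefficient of \<open>v\<^sub>1\<^sup>i v\<^sub>2\<^bsup>d k - i\<^esup>\<close>, of
  weight \<open>d k - 2 i\<close>. The maps below are its transforms under the two unipotent one-parameter subgroups.\<close>

type_synonym coords = "nat \<times> nat \<Rightarrow> complex"

definition flow_down :: "(nat \<Rightarrow> nat) \<Rightarrow> complex \<Rightarrow> coords \<Rightarrow> coords" where
  "flow_down d s y = (\<lambda>(k, j). if j \<le> d k then \<Sum>i\<le>d k. of_nat (i choose j) * (- s) ^ (i - j) * y (k, i) else y (k, j))"

definition flow_up :: "(nat \<Rightarrow> nat) \<Rightarrow> complex \<Rightarrow> coords \<Rightarrow> coords" where
  "flow_up d s y = (\<lambda>(k, j). if j \<le> d k then \<Sum>i\<le>j. of_nat ((d k - i) choose (j - i)) * (- s) ^ (j - i) * y (k, i) else y (k, j))"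

text \<open>Together with \<open>idx_down\<close> this is the linear vector field whose flow is
  \<open>flow_down\<close>, and likewise for \<open>coef_up\<close>. The value 0 at the end of a
  block keeps the shifted index from mattering there. Down means that the weight drops, that is, the
  second index grows.\<close>

definition coef_down :: "(nat \<Rightarrow> nat) \<Rightarrow> nat \<times> nat \<Rightarrow> complex" where
  "coef_down d = (\<lambda>(k, j). if j < d k then - of_nat (j + 1) else 0)"

definition coef_up :: "(nat \<Rightarrow> nat) \<Rightarrow> nat \<times> nat \<Rightarrow> complex" where
  "coef_up d = (\<lambda>(k, j). if 0 < j \<and> j \<le> d k then - of_nat (d k - j + 1) else 0)"

definition idx_down :: "nat \<times> nat \<Rightarrow> nat \<times> nat" where "idx_down = (\<lambda>(k, j). (k, j + 1))"
definition idx_up :: "nat \<times> nat \<Rightarrow> nat \<times> nat" where "idx_up = (\<lambda>(k, j). (k, j - 1))"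

definition coord_weight :: "(nat \<Rightarrow> nat) \<Rightarrow> nat \<times> nat \<Rightarrow> int" where
  "coord_weight d = (\<lambda>(k, j). int (d k) - 2 * int j)"

lemma flow_0: "flow_down d 0 y = y" "flow_up d 0 y = y"
proof -
  have "(\<Sum>i\<le>m. of_nat (i choose j) * 0 ^ (i - j) * y (k, i)) = y (k, j)" if "j \<le> m" for m k j
  proof -
    have "(\<Sum>i\<le>m. of_nat (i choose j) * 0 ^ (i - j) * y (k, i)) = (\<Sum>i\<le>m. if i = j then y (k, i) else 0)"
      by (intro sum.cong refl) (auto simp: power_0_left not_le)
    then show ?thesis using that by simp
  qed
  then show "flow_down d 0 y = y" by (auto simp: flow_down_def fun_eq_iff)
  have "(\<Sum>i\<le>j. of_nat ((m - i) choose (j - i)) * 0 ^ (j - i) * y (k, i)) = y (k, j)" for m k j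
  proof -
    have "(\<Sum>i\<le>j. of_nat ((m - i) choose (j - i)) * 0 ^ (j - i) * y (k, i)) = (\<Sum>i\<le>j. if i = j then y (k, i) else 0)"
      by (intro sum.cong refl) (auto simp: power_0_left)
    then show ?thesis by simp
  qed
  then show "flow_up d 0 y = y" by (auto simp: flow_up_def fun_eq_iff)
qed

lemma choose_mult_diff: "of_nat (n choose k) * of_nat (n - k) = (of_nat (k + 1) * of_nat (n choose (k + 1)) :: complex)"
  using binomial_absorb_comp[of n k] binomial_absorption[of k n]
  by (simp only: of_nat_mult[symmetric] of_nat_eq_iff) (simp add: mult.commute)

text \<open>By (i choose j) (i - j) = (j + 1) (i choose (j + 1)) the derivative of one coefficient
  is a multiple of the next one; the last coefficient of a block is constant.\<close>

lemma flow_down_deriv: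
  "((\<lambda>s. flow_down d s y p) has_field_derivative coef_down d p * flow_down d s y (idx_down p)) (at s)"
proof -
  obtain k j where p: "p = (k, j)" by (cases p)
  consider "j < d k" | "j = d k" | "d k < j" by linarith
  then show ?thesis
  proof cases
    case 1
    have "((\<lambda>s. \<Sum>i\<le>d k. of_nat (i choose j) * (- s) ^ (i - j) * y (k, i)) has_field_derivative
      (\<Sum>i\<le>d k. of_nat (i choose j) * (of_nat (i - j) * (- s) ^ (i - j - 1) * - 1) * y (k, i))) (at s)"
      by (auto intro!: derivative_eq_intros sum.cong)
    also have "(\<Sum>i\<le>d k. of_nat (i choose j) * (of_nat (i - j) * (- s) ^ (i - j - 1) * - 1) * y (k, i)) =
      (\<Sum>i\<le>d k. - of_nat (j + 1) * (of_nat (i choose (j + 1)) * (- s) ^ (i - (j + 1)) * y (k, i)))"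
    proof (intro sum.cong refl)
      fix i
      have "of_nat (i choose j) * (of_nat (i - j) * (- s) ^ (i - j - 1) * - 1) * y (k, i) =
          - (of_nat (i choose j) * of_nat (i - j)) * (- s) ^ (i - j - 1) * y (k, i)" by simp
      also have "\<dots> = - (of_nat (j + 1) * of_nat (i choose (j + 1))) * (- s) ^ (i - (j + 1)) * y (k, i)"
        by (simp only: choose_mult_diff diff_diff_left)
      also have "\<dots> = - of_nat (j + 1) * (of_nat (i choose (j + 1)) * (- s) ^ (i - (j + 1)) * y (k, i))"
        by (simp only: mult.assoc mult_minus_left)
      finally show "of_nat (i choose j) * (of_nat (i - j) * (- s) ^ (i - j - 1) * - 1) * y (k, i) =
          - of_nat (j + 1) * (of_nat (i choose (j + 1)) * (- s) ^ (i - (j + 1)) * y (k, i))" .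
    qed
    finally show ?thesis
      using 1 by (simp add: p flow_down_def coef_down_def idx_down_def sum_distrib_left)
  next
    case 2
    have "((\<lambda>s. \<Sum>i\<le>d k. of_nat (i choose j) * (- s) ^ (i - j) * y (k, i)) has_field_derivative 0) (at s)"
    proof -
      have "(\<Sum>i\<le>d k. of_nat (i choose j) * (- s) ^ (i - j) * y (k, i)) = y (k, j)" for s
      proof -
        have "(\<Sum>i\<le>d k. of_nat (i choose j) * (- s) ^ (i - j) * y (k, i)) = (\<Sum>i\<le>d k. if i = j then y (k, j) else 0)"
          using 2 by (intro sum.cong refl) auto
        then show ?thesis using 2 by simp
      qed
      then show ?thesis by simp
    qed
    then show ?thesis using 2 by (simp add: p flow_down_def coef_down_def)
  qed (simp add: p flow_down_def coef_down_def)
qed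

lemma flow_up_deriv:
  "((\<lambda>s. flow_up d s y p) has_field_derivative coef_up d p * flow_up d s y (idx_up p)) (at s)"
proof -
  obtain k j where p: "p = (k, j)" by (cases p)
  show ?thesis
  proof (cases "0 < j \<and> j \<le> d k")
    case True
    then obtain l where l: "j = Suc l" by (metis gr0_conv_Suc)
    have "((\<lambda>s. \<Sum>i\<le>j. of_nat ((d k - i) choose (j - i)) * (- s) ^ (j - i) * y (k, i)) has_field_derivative
      (\<Sum>i\<le>j. of_nat ((d k - i) choose (j - i)) * (of_nat (j - i) * (- s) ^ (j - i - 1) * - 1) * y (k, i))) (at s)"
      by (auto intro!: derivative_eq_intros sum.cong)
    also have "(\<Sum>i\<le>j. of_nat ((d k - i) choose (j - i)) * (of_nat (j - i) * (- s) ^ (j - i - 1) * - 1) * y (k, i)) =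
      (\<Sum>i\<le>l. of_nat ((d k - i) choose (j - i)) * (of_nat (j - i) * (- s) ^ (j - i - 1) * - 1) * y (k, i))"
      by (simp add: l)
    also have "\<dots> = (\<Sum>i\<le>l. - of_nat (d k - j + 1) * (of_nat ((d k - i) choose (l - i)) * (- s) ^ (l - i) * y (k, i)))"
    proof (intro sum.cong refl)
      fix i assume i: "i \<in> {..l}"
      have n: "d k - i - (l - i) = d k - j + 1" "l - i + 1 = j - i" "j - i - 1 = l - i"
        using i True l by auto
      have e: "of_nat ((d k - i) choose (l - i)) * of_nat (d k - j + 1) =
          (of_nat (j - i) * of_nat ((d k - i) choose (j - i)) :: complex)"
        using choose_mult_diff[of "d k - i" "l - i"] unfolding n .
      have "of_nat ((d k - i) choose (j - i)) * (of_nat (j - i) * (- s) ^ (j - i - 1) * - 1) * y (k, i) =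
          - (of_nat (j - i) * of_nat ((d k - i) choose (j - i))) * (- s) ^ (j - i - 1) * y (k, i)" by simp
      also have "\<dots> = - (of_nat (d k - j + 1) * of_nat ((d k - i) choose (l - i))) * (- s) ^ (l - i) * y (k, i)"
        by (simp only: e[symmetric] n(3) mult.commute)
      also have "\<dots> = - of_nat (d k - j + 1) * (of_nat ((d k - i) choose (l - i)) * (- s) ^ (l - i) * y (k, i))"
        by (simp only: mult.assoc mult_minus_left)
      finally show "of_nat ((d k - i) choose (j - i)) * (of_nat (j - i) * (- s) ^ (j - i - 1) * - 1) * y (k, i) =
          - of_nat (d k - j + 1) * (of_nat ((d k - i) choose (l - i)) * (- s) ^ (l - i) * y (k, i))" .
    qed
    finally show ?thesis
      using True by (simp add: p flow_up_def coef_up_def idx_up_def sum_distrib_left l)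
  qed (auto simp: p flow_up_def coef_up_def)
qed

text \<open>The range includes k = r, a block kept for the factor \<complex>^2. On the coordinate
  (k, j) of a block of degree d the bracket is (j + 1) (d - j) - j (d - j + 1) = d - 2 j.\<close>

lemma sl2_coordinates_forms:
  "sl2_coordinates {(k, i). k \<le> r \<and> i \<le> d k} fst (coord_weight d)
    (coef_up d) (coef_down d) idx_up idx_down"
proof
  fix p :: "nat \<times> nat" and y :: coords
  assume p: "p \<in> {(k, i). k \<le> r \<and> i \<le> d k}"
  obtain k j where kj: "p = (k, j)" by (cases p)
  show "idx_up p \<in> {(k, i). k \<le> r \<and> i \<le> d k} \<and> fst (idx_up p) = fst p \<and> coord_weight d (idx_up p) = coord_weight d p + 2"
    if "coef_up d p \<noteq> 0"
    using p that by (auto simp: kj coef_up_def idx_up_def coord_weight_def split: if_splits)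
  show "idx_down p \<in> {(k, i). k \<le> r \<and> i \<le> d k} \<and> fst (idx_down p) = fst p \<and> coord_weight d (idx_down p) = coord_weight d p - 2"
    if "coef_down d p \<noteq> 0"
    using p that by (auto simp: kj coef_down_def idx_down_def coord_weight_def split: if_splits)
  show "coef_down d p * coef_up d (idx_down p) * y (idx_up (idx_down p)) -
      coef_up d p * coef_down d (idx_up p) * y (idx_down (idx_up p)) = of_int (coord_weight d p) * y p"
    using p by (cases "j = 0"; cases "j = d k")
      (auto simp: kj coef_down_def coef_up_def idx_up_def idx_down_def coord_weight_def of_nat_diff algebra_simps)
qed

lemma form_flow_down:
  "(\<Sum>i\<le>n. y i * (a - s * b) ^ i * b ^ (n - i)) =
   (\<Sum>j\<le>n. (\<Sum>i\<le>n. of_nat (i choose j) * (- s) ^ (i - j) * y i) * a ^ j * b ^ (n - j))" for a b s :: complex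
proof -
  have "y i * (a - s * b) ^ i * b ^ (n - i) = (\<Sum>j\<le>n. of_nat (i choose j) * (- s) ^ (i - j) * y i * a ^ j * b ^ (n - j))"
    if i: "i \<le> n" for i
  proof -
    have "(a - s * b) ^ i = (\<Sum>j\<le>i. of_nat (i choose j) * a ^ j * ((- s) ^ (i - j) * b ^ (i - j)))"
      using binomial_ring[of a "- s * b" i] unfolding power_mult_distrib by simp
    then have "y i * (a - s * b) ^ i * b ^ (n - i) =
        (\<Sum>j\<le>i. of_nat (i choose j) * (- s) ^ (i - j) * y i * a ^ j * (b ^ (i - j) * b ^ (n - i)))"
      by (simp add: sum_distrib_left sum_distrib_right mult_ac)
    also have "\<dots> = (\<Sum>j\<le>i. of_nat (i choose j) * (- s) ^ (i - j) * y i * a ^ j * b ^ (n - j))"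
      using i by (intro sum.cong refl) (simp add: power_add[symmetric])
    also have "\<dots> = (\<Sum>j\<le>n. of_nat (i choose j) * (- s) ^ (i - j) * y i * a ^ j * b ^ (n - j))"
      using i by (intro sum.mono_neutral_left) auto
    finally show ?thesis .
  qed
  then have "(\<Sum>i\<le>n. y i * (a - s * b) ^ i * b ^ (n - i)) =
      (\<Sum>i\<le>n. \<Sum>j\<le>n. of_nat (i choose j) * (- s) ^ (i - j) * y i * a ^ j * b ^ (n - j))" by simp
  also have "\<dots> = (\<Sum>j\<le>n. \<Sum>i\<le>n. of_nat (i choose j) * (- s) ^ (i - j) * y i * a ^ j * b ^ (n - j))"
    by (rule sum.swap)
  finally show ?thesis by (simp add: sum_distrib_right)
qed

lemma form_flow_up:
  "(\<Sum>i\<le>n. y i * a ^ i * (b - s * a) ^ (n - i)) =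
   (\<Sum>j\<le>n. (\<Sum>i\<le>j. of_nat ((n - i) choose (j - i)) * (- s) ^ (j - i) * y i) * a ^ j * b ^ (n - j))" for a b s :: complex
proof -
  let ?t = "\<lambda>i j. of_nat ((n - i) choose (j - i)) * (- s) ^ (j - i) * y i * a ^ j * b ^ (n - j)"
  have "y i * a ^ i * (b - s * a) ^ (n - i) = (\<Sum>j\<in>{i..n}. ?t i j)" if i: "i \<le> n" for i
  proof -
    have "(b - s * a) ^ (n - i) = (\<Sum>m\<le>n - i. of_nat ((n - i) choose m) * ((- s) ^ m * a ^ m) * b ^ (n - i - m))"
      using binomial_ring[of "- s * a" b "n - i"] unfolding power_mult_distrib by simp
    then have "y i * a ^ i * (b - s * a) ^ (n - i) =
        (\<Sum>m\<le>n - i. of_nat ((n - i) choose m) * (- s) ^ m * y i * (a ^ i * a ^ m) * b ^ (n - i - m))"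
      by (simp add: sum_distrib_left mult_ac)
    also have "\<dots> = (\<Sum>m\<le>n - i. ?t i (i + m))"
      by (simp add: power_add diff_diff_left)
    also have "\<dots> = (\<Sum>j\<in>{i..n}. ?t i j)"
      using i by (intro sum.reindex_bij_witness[of _ "\<lambda>j. j - i" "\<lambda>m. i + m"]) auto
    finally show ?thesis .
  qed
  then have "(\<Sum>i\<le>n. y i * a ^ i * (b - s * a) ^ (n - i)) = (\<Sum>i\<le>n. \<Sum>j\<in>{i..n}. ?t i j)" by simp
  also have "\<dots> = (\<Sum>i\<le>n. \<Sum>j | j \<in> {..n} \<and> i \<le> j. ?t i j)"
    by (intro sum.cong refl arg_cong2[where f = sum]) auto
  also have "\<dots> = (\<Sum>j\<le>n. \<Sum>i | i \<in> {..n} \<and> i \<le> j. ?t i j)"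
    by (rule sum.swap_restrict) auto
  also have "\<dots> = (\<Sum>j\<le>n. \<Sum>i\<le>j. ?t i j)"
    by (intro sum.cong refl arg_cong2[where f = sum]) auto
  finally show ?thesis by (simp add: sum_distrib_right)
qed

lemma span_image_finite:
  assumes "finite I" "f \<in> cfun.span (g ` I)"
  shows "\<exists>c. f = (\<lambda>x. \<Sum>i\<in>I. c i * g i x)"
  using assms(2)
proof (rule cfun.span_induct)
  have zero: "0 = (\<lambda>x. \<Sum>i\<in>I. 0 * g i x)" by (simp add: fun_ops)
  have add: "(\<lambda>x. \<Sum>i\<in>I. c i * g i x) + (\<lambda>x. \<Sum>i\<in>I. c' i * g i x) = (\<lambda>x. \<Sum>i\<in>I. (c i + c' i) * g i x)" for c c'
    by (simp add: fun_ops sum.distrib distrib_right)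
  have scale: "fscale a (\<lambda>x. \<Sum>i\<in>I. c i * g i x) = (\<lambda>x. \<Sum>i\<in>I. (a * c i) * g i x)" for a c
    by (simp add: fun_ops sum_distrib_left mult.assoc)
  show "cfun.subspace {f. \<exists>c. f = (\<lambda>x. \<Sum>i\<in>I. c i * g i x)}"
    by (intro cfun.subspaceI CollectI; (elim CollectE exE)?; hypsubst?; rule exI, rule zero add scale)
  fix f assume "f \<in> g ` I"
  then obtain j where j: "j \<in> I" "f = g j" by blast
  have "f = (\<lambda>x. \<Sum>i\<in>I. (if i = j then 1 else 0) * g i x)"
    using j assms(1) by (simp add: if_distrib[where f = "\<lambda>x. x * _"] cong: if_cong)
  then show "\<exists>c. f = (\<lambda>x. \<Sum>i\<in>I. c i * g i x)" by (rule exI[of _ "\<lambda>i. if i = j then 1 else 0"])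
qed

lemma clinear_span_imp:
  assumes "clinear T" "\<And>g. g \<in> S \<Longrightarrow> T g \<in> cfun.span V" "f \<in> cfun.span S"
  shows "T f \<in> cfun.span V"
proof -
  have "T f \<in> cfun.span (T ` S)"
    using cfun_pair.linear_span_image[OF assms(1), of S] assms(3) by blast
  moreover have "cfun.span (T ` S) \<subseteq> cfun.span V"
    using assms(2) by (intro cfun.span_minimal cfun.subspace_span) auto
  ultimately show ?thesis by blast
qed

lemma span_monm_mult:
  assumes "f \<in> cfun.span (monm ` S)" "h \<in> cfun.span (monm ` S')"
  shows "(\<lambda>y. f y * h y) \<in> cfun.span (monm ` {A + B | A B. A \<in> S \<and> B \<in> S'})"
proof (rule clinear_span_imp[OF _ _ assms(1)])
  show "clinear (\<lambda>f y. f y * h y)" by (rule clinearI) (auto simp: fun_ops algebra_simps)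
  fix g assume "g \<in> monm ` S"
  then obtain A where A: "A \<in> S" "g = monm A" by blast
  show "(\<lambda>y. g y * h y) \<in> cfun.span (monm ` {A + B | A B. A \<in> S \<and> B \<in> S'})"
  proof (rule clinear_span_imp[OF _ _ assms(2)])
    show "clinear (\<lambda>h y. g y * h y)" by (rule clinearI) (auto simp: fun_ops algebra_simps)
    fix g' assume "g' \<in> monm ` S'"
    then obtain B where B: "B \<in> S'" "g' = monm B" by blast
    have "(\<lambda>y. g y * g' y) = monm (A + B)" by (simp add: A B monm_def)
    then show "(\<lambda>y. g y * g' y) \<in> cfun.span (monm ` {A + B | A B. A \<in> S \<and> B \<in> S'})"
      using A(1) B(1) by (auto intro!: cfun.span_base)
  qed
qed

lemma linear_map_on_sum:
  assumes l: "linear_map_on M (*) l" and M: "cfun.subspace M" and "finite A" "\<And>p. p \<in> A \<Longrightarrow> g p \<in> M"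
  shows "l (\<Sum>p\<in>A. fscale (c p) (g p)) = (\<Sum>p\<in>A. c p * l (g p))"
  using assms(3,4)
proof (induction A rule: finite_induct)
  case empty
  have "l (fscale 0 0) = 0 * l 0" using l cfun.subspace_0[OF M] unfolding linear_map_on_def by blast
  then show ?case by simp
next
  case (insert p A)
  have "(\<Sum>p\<in>A. fscale (c p) (g p)) \<in> M" "fscale (c p) (g p) \<in> M"
    using insert.prems by (auto intro!: cfun.subspace_sum[OF M] cfun.subspace_scale[OF M])
  then have "l (fscale (c p) (g p) + (\<Sum>p\<in>A. fscale (c p) (g p))) = l (fscale (c p) (g p)) + l (\<Sum>p\<in>A. fscale (c p) (g p))"
    using l unfolding linear_map_on_def by blast
  also have "l (fscale (c p) (g p)) = c p * l (g p)"
    using l insert.prems unfolding linear_map_on_def by blast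
  finally show ?case using insert by simp
qed

section \<open>Covariants of a fixed W as polynomials in coordinates\<close>

locale forms =
  fixes ds :: "nat list"
begin

abbreviation "r \<equiv> length ds"

text \<open>The default value matters at k = r: that extra block has degree 1 and holds the factor
  \<complex>^2.\<close>

definition d :: "nat \<Rightarrow> nat" where "d k = (if k < r then ds ! k else 1)"

definition to_W :: "coords \<Rightarrow> nat \<times> (complex^2) \<Rightarrow> complex" where
  "to_W y = (\<lambda>(k, v). if k < r then \<Sum>i\<le>d k. y (k, i) * (v $ 1) ^ i * (v $ 2) ^ (d k - i) else 0)"

text \<open>The second factor \<open>\<complex>\<^sup>2\<close> is identified with the linear forms so that \<open>flow_down\<close> and \<open>flow_up\<close> describe the action
  on it as well; this is where the sign comes from.\<close>

definition to_V :: "coords \<Rightarrow> complex^2" where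
  "to_V y = (\<chi> i. if i = 1 then y (r, 0) else - y (r, 1))"

definition to_pair :: "coords \<Rightarrow> (nat \<times> (complex^2) \<Rightarrow> complex) \<times> (complex^2)" where
  "to_pair y = (to_W y, to_V y)"

lemma to_V_nth: "to_V y $ 1 = y (r, 0)" "to_V y $ 2 = - y (r, 1)"
  by (simp_all add: to_V_def)

lemma to_pair_flow_down: "to_pair (flow_down d s y) = pair_act (mat2 1 s 0 1) (to_pair y)"
proof -
  have inv: "matrix_inv (mat2 1 s 0 1) = mat2 1 (- s) 0 1"
    by (subst SL2_inv(5)[of "mat2 1 0 0 1"]) (simp_all add: mat2_in_SL2)
  have "to_W (flow_down d s y) (k, v) = actW (mat2 1 s 0 1) (to_W y) (k, v)" for k v
    using form_flow_down[of "\<lambda>i. y (k, i)" "v $ 1" s "v $ 2" "d k"]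
    by (simp add: to_W_def actW_apply inv mat2_vec flow_down_def)
  moreover have "to_V (flow_down d s y) = mat2 1 s 0 1 *v to_V y"
    by (simp add: Finite_Cartesian_Product.vec_eq_iff forall_2 mat2_vec to_V_nth flow_down_def d_def)
  ultimately show ?thesis by (auto simp: to_pair_def pair_act_def)
qed

lemma to_pair_flow_up: "to_pair (flow_up d s y) = pair_act (mat2 1 0 s 1) (to_pair y)"
proof -
  have inv: "matrix_inv (mat2 1 0 s 1) = mat2 1 0 (- s) 1"
    by (subst SL2_inv(5)[of "mat2 1 0 0 1"]) (simp_all add: mat2_in_SL2)
  have "to_W (flow_up d s y) (k, v) = actW (mat2 1 0 s 1) (to_W y) (k, v)" for k v
    using form_flow_up[of "\<lambda>i. y (k, i)" "v $ 1" "v $ 2" s "d k"]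
    by (simp add: to_W_def actW_apply inv mat2_vec flow_up_def)
  moreover have "to_V (flow_up d s y) = mat2 1 0 s 1 *v to_V y"
    by (simp add: Finite_Cartesian_Product.vec_eq_iff forall_2 mat2_vec to_V_nth flow_up_def d_def)
  ultimately show ?thesis by (auto simp: to_pair_def pair_act_def)
qed

lemma clinear_to_W: "clinear to_W"
  by (rule clinearI)
     (auto simp: to_W_def fun_ops sum.distrib sum_distrib_left algebra_simps intro!: sum.cong)

definition I :: "(nat \<times> nat) set" where "I = {(k, i). k < r \<and> i \<le> d k}"

lemma finite_I: "finite I"
proof -
  have "I = (SIGMA k:{..<r}. {..d k})" by (auto simp: I_def)
  then show ?thesis by simp
qed

definition \<delta> :: "nat \<times> nat \<Rightarrow> coords" where "\<delta> p = (\<lambda>q. if q = p then 1 else 0)"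

lemma to_W_eq_sum: "to_W y = (\<Sum>p\<in>I. fscale (y p) (to_W (\<delta> p)))"
proof -
  have "(\<Sum>p\<in>I. fscale (y p) (\<delta> p)) q = (if q \<in> I then y q else 0)" for q
    by (simp add: sum_fun_apply fscale_apply \<delta>_def finite_I if_distrib[where f = "\<lambda>x. _ * x"] cong: if_cong)
  then have "to_W y = to_W (\<Sum>p\<in>I. fscale (y p) (\<delta> p))"
    by (auto simp: to_W_def I_def fun_eq_iff intro!: sum.cong)
  then show ?thesis by (simp add: clinear_simps[OF clinear_to_W])
qed

lemma form_sum_eq: "form_sum ds = range to_W"
proof (intro subset_antisym subsetI)
  fix w assume w: "w \<in> form_sum ds"
  have "\<exists>c. \<forall>v. w (k, v) = (\<Sum>i\<le>d k. c i * (v $ 1) ^ i * (v $ 2) ^ (d k - i))" if k: "k < r" for k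
  proof -
    have "(\<lambda>v. w (k, v)) \<in> cfun.span (monomial_form (d k) ` {..d k})"
      using w k by (simp add: form_sum_def binary_forms_def d_def)
    then obtain c where "(\<lambda>v. w (k, v)) = (\<lambda>v. \<Sum>i\<le>d k. c i * monomial_form (d k) i v)"
      using span_image_finite[of "{..d k}"] by blast
    then show ?thesis by (intro exI[of _ c]) (simp add: fun_eq_iff monomial_form_def mult.assoc)
  qed
  then obtain c where c: "\<And>k v. k < r \<Longrightarrow> w (k, v) = (\<Sum>i\<le>d k. c k i * (v $ 1) ^ i * (v $ 2) ^ (d k - i))"
    by metis
  have "w = to_W (\<lambda>(k, i). c k i)"
    using w by (auto simp: fun_eq_iff to_W_def c form_sum_def not_less)
  then show "w \<in> range to_W" by blast
next
  fix w assume "w \<in> range to_W"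
  then obtain y where w: "w = to_W y" by blast
  have "(\<lambda>v. w (k, v)) \<in> binary_forms (ds ! k)" if k: "k < r" for k
  proof -
    have "(\<lambda>v. w (k, v)) = (\<Sum>i\<le>d k. fscale (y (k, i)) (monomial_form (d k) i))"
      using k by (simp add: w to_W_def fun_eq_iff sum_fun_apply fscale_apply monomial_form_def mult.assoc)
    also have "\<dots> \<in> binary_forms (ds ! k)"
      using k unfolding binary_forms_def d_def
      by (intro cfun.span_sum cfun.span_scale cfun.span_base) auto
    finally show ?thesis .
  qed
  then show "w \<in> form_sum ds" by (auto simp: form_sum_def w to_W_def)
qed

lemma subspace_form_sum: "cfun.subspace (form_sum ds)"
  unfolding form_sum_eq by (rule cfun_pair.linear_subspace_image[OF clinear_to_W cfun.subspace_UNIV])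

lemma to_W_eqD:
  assumes "to_W y = to_W z" "p \<in> I"
  shows "y p = z p"
proof -
  obtain k i where p: "p = (k, i)" "k < r" "i \<le> d k" using assms(2) by (auto simp: I_def)
  \<comment> \<open>At v = (x, 1) a binary form becomes a polynomial in x with the same
    coefficients.\<close>
  have "(\<Sum>i\<le>d k. (y (k, i) - z (k, i)) * x ^ i) = 0" for x
    using fun_cong[OF assms(1), of "(k, \<chi> j. if j = 1 then x else 1)"] p(2)
    by (simp add: to_W_def left_diff_distrib sum_subtractf)
  then show ?thesis
    using Poly_Roots.polyfun_eq_0[of "\<lambda>i. y (k, i) - z (k, i)" "d k"] p by auto
qed

text \<open>Preimages under \<open>to_W\<close> differ outside I, where \<open>to_W\<close> ignores
  y, so one of them is chosen; for p in I the value does not depend on the choice.\<close>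

definition coord :: "nat \<times> nat \<Rightarrow> (nat \<times> (complex^2) \<Rightarrow> complex) \<Rightarrow> complex" where
  "coord p w = (SOME y. to_W y = w) p"

lemma coord_to_W: "p \<in> I \<Longrightarrow> coord p (to_W y) = y p"
  unfolding coord_def by (rule someI2[of _ y]) (auto intro: to_W_eqD)

lemma linear_coord: "p \<in> I \<Longrightarrow> linear_map_on (form_sum ds) (*) (coord p)"
  unfolding linear_map_on_def form_sum_eq
  by (auto simp: coord_to_W fun_ops clinear_simps(1,2)[OF clinear_to_W, symmetric])

lemma linear_functional_to_W:
  assumes "linear_map_on (form_sum ds) (*) l"
  shows "l (to_W y) = (\<Sum>p\<in>I. y p * l (to_W (\<delta> p)))"
  by (subst to_W_eq_sum, rule linear_map_on_sum[OF assms subspace_form_sum finite_I])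
     (simp add: form_sum_eq)

lemma dim_form_sum: "cfun.dim (form_sum ds) = card I"
proof -
  let ?g = "\<lambda>p. to_W (\<delta> p)"
  have inj: "inj_on ?g I"
  proof (rule inj_onI)
    fix p q assume "p \<in> I" "q \<in> I" "?g p = ?g q"
    then have "\<delta> p p = \<delta> q p" by (intro to_W_eqD)
    then show "p = q" by (simp add: \<delta>_def split: if_splits)
  qed
  have "cfun.independent (?g ` I)"
  proof
    assume "cfun.dependent (?g ` I)"
    then obtain u where u: "\<exists>v\<in>?g ` I. u v \<noteq> 0" "(\<Sum>v\<in>?g ` I. fscale (u v) v) = 0"
      unfolding cfun.dependent_finite[OF finite_imageI[OF finite_I]] by blast
    have "to_W (\<lambda>p. u (?g p)) = to_W 0"
      using u(2) by (subst to_W_eq_sum) (simp add: sum.reindex[OF inj] clinear_simps[OF clinear_to_W])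
    then have "u (?g p) = 0" if "p \<in> I" for p using to_W_eqD[OF _ that] by (metis zero_fun_apply)
    then show False using u(1) by blast
  qed
  moreover have "form_sum ds \<subseteq> cfun.span (?g ` I)"
  proof
    fix w assume "w \<in> form_sum ds"
    then obtain y where w: "w = to_W y" by (auto simp: form_sum_eq)
    show "w \<in> cfun.span (?g ` I)"
      unfolding w by (subst to_W_eq_sum) (intro cfun.span_sum cfun.span_scale cfun.span_base imageI)
  qed
  moreover have "?g ` I \<subseteq> form_sum ds" by (auto simp: form_sum_eq)
  ultimately have "card (?g ` I) = cfun.dim (form_sum ds)" by (intro cfun.basis_card_eq_dim)
  then show ?thesis by (simp add: card_image[OF inj])
qed

text \<open>Each linear functional becomes a combination of the coordinates in I, so every further
  factor raises the degree by one.\<close>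

lemma homog_poly_to_W:
  assumes "f \<in> homog_polys (form_sum ds) n"
  shows "(\<lambda>y. f (to_W y)) \<in> cfun.span (monm ` multisets_of_size I n)"
proof (rule clinear_span_imp[OF _ _ assms[unfolded homog_polys_def]])
  show "clinear (\<lambda>f y. f (to_W y))" by (rule clinearI) (auto simp: fun_ops)
  fix f assume "f \<in> {(\<lambda>w. if w \<in> form_sum ds then \<Prod>i<n. l i w else 0) | l.
    \<forall>i<n. linear_map_on (form_sum ds) (*) (l i)}"
  then obtain l where f: "f = (\<lambda>w. if w \<in> form_sum ds then \<Prod>i<n. l i w else 0)"
    and l: "\<And>i. i < n \<Longrightarrow> linear_map_on (form_sum ds) (*) (l i)" by blast
  have "(\<lambda>y. \<Prod>i<m. l i (to_W y)) \<in> cfun.span (monm ` multisets_of_size I m)" if "m \<le> n" for m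
    using that
  proof (induction m)
    case 0
    have "(\<lambda>y. 1) = monm {#}" by (simp add: monm_def)
    then show ?case by (auto simp: multisets_of_size_def intro!: cfun.span_base)
  next
    case (Suc m)
    let ?g = "\<lambda>y. \<Prod>i<m. l i (to_W y)"
    have lm: "l m (to_W y) = (\<Sum>p\<in>I. y p * l m (to_W (\<delta> p)))" for y
      using Suc.prems by (intro linear_functional_to_W l) auto
    have eq: "(\<lambda>y. \<Prod>i<Suc m. l i (to_W y)) = (\<Sum>p\<in>I. fscale (l m (to_W (\<delta> p))) (mulc p ?g))"
    proof
      fix y
      have "(\<Prod>i<Suc m. l i (to_W y)) = ?g y * (\<Sum>p\<in>I. y p * l m (to_W (\<delta> p)))"
        by (simp only: prod.lessThan_Suc lm[symmetric])
      then show "(\<Prod>i<Suc m. l i (to_W y)) = (\<Sum>p\<in>I. fscale (l m (to_W (\<delta> p))) (mulc p ?g)) y"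
        by (simp add: sum_fun_apply fscale_apply mulc_def sum_distrib_left mult_ac)
    qed
    have "mulc p ?g \<in> cfun.span (monm ` multisets_of_size I (Suc m))" if p: "p \<in> I" for p
    proof (rule clinear_span_imp[OF clinear_mulc])
      show "?g \<in> cfun.span (monm ` multisets_of_size I m)" using Suc by simp
      show "mulc p g \<in> cfun.span (monm ` multisets_of_size I (Suc m))" if "g \<in> monm ` multisets_of_size I m" for g
        using that p by (auto simp: mulc_monm multisets_of_size_def intro!: cfun.span_base)
    qed
    then show ?case unfolding eq by (intro cfun.span_sum cfun.span_scale)
  qed
  from this[of n] show "(\<lambda>y. f (to_W y)) \<in> cfun.span (monm ` multisets_of_size I n)"
    by (simp add: f form_sum_eq)
qed

lemma monm_two_blocks:
  "monm (replicate_mset i (r, 0) + replicate_mset j (r, 1)) y = (to_V y $ 1) ^ i * (- to_V y $ 2) ^ j"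
  by (simp add: monm_def to_V_nth)

lemma minus_one_power_mult: "(- 1) ^ m * (x * (- y) ^ m) = x * y ^ m" for x y :: complex
  by (simp add: mult.left_commute flip: power_mult_distrib)

lemma binary_form_to_V:
  assumes "h \<in> binary_forms L"
  shows "(\<lambda>y. h (to_V y)) \<in> cfun.span (monm ` multisets_of_size {(r, 0), (r, 1)} L)"
proof (rule clinear_span_imp[OF _ _ assms[unfolded binary_forms_def]])
  show "clinear (\<lambda>f y. f (to_V y))" by (rule clinearI) (auto simp: fun_ops)
  fix h assume "h \<in> monomial_form L ` {..L}"
  then obtain i where i: "i \<le> L" "h = monomial_form L i" by blast
  have "(\<lambda>y. h (to_V y)) = fscale ((-1) ^ (L - i)) (monm (replicate_mset i (r, 0) + replicate_mset (L - i) (r, 1)))"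
    by (intro ext) (simp only: fscale_apply monm_two_blocks i monomial_form_def minus_one_power_mult)
  also have "\<dots> \<in> cfun.span (monm ` multisets_of_size {(r, 0), (r, 1)} L)"
    using i(1) by (intro cfun.span_scale cfun.span_base imageI) (auto simp: multisets_of_size_def split: if_splits)
  finally show "(\<lambda>y. h (to_V y)) \<in> cfun.span (monm ` multisets_of_size {(r, 0), (r, 1)} L)" .
qed

text \<open>Degree n in the coordinates of W and degree L in those of \<complex>^2: binary forms of
  degree L are the homogeneous polynomials of that degree on \<complex>^2.\<close>

definition bidegree_basis :: "nat \<Rightarrow> nat \<Rightarrow> (nat \<times> nat) multiset set" where
  "bidegree_basis n L = {A1 + A2 | A1 A2. A1 \<in> multisets_of_size I n \<and> A2 \<in> multisets_of_size {(r, 0), (r, 1)} L}"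

definition pull :: "((nat \<times> (complex^2) \<Rightarrow> complex) \<times> (complex^2) \<Rightarrow> complex) \<Rightarrow> coords \<Rightarrow> complex" where
  "pull f = (\<lambda>y. f (to_pair y))"

lemma clinear_pull: "clinear pull"
  by (rule clinearI) (auto simp: pull_def fun_ops)

abbreviation tensor_space where
  "tensor_space n L \<equiv> tensor (homog_polys (form_sum ds) n) (binary_forms L)"

text \<open>Conversely to the expansion of functionals in coordinates, each monomial comes from a
  product of n coordinate functionals times a monomial form. The sign (-1)^(L - i) undoes the minus
  sign in \<open>to_V\<close>.\<close>

lemma pull_tensor: "pull ` tensor_space n L = cfun.span (monm ` bidegree_basis n L)"
proof (intro subset_antisym subsetI)
  fix g assume "g \<in> pull ` tensor_space n L"
  then obtain f where f: "f \<in> tensor_space n L" "g = pull f" by blast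
  show "g \<in> cfun.span (monm ` bidegree_basis n L)"
    unfolding f(2)
  proof (rule clinear_span_imp[OF clinear_pull _ f(1)[unfolded tensor_def]])
    fix F assume "F \<in> {(\<lambda>(x, y). f x * h y) | f h. f \<in> homog_polys (form_sum ds) n \<and> h \<in> binary_forms L}"
    then obtain f h where "F = (\<lambda>(x, y). f x * h y)" "f \<in> homog_polys (form_sum ds) n" "h \<in> binary_forms L"
      by blast
    then show "pull F \<in> cfun.span (monm ` bidegree_basis n L)"
      using span_monm_mult[OF homog_poly_to_W binary_form_to_V, of f n h L]
      by (simp add: pull_def to_pair_def bidegree_basis_def)
  qed
next
  have "monm ` bidegree_basis n L \<subseteq> pull ` tensor_space n L"
  proof
    fix g assume "g \<in> monm ` bidegree_basis n L"
    then obtain A1 A2 where g: "g = monm (A1 + A2)" and A1: "A1 \<in> multisets_of_size I n"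
      and A2: "A2 \<in> multisets_of_size {(r, 0), (r, 1)} L" unfolding bidegree_basis_def by blast
    obtain ps where ps: "A1 = mset ps" by (metis ex_mset)
    have len: "length ps = n" "\<And>i. i < n \<Longrightarrow> ps ! i \<in> I"
      using A1 nth_mem by (auto simp: multisets_of_size_def ps)
    define f where "f w = (if w \<in> form_sum ds then \<Prod>i<n. coord (ps ! i) w else 0)" for w
    have f: "f \<in> homog_polys (form_sum ds) n"
      unfolding homog_polys_def f_def[abs_def]
      using len by (intro cfun.span_base CollectI exI[of _ "\<lambda>i. coord (ps ! i)"]) (auto intro: linear_coord)
    define i j where "i = count A2 (r, 0)" and "j = count A2 (r, 1)"
    have eq: "A2 = replicate_mset i (r, 0) + replicate_mset j (r, 1)"
    proof (rule multiset_eqI)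
      fix x show "count A2 x = count (replicate_mset i (r, 0) + replicate_mset j (r, 1)) x"
      proof (cases "x \<in> {(r, 0), (r, 1)}")
        case False
        then have "x \<notin># A2" using A2 by (auto simp: multisets_of_size_def)
        then show ?thesis using False by (auto simp: not_in_iff)
      qed (auto simp: i_def j_def)
    qed
    have "size A2 = i + j"
      using arg_cong[OF eq, of size] by (simp only: size_union size_replicate_mset)
    then have i: "i \<le> L" "j = L - i" using A2 by (auto simp: multisets_of_size_def)
    define h where "h = fscale ((-1) ^ (L - i)) (monomial_form L i)"
    have h: "h \<in> binary_forms L"
      unfolding h_def binary_forms_def using i(1) by (intro cfun.span_scale cfun.span_base) auto
    have "(\<lambda>(x, y). f x * h y) \<in> tensor_space n L"
      unfolding tensor_def using f h by (intro cfun.span_base) blast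
    moreover have "pull (\<lambda>(x, y). f x * h y) = g"
    proof
      fix y
      have "f (to_W y) = monm A1 y"
        using len by (simp add: f_def form_sum_eq monm_def ps coord_to_W prod_mset_prod_list
            prod.list_conv_set_nth lessThan_atLeast0 flip: mset_map)
      moreover have "h (to_V y) = monm A2 y"
        unfolding eq i(2) monm_two_blocks
        using minus_one_power_mult[of "L - i" "to_V y $ 1 ^ i" "- to_V y $ 2"]
        by (simp add: h_def fscale_apply monomial_form_def)
      ultimately show "pull (\<lambda>(x, y). f x * h y) y = g y"
        by (simp add: pull_def to_pair_def g monm_def)
    qed
    ultimately show "g \<in> pull ` tensor_space n L" by blast
  qed
  then have "cfun.span (monm ` bidegree_basis n L) \<subseteq> pull ` tensor_space n L"
    unfolding tensor_def
    by (intro cfun.span_minimal cfun_pair.linear_subspace_image[OF clinear_pull] cfun.subspace_span)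
  then show "g \<in> pull ` tensor_space n L" if "g \<in> cfun.span (monm ` bidegree_basis n L)" for g
    using that by blast
qed

text \<open>The extension by 0 in \<open>homog_polys\<close> passes to the tensor space. This is why
  \<open>pull\<close> loses nothing although \<open>to_pair\<close> reaches only pairs with w in
  \<open>form_sum ds\<close>.\<close>

lemma tensor_vanishes_outside:
  assumes "f \<in> tensor_space n L" "w \<notin> form_sum ds"
  shows "f (w, v) = 0"
proof -
  have hom: "f w = 0" if "f \<in> homog_polys (form_sum ds) n" for f
    using that unfolding homog_polys_def
    by (rule cfun.span_induct) (use assms(2) in \<open>auto simp: cfun.subspace_def fun_ops\<close>)
  show ?thesis
    using assms(1) unfolding tensor_def
    by (rule cfun.span_induct) (use hom in \<open>auto simp: cfun.subspace_def fun_ops\<close>)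
qed

lemma to_pair_surj:
  assumes "w \<in> form_sum ds"
  obtains y where "to_pair y = (w, v)"
proof -
  obtain y where y: "w = to_W y" using assms by (auto simp: form_sum_eq)
  define z where "z = y((r, 0) := v $ 1, (r, 1) := - v $ 2)"
  have "to_W z = w" unfolding y by (auto simp: to_W_def z_def fun_eq_iff)
  moreover have "to_V z = v"
    by (simp add: Finite_Cartesian_Product.vec_eq_iff forall_2 to_V_nth z_def)
  ultimately show ?thesis using that[of z] by (simp add: to_pair_def)
qed

lemma inj_pull: "inj_on pull (tensor_space n L)"
proof (rule clinear_inj_onI[OF clinear_pull])
  show "cfun.subspace (tensor_space n L)" unfolding tensor_def by (rule cfun.subspace_span)
  fix f assume f: "f \<in> tensor_space n L" "pull f = 0"
  have "f (w, v) = 0" for w v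
  proof (cases "w \<in> form_sum ds")
    case True
    then obtain y where "to_pair y = (w, v)" by (rule to_pair_surj)
    then show ?thesis using fun_cong[OF f(2), of y] by (simp add: pull_def zero_fun_apply)
  qed (rule tensor_vanishes_outside[OF f(1)])
  then show "f = 0" by (auto simp: fun_ops)
qed

text \<open>Invariance is an equation between functions on all pairs. Where w is not a tuple of
  forms, this stability makes both sides 0.\<close>

lemma actW_form_sum_iff:
  assumes "g = mat2 1 s 0 1 \<or> g = mat2 1 0 s 1"
  shows "actW g w \<in> form_sum ds \<longleftrightarrow> w \<in> form_sum ds"
proof -
  have fwd: "actW g w \<in> form_sum ds" if g: "g = mat2 1 s 0 1 \<or> g = mat2 1 0 s 1" and w: "w \<in> form_sum ds" for g s w
  proof -
    obtain y where y: "to_pair y = (w, 0)" using to_pair_surj[OF w] .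
    have "pair_act g (to_pair y) \<in> range to_pair"
      using g by (auto simp flip: to_pair_flow_down to_pair_flow_up)
    then obtain z where "pair_act g (to_pair y) = to_pair z" by blast
    then have "actW g w = to_W z" unfolding y by (simp add: pair_act_def to_pair_def)
    then show ?thesis by (simp add: form_sum_eq)
  qed
  have g: "g \<in> SL2" using assms by (auto simp: mat2_in_SL2)
  have inv: "matrix_inv g = mat2 1 (- s) 0 1 \<or> matrix_inv g = mat2 1 0 (- s) 1"
    using assms SL2_inv(5)[OF g, of 1 1 s 0] SL2_inv(5)[OF g, of 1 1 0 s] by auto
  have "actW (matrix_inv g) (actW g w) = w"
    by (subst actW_mult[symmetric])
       (auto simp: SL2_inv g fun_eq_iff actW_apply matrix_inv_eqI[where B = "Finite_Cartesian_Product.mat 1"])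
  then show ?thesis using fwd[OF assms] fwd[OF inv] by metis
qed

text \<open>Along an orbit of a unipotent one-parameter group, \<open>derivation_curve\<close> gives
  the derivative of f. For an invariant f its vanishing at s = 0, with an arbitrary starting point,
  says that the derivation kills f; if the derivation kills f, then f is constant in s.\<close>

lemma covariant_iff:
  assumes f: "f \<in> tensor_space n L"
  shows "f \<in> covariants ds L n \<longleftrightarrow>
    derivation (coef_up d) idx_up (pull f) = 0 \<and> derivation (coef_down d) idx_down (pull f) = 0"
proof -
  have eq: "(\<lambda>g (w, v). (actW g w, g *v v)) = pair_act" by (simp add: pair_act_def fun_eq_iff)
  have polys: "pull f \<in> polys"
    using pull_tensor f cfun.span_mono[of "monm ` bidegree_basis n L" "range monm"] by blast
  have flow: "(\<forall>s x. f (pair_act (g s) x) = f x) \<longleftrightarrow> derivation c \<sigma> (pull f) = 0"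
    if g: "\<And>s. g s = mat2 1 s 0 1 \<or> g s = mat2 1 0 s 1"
      and \<gamma>: "\<And>s y. to_pair (\<gamma> s y) = pair_act (g s) (to_pair y)" "\<And>y. \<gamma> 0 y = y"
      "\<And>s y p. ((\<lambda>s. \<gamma> s y p) has_field_derivative c p * \<gamma> s y (\<sigma> p)) (at s)" for g c \<sigma> \<gamma>
  proof
    have D: "((\<lambda>s. pull f (\<gamma> s y)) has_field_derivative derivation c \<sigma> (pull f) (\<gamma> s y)) (at s)" for s y
      by (rule derivation_curve[OF polys, where \<gamma> = "\<lambda>s. \<gamma> s y"]) (rule \<gamma>(3))
    {
      assume inv: "\<forall>s x. f (pair_act (g s) x) = f x"
      show "derivation c \<sigma> (pull f) = 0"
      proof
        fix y
        have "((\<lambda>s. pull f (\<gamma> s y)) has_field_derivative 0) (at 0)"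
          by (simp add: pull_def \<gamma>(1) inv del: split_paired_All)
        then show "derivation c \<sigma> (pull f) y = 0 y"
          using DERIV_unique[OF D[of y 0]] by (simp add: \<gamma>(2) zero_fun_apply)
      qed
    next
      assume zero: "derivation c \<sigma> (pull f) = 0"
      show "\<forall>s x. f (pair_act (g s) x) = f x"
      proof (intro allI)
        fix s and x :: "(nat \<times> (complex^2) \<Rightarrow> complex) \<times> (complex^2)"
        obtain w v where x: "x = (w, v)" by (cases x)
        show "f (pair_act (g s) x) = f x"
        proof (cases "w \<in> form_sum ds")
          case True
          then obtain y where y: "to_pair y = x" unfolding x by (rule to_pair_surj)
          have "((\<lambda>s. pull f (\<gamma> s y)) has_field_derivative 0) (at s within UNIV)" for s
            using D[of y s] by (simp add: zero zero_fun_apply)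
          then obtain C where "\<And>s. pull f (\<gamma> s y) = C"
            using has_field_derivative_zero_constant[of UNIV "\<lambda>s. pull f (\<gamma> s y)"] by auto
          then have "pull f (\<gamma> s y) = pull f (\<gamma> 0 y)" by simp
          then show ?thesis by (simp add: pull_def \<gamma> y)
        next
          case False
          then have "actW (g s) w \<notin> form_sum ds" using actW_form_sum_iff[OF g] by blast
          then show ?thesis
            using tensor_vanishes_outside[OF f] False by (simp add: x pair_act_def)
        qed
      qed
    }
  qed
  have "f \<in> covariants ds L n \<longleftrightarrow> (\<forall>g\<in>SL2. translate pair_act g f = f)"
    using f by (simp add: covariants_def invariants_def eq)
  also have "\<dots> \<longleftrightarrow> (\<forall>s x. f (pair_act (mat2 1 s 0 1) x) = f x) \<and> (\<forall>s x. f (pair_act (mat2 1 0 s 1) x) = f x)"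
    unfolding translate_pair_act_invariant_iff by blast
  also have "(\<forall>s x. f (pair_act (mat2 1 s 0 1) x) = f x) \<longleftrightarrow> derivation (coef_down d) idx_down (pull f) = 0"
    by (rule flow[where \<gamma> = "flow_down d"]) (auto simp: to_pair_flow_down flow_0 flow_down_deriv)
  also have "(\<forall>s x. f (pair_act (mat2 1 0 s 1) x) = f x) \<longleftrightarrow> derivation (coef_up d) idx_up (pull f) = 0"
    by (rule flow[where \<gamma> = "flow_up d"]) (auto simp: to_pair_flow_up flow_0 flow_up_deriv)
  finally show ?thesis by blast
qed

lemma pull_covariants: "pull ` covariants ds L n = {f \<in> cfun.span (monm ` bidegree_basis n L).
    derivation (coef_up d) idx_up f = 0 \<and> derivation (coef_down d) idx_down f = 0}"
proof -
  have "covariants ds L n \<subseteq> tensor_space n L" by (auto simp: covariants_def invariants_def)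
  then show ?thesis unfolding pull_tensor[symmetric] using covariant_iff by blast
qed

lemma subspace_covariants: "cfun.subspace (covariants ds L n)"
  using cfun.subspace_span[of "{(\<lambda>(x, y). f x * h y) | f h. f \<in> homog_polys (form_sum ds) n \<and> h \<in> binary_forms L}"]
  unfolding covariants_def invariants_def tensor_def[symmetric]
  by (auto simp: cfun.subspace_def translate_def fun_ops)

text \<open>The bidegree depends only on the blocks to which the coordinates belong, so it is a
  condition on \<open>image_mset fst\<close>, the form that \<open>dim_lie_invariants\<close>
  expects.\<close>

lemma bidegree_basis_eq:
  "bidegree_basis n L = {A. set_mset A \<subseteq> {(k, i). k \<le> r \<and> i \<le> d k} \<and>
    image_mset fst A \<in> {K. size (filter_mset (\<lambda>k. k < r) K) = n \<and> size (filter_mset (\<lambda>k. \<not> k < r) K) = L}}"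
proof (intro subset_antisym subsetI)
  fix A assume "A \<in> bidegree_basis n L"
  then obtain A1 A2 where A: "A = A1 + A2" and A1: "A1 \<in> multisets_of_size I n"
    and A2: "A2 \<in> multisets_of_size {(r, 0), (r, 1)} L" unfolding bidegree_basis_def by blast
  have "filter_mset (\<lambda>k. k < r) (image_mset fst A1) = image_mset fst A1"
    "filter_mset (\<lambda>k. \<not> k < r) (image_mset fst A1) = {#}"
    "filter_mset (\<lambda>k. k < r) (image_mset fst A2) = {#}"
    "filter_mset (\<lambda>k. \<not> k < r) (image_mset fst A2) = image_mset fst A2"
    using A1 A2 by (auto simp: multisets_of_size_def I_def filter_mset_eq_conv)
  then show "A \<in> {A. set_mset A \<subseteq> {(k, i). k \<le> r \<and> i \<le> d k} \<and>
    image_mset fst A \<in> {K. size (filter_mset (\<lambda>k. k < r) K) = n \<and> size (filter_mset (\<lambda>k. \<not> k < r) K) = L}}"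
    using A1 A2 by (auto simp: A multisets_of_size_def I_def d_def)
next
  fix A assume A: "A \<in> {A. set_mset A \<subseteq> {(k, i). k \<le> r \<and> i \<le> d k} \<and>
    image_mset fst A \<in> {K. size (filter_mset (\<lambda>k. k < r) K) = n \<and> size (filter_mset (\<lambda>k. \<not> k < r) K) = L}}"
  have "filter_mset (\<lambda>p. fst p < r) A \<in> multisets_of_size I n"
    using A by (auto simp: multisets_of_size_def I_def filter_mset_image_mset)
  moreover have "filter_mset (\<lambda>p. \<not> fst p < r) A \<in> multisets_of_size {(r, 0), (r, 1)} L"
    using A by (auto simp: multisets_of_size_def filter_mset_image_mset d_def split: if_splits)
  ultimately show "A \<in> bidegree_basis n L"
    unfolding bidegree_basis_def using multiset_partition[of A "\<lambda>p. fst p < r"] by blast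
qed

text \<open>The second index runs downwards because \<open>coord_weight\<close> decreases in it
  while \<open>weights\<close> is increasing.\<close>

definition idx :: "(nat \<times> nat) list" where
  "idx = concat (map (\<lambda>k. map (\<lambda>i. (k, i)) (rev [0..<d k + 1])) [0..<r])"

lemma idx: "distinct idx" "set idx = I" "map (coord_weight d) idx = concat (map weights ds)"
proof -
  have "distinct (concat (map (\<lambda>k. map (\<lambda>i. (k, i)) (rev [0..<d k + 1])) ks))" if "distinct ks" for ks
    using that by (induction ks) (auto simp: distinct_map inj_on_def simp del: upt_Suc)
  then show "distinct idx" by (simp add: idx_def del: upt_Suc)
  show "set idx = I" by (force simp: idx_def I_def)
  have w: "map (coord_weight d) (map (\<lambda>i. (k, i)) (rev [0..<d k + 1])) = weights (d k)" for k
  proof (rule nth_equalityI)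
    fix i assume "i < length (map (coord_weight d) (map (\<lambda>i. (k, i)) (rev [0..<d k + 1])))"
    then show "map (coord_weight d) (map (\<lambda>i. (k, i)) (rev [0..<d k + 1])) ! i = weights (d k) ! i"
      by (simp add: weights_def coord_weight_def rev_nth of_nat_diff del: upt_Suc)
  qed (simp add: weights_def)
  have "map (coord_weight d) idx = concat (map (\<lambda>k. weights (d k)) [0..<r])"
    unfolding idx_def map_concat map_map o_def using w by (simp add: o_def del: upt_Suc)
  also have "map (\<lambda>k. weights (d k)) [0..<r] = map weights ds"
    by (rule nth_equalityI) (auto simp: d_def)
  finally show "map (coord_weight d) idx = concat (map weights ds)" .
qed

text \<open>Invariants of the tensor product are counted by the weights 0 and 2 in bidegree (n, L);
  telescoping over the weights of V_L expresses this by weights of \<complex>[W]_n alone.\<close>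

lemma dim_covariants:
  "int (cfun.dim (covariants ds L n)) =
    int (cnt (concat (map weights ds)) n (- int L)) - int (cnt (concat (map weights ds)) n (int L + 2))"
proof -
  interpret sl2_coordinates "{(k, i). k \<le> r \<and> i \<le> d k}" fst "coord_weight d"
    "coef_up d" "coef_down d" idx_up idx_down by (rule sl2_coordinates_forms)
  have count: "finite (bidegree_basis n L)"
    "int (card {A \<in> bidegree_basis n L. weight_mset (coord_weight d) A = 0}) -
     int (card {A \<in> bidegree_basis n L. weight_mset (coord_weight d) A = 2}) =
     int (cnt (concat (map weights ds)) n (- int L)) - int (cnt (concat (map weights ds)) n (int L + 2))"
    using card_multisets_two_blocks[of idx "(r, 0)" "(r, 1)" "coord_weight d" n L]
    unfolding idx bidegree_basis_def[symmetric] by (auto simp: idx I_def coord_weight_def d_def)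
  have "cfun.dim (covariants ds L n) = cfun.dim (pull ` covariants ds L n)"
  proof (rule dim_image_inj[OF clinear_pull subspace_covariants, symmetric])
    show "inj_on pull (covariants ds L n)"
      by (rule inj_on_subset[OF inj_pull]) (auto simp: covariants_def invariants_def)
  qed
  then show ?thesis
    using dim_lie_invariants[OF count(1)[unfolded bidegree_basis_eq]] count(2)
    unfolding pull_covariants bidegree_basis_eq by simp
qed

end

section \<open>The weights of \<open>W\<close>\<close>

lemma rev_weights: "map uminus (weights d) = rev (weights d)"
  by (rule nth_equalityI) (auto simp: weights_def rev_nth of_nat_diff simp del: upt_Suc)

lemma weights_symmetric: "image_mset uminus (mset (concat (map weights ds))) = mset (concat (map weights ds))"
proof (induction ds)
  case (Cons d ds)
  have "image_mset uminus (mset (weights d)) = mset (weights d)"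
    using arg_cong[OF rev_weights[of d], of mset] by simp
  then show ?case using Cons by simp
qed simp

lemma subset_mset_positive_weights:
  fixes S :: "int set"
  assumes "\<And>m. m \<in> S \<Longrightarrow> 0 < m \<and> m \<le> int d \<and> even (int d - m)"
  shows "mset_set S \<subseteq># mset (filter (\<lambda>m. 0 < m) (weights d))"
proof -
  have "distinct (weights d)" by (simp add: weights_def distinct_map inj_on_def del: upt_Suc)
  then have "mset (filter (\<lambda>m. 0 < m) (weights d)) = mset_set (set (filter (\<lambda>m. 0 < m) (weights d)))"
    by (intro mset_set_set[symmetric] distinct_filter)
  moreover have "S \<subseteq> set (filter (\<lambda>m. 0 < m) (weights d))"
  proof
    fix m assume "m \<in> S"
    then have m: "0 < m" "m \<le> int d" "even (int d - m)" using assms by auto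
    define i where "i = nat ((int d + m) div 2)"
    have "even (int d + m)" using m(3) by simp
    then have "2 * int i = int d + m" using m(1) by (simp add: i_def)
    then have "i < d + 1" "m = 2 * int i - int d" using m(2) by auto
    then show "m \<in> set (filter (\<lambda>m. 0 < m) (weights d))"
      using m(1) by (auto simp: weights_def simp del: upt_Suc)
  qed
  ultimately show ?thesis by (simp add: subset_imp_msubset_mset_set del: set_filter)
qed

lemma mset_positive_weights:
  "mset (positive_weights ds) = (\<Sum>d\<in>#mset ds. mset (filter (\<lambda>m. 0 < m) (weights d)))"
  by (induction ds) (auto simp: positive_weights_def)

text \<open>The smallest positive weight of a nontrivial summand is 1 or 2 according to the parity
  of its degree, and distinct summands provide it separately.\<close>

lemma positive_weights_two:
  assumes "add_mset d (add_mset d' M) = mset ds" "0 < d" "0 < d'"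
  shows "{#if odd d then 1 else 2, if odd d' then 1 else 2#} \<subseteq># mset (positive_weights ds)"
proof -
  have one: "{#if odd d then 1 else 2#} \<subseteq># mset (filter (\<lambda>m. 0 < m) (weights d))" if "0 < d" for d
    using subset_mset_positive_weights[of "{if odd d then 1 else 2}" d] that by (cases "odd d") (auto elim!: evenE)
  have "{#if odd d then 1 else 2#} + {#if odd d' then 1 else 2#} \<subseteq>#
      mset (filter (\<lambda>m. 0 < m) (weights d)) + mset (filter (\<lambda>m. 0 < m) (weights d'))"
    by (intro subset_mset.add_mono one assms)
  also have "\<dots> \<subseteq># mset (positive_weights ds)"
    unfolding mset_positive_weights assms(1)[symmetric] by (simp add: add.assoc[symmetric])
  finally show ?thesis by (simp add: add_mset_commute)
qed

text \<open>A summand of degree 0 consists of constants, which are invariant.\<close>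

lemma zero_notin_of_no_invariants:
  assumes "invariants actW (form_sum ds) = {0}"
  shows "0 \<notin> set ds"
proof
  assume "0 \<in> set ds"
  then obtain k where k: "k < length ds" "ds ! k = 0" by (metis in_set_conv_nth)
  define w :: "nat \<times> (complex^2) \<Rightarrow> complex" where "w = (\<lambda>(j, v). if j = k then 1 else 0)"
  have "(\<lambda>v. w (j, v)) \<in> binary_forms (ds ! j)" for j
  proof (cases "j = k")
    case True
    have "(\<lambda>v. w (j, v)) = monomial_form 0 0" by (simp add: True w_def monomial_form_def)
    then show ?thesis using True k(2) by (simp add: binary_forms_def cfun.span_base)
  next
    case False
    then have "(\<lambda>v. w (j, v)) = 0" by (simp add: w_def fun_ops)
    then show ?thesis by (simp add: binary_forms_def cfun.span_zero)
  qed
  then have "w \<in> form_sum ds" using k(1) by (auto simp: form_sum_def w_def)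
  moreover have "actW g w = w" for g by (auto simp: fun_eq_iff actW_apply w_def)
  ultimately have "w \<in> invariants actW (form_sum ds)" by (simp add: invariants_def)
  then have "w (k, 0) = 0" using assms by (simp add: zero_fun_apply)
  then show False by (simp add: w_def)
qed

lemma module_iso_single: "module_iso actW (form_sum [d]) actV (binary_forms d)"
  unfolding module_iso_def
proof (intro exI conjI ballI)
  define \<phi> where "\<phi> w = (\<lambda>v. w (0, v))" for w :: "nat \<times> (complex^2) \<Rightarrow> complex"
  show "linear_map_on (form_sum [d]) fscale \<phi>"
    by (simp add: linear_map_on_def \<phi>_def fun_ops)
  show "bij_betw \<phi> (form_sum [d]) (binary_forms d)"
  proof (rule bij_betw_byWitness[where f' = "\<lambda>f (k, v). if k = 0 then f v else 0"])
    show "\<forall>w\<in>form_sum [d]. (\<lambda>(k, v). if k = 0 then \<phi> w v else 0) = w"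
      by (auto simp: form_sum_def \<phi>_def fun_eq_iff)
  qed (auto simp: form_sum_def \<phi>_def)
  show "\<phi> (actW g u) = actV g (\<phi> u)" for g u
    by (simp add: \<phi>_def actW_apply actV_def translate_def)
qed

theorem theorem3p7:
  fixes ds :: "nat list" and L :: nat and a :: "int list" and C :: nat
  assumes "ds \<noteq> []"
    and "invariants actW (form_sum ds) = {0}"
    and "\<forall>d\<le>4. \<not> module_iso actW (form_sum ds) actV (binary_forms d)"
    and "\<not> module_iso actW (form_sum ds) actW (form_sum [1, 1])"
    and "a = positive_weights ds"
    and "C = length a"
  shows "((\<exists>d\<in>set ds. odd d) \<longrightarrow>
           gamma_coeff ds 0 L = of_nat (L + 1) * gamma_coeff ds 0 0 \<and>
           of_nat (L + 1) * gamma_coeff ds 0 0 =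
             of_nat (L + 1) * schur (rho C) a / schur (delta C) a) \<and>
         ((\<forall>d\<in>set ds. even d) \<longrightarrow>
           gamma_coeff ds 0 L = (1 + (-1) ^ L) * of_nat (L + 1) * gamma_coeff ds 0 0 / 2 \<and>
           (1 + (-1) ^ L) * of_nat (L + 1) * gamma_coeff ds 0 0 / 2 =
             (1 + (-1) ^ L) * of_nat (L + 1) * schur (rho C) a / schur (delta C) a)"
proof -
  define ms where "ms = concat (map weights ds)"
  have a: "a = filter (\<lambda>m. 0 < m) ms" by (simp add: assms(5) positive_weights_def ms_def)
  interpret forms ds .
  have dim: "cfun.dim (form_sum ds) = length ms"
    using idx distinct_card[of idx] unfolding dim_form_sum ms_def by (metis length_map)
  have hilbert: "hilbert_series ds l = genf ms (- int l) - genf ms (int l + 2)" for l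
  proof (rule fps_ext)
    fix n
    have "of_nat (cfun.dim (covariants ds l n)) = (of_int (int (cfun.dim (covariants ds l n))) :: complex)" by simp
    also have "\<dots> = of_nat (cnt ms n (- int l)) - of_nat (cnt ms n (int l + 2))"
      unfolding dim_covariants by (simp add: ms_def)
    finally show "fps_nth (hilbert_series ds l) n = fps_nth (genf ms (- int l) - genf ms (int l + 2)) n"
      by (simp add: hilbert_series_def genf_def)
  qed
  have pos: "0 < d" if "d \<in> set ds" for d
    using zero_notin_of_no_invariants[OF assms(2)] that by (metis gr0I)
  have single: "4 < d" if "ds = [d]" for d
    using assms(3) module_iso_single[of d] that by (metis not_less)
  have conclusion: "gamma_coeff ds 0 l = (if p = 1 then 1 else 1 + (-1) ^ l) * of_nat (l + 1) *
      (schur (rho C) a / schur (delta C) a)"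
    if sub: "add_mset p A \<subseteq># mset a" and A: "A = {#p#} \<or> A = {#2#} \<or> A = {#q, q + 2#}"
      and p: "p = 1 \<or> p = 2 \<and> (\<forall>m\<in>set ms. even m)" for p A q l
  proof -
    have "2 \<le> length a" using size_mset_mono[OF sub] A by auto
    then have "schur (rho C) a / schur (delta C) a = of_real (lap_integral (map of_int a))"
      using schur_rho_eq[of a] by (simp add: assms(6)) (simp add: a)
    moreover have "gamma_coeff ds 0 l = fls_nth (laurent_at_one (genf ms (- int l) - genf ms (int l + 2))) (3 - int (length ms))"
      by (simp add: gamma_coeff_def hilbert dim)
    ultimately show ?thesis
      using laurent_coeff_genf[OF weights_symmetric[of ds, folded ms_def] sub[unfolded a] A p, of l]
      by (simp add: a)
  qed
  show ?thesis
  proof (intro conjI[of "_ \<longrightarrow> _"] impI)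
    assume "\<exists>d\<in>set ds. odd d"
    then obtain d where d: "d \<in> set ds" "odd d" by blast
    \<comment> \<open>The odd summand has the weight 1. If it is alone, its degree is at least 5 and
      the weights 3 and 5 occur too; otherwise a second summand adds a weight 1 or 2.\<close>
    have "\<exists>A q. add_mset 1 A \<subseteq># mset a \<and> (A = {#1#} \<or> A = {#2#} \<or> A = {#q, q + 2#})"
    proof (cases "ds = [d]")
      case True
      then have "{1, 3, 5} \<subseteq> {m. 0 < m \<and> m \<le> int d \<and> even (int d - m)}"
        using single d(2) by (auto elim!: oddE)
      then have "mset_set {1, 3, 5} \<subseteq># mset (filter (\<lambda>m. 0 < m) (weights d))"
        by (intro subset_mset_positive_weights) auto
      then have "add_mset 1 {#3, 3 + 2#} \<subseteq># mset a"
        by (simp add: True assms(5) positive_weights_def add_mset_commute)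
      then show ?thesis by blast
    next
      case False
      obtain M where M: "mset ds = add_mset d M" using d(1) by (metis insert_DiffM set_mset_mset)
      have "M \<noteq> {#}"
        using M False by (auto simp: mset_single_iff_right)
      then obtain d' M' where M': "M = add_mset d' M'" by (meson multiset_cases)
      have "d' \<in># mset ds" by (simp add: M M')
      then have d': "d' \<in> set ds" by simp
      have "{#if odd d then 1 else 2, if odd d' then 1 else 2#} \<subseteq># mset a"
        unfolding assms(5) using pos[OF d(1)] pos[OF d']
        by (intro positive_weights_two[of d d' M']) (auto simp: M M')
      then have "add_mset 1 {#if odd d' then 1 else 2#} \<subseteq># mset a"
        using d(2) by simp
      then show ?thesis by (metis (full_types))
    qed
    then obtain A q where "add_mset 1 A \<subseteq># mset a" "A = {#1#} \<or> A = {#2#} \<or> A = {#q, q + 2#}" by blast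
    note * = conclusion[OF this, simplified]
    show "gamma_coeff ds 0 L = of_nat (L + 1) * gamma_coeff ds 0 0 \<and>
        of_nat (L + 1) * gamma_coeff ds 0 0 = of_nat (L + 1) * schur (rho C) a / schur (delta C) a"
      using *[of L] *[of 0] by simp
  next
    assume even: "\<forall>d\<in>set ds. even d"
    have even_ms: "\<forall>m\<in>set ms. even m"
      using even by (auto simp: ms_def weights_def simp del: upt_Suc)
    \<comment> \<open>A single even summand has degree at least 6, hence the weights 2, 4 and 6; two
      summands give the weight 2 twice.\<close>
    have "\<exists>A q. add_mset 2 A \<subseteq># mset a \<and> (A = {#2#} \<or> A = {#q, q + 2#})"
    proof (cases "length ds = 1")
      case True
      then obtain d where ds: "ds = [d]" by (auto simp: length_Suc_conv)
      then have "even d" "4 < d" using even single by auto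
      then have "{2, 4, 6} \<subseteq> {m. 0 < m \<and> m \<le> int d \<and> even (int d - m)}"
        by (auto elim!: evenE)
      then have "mset_set {2, 4, 6} \<subseteq># mset (filter (\<lambda>m. 0 < m) (weights d))"
        by (intro subset_mset_positive_weights) auto
      then have "add_mset 2 {#4, 4 + 2#} \<subseteq># mset a"
        by (simp add: ds assms(5) positive_weights_def add_mset_commute)
      then show ?thesis by blast
    next
      case False
      then obtain d d' ds' where ds: "ds = d # d' # ds'"
        using assms(1) by (metis One_nat_def length_0_conv length_Suc_conv neq_Nil_conv)
      have "{#if odd d then 1 else 2, if odd d' then 1 else 2#} \<subseteq># mset a"
        unfolding assms(5) using pos by (intro positive_weights_two[of d d' "mset ds'"]) (auto simp: ds)
      then have "add_mset 2 {#2#} \<subseteq># mset a" using even by (simp add: ds)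
      then show ?thesis by blast
    qed
    then obtain A q where "add_mset 2 A \<subseteq># mset a" "A = {#2#} \<or> A = {#2#} \<or> A = {#q, q + 2#}" by blast
    \<comment> \<open>At l = 0 the factor 1 + (-1)^l equals 2, which is why half of \<gamma>_0
      enters the formula.\<close>
    note * = conclusion[OF this, simplified, OF even_ms]
    show "gamma_coeff ds 0 L = (1 + (-1) ^ L) * of_nat (L + 1) * gamma_coeff ds 0 0 / 2 \<and>
           (1 + (-1) ^ L) * of_nat (L + 1) * gamma_coeff ds 0 0 / 2 =
             (1 + (-1) ^ L) * of_nat (L + 1) * schur (rho C) a / schur (delta C) a"
      using *[of L] *[of 0] by simp
  qed
qed

end
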